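(* Let $R\subseteq S$ be an étale, infra-integral Gilmer extension. Then $R\subseteq S$ has FIP if and only if the nucleus $R/(R:S)$ is a FMIR and, for each $M\in\mathrm{Supp}_R(S/R)$ such that $R_M$ is an infinite SPIR, the number of prime ideals of $S$ lying over $M$ is $2$.
   Context: Rings are commutative with identity. $(R:S)=\{r\in R\mid rS\subseteq R\}$; Gilmer extension: $R/(R:S)$ Artinian. Étale: flat, of finite presentation, unramified. Infra-integral: integral with all residual field extensions isomorphisms. FIP: finitely many $R$-subalgebras of $S$. A FMIR is a ring with only finitely many ideals. A SPIR is a local ring $R$ which is not a field, whose maximal ideal $M$ is principal and nilpotent (so $M$ is its unique prime ideal). *)

theory Defs
  imports "HOL-Algebra.Algebra"
begin

text \<open>Setting: S is a commutative ring (HOL-Algebra record), and R is the carrier of a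
  subring of S; the ring extension is R \<subseteq> S. The ring R itself is S restricted to R.\<close>

abbreviation subR :: "'a ring \<Rightarrow> 'a set \<Rightarrow> 'a ring" where
  "subR S R \<equiv> S\<lparr>carrier := R\<rparr>"

definition conductor :: "'a ring \<Rightarrow> 'a set \<Rightarrow> 'a set" where
  "conductor S R = {r \<in> R. \<forall>s \<in> carrier S. r \<otimes>\<^bsub>S\<^esub> s \<in> R}"

definition artinian :: "('b, 'c) ring_scheme \<Rightarrow> bool" where
  "artinian A \<longleftrightarrow> \<not> (\<exists>f. \<forall>n. ideal (f n) A \<and> f (Suc n) \<subset> f n)"

definition gilmer_ext :: "'a ring \<Rightarrow> 'a set \<Rightarrow> bool" where
  "gilmer_ext S R \<longleftrightarrow> artinian (subR S R Quot conductor S R)"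

definition FMIR :: "('b, 'c) ring_scheme \<Rightarrow> bool" where
  "FMIR A \<longleftrightarrow> finite {I. ideal I A}"

definition FIP :: "'a ring \<Rightarrow> 'a set \<Rightarrow> bool" where
  "FIP S R \<longleftrightarrow> finite {T. subring T S \<and> R \<subseteq> T}"

definition integral_ext :: "'a ring \<Rightarrow> 'a set \<Rightarrow> bool" where
  "integral_ext S R \<longleftrightarrow> (\<forall>s \<in> carrier S. \<exists>n c. (\<forall>i<n. c i \<in> R) \<and>
      s [^]\<^bsub>S\<^esub> (n::nat) \<oplus>\<^bsub>S\<^esub> (\<Oplus>\<^bsub>S\<^esub> i \<in> {..<n}. c i \<otimes>\<^bsub>S\<^esub> s [^]\<^bsub>S\<^esub> (i::nat)) = \<zero>\<^bsub>S\<^esub>)"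

text \<open>Residual extension at a prime Q of S (lying over P = Q \<inter> R):
  the natural map kappa(P) = Frac(R/P) \<rightarrow> kappa(Q) = Frac(S/Q) is always injective; it is an
  isomorphism iff every class of S/Q is a quotient of classes of R/P, i.e. for every s there are
  a, b in R with b \<notin> Q and b s - a \<in> Q.\<close>
definition residually_iso :: "'a ring \<Rightarrow> 'a set \<Rightarrow> 'a set \<Rightarrow> bool" where
  "residually_iso S R Q \<longleftrightarrow> (\<forall>s \<in> carrier S. \<exists>a \<in> R. \<exists>b \<in> R. b \<notin> Q \<and>
      b \<otimes>\<^bsub>S\<^esub> s \<ominus>\<^bsub>S\<^esub> a \<in> Q)"

definition infra_integral :: "'a ring \<Rightarrow> 'a set \<Rightarrow> bool" where
  "infra_integral S R \<longleftrightarrow> integral_ext S R \<and>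
      (\<forall>Q. primeideal Q S \<longrightarrow> residually_iso S R Q)"

text \<open>Polynomials in n variables X_0..X_{n-1} with coefficients in R, as finitely supported
  coefficient functions on exponent vectors.\<close>
definition mpolys :: "'a ring \<Rightarrow> 'a set \<Rightarrow> nat \<Rightarrow> ((nat \<Rightarrow> nat) \<Rightarrow> 'a) set" where
  "mpolys S R n = {p. (\<forall>m. p m \<in> R) \<and> finite {m. p m \<noteq> \<zero>\<^bsub>S\<^esub>} \<and>
                      (\<forall>m. p m \<noteq> \<zero>\<^bsub>S\<^esub> \<longrightarrow> (\<forall>i\<ge>n. m i = 0))}"

definition mp_eval :: "'a ring \<Rightarrow> nat \<Rightarrow> (nat \<Rightarrow> 'a) \<Rightarrow> ((nat \<Rightarrow> nat) \<Rightarrow> 'a) \<Rightarrow> 'a" where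
  "mp_eval S n s p = (\<Oplus>\<^bsub>S\<^esub> m \<in> {m. p m \<noteq> \<zero>\<^bsub>S\<^esub>}.
       p m \<otimes>\<^bsub>S\<^esub> (\<Otimes>\<^bsub>S\<^esub> i \<in> {..<n}. s i [^]\<^bsub>S\<^esub> (m i :: nat)))"

definition mp_mult :: "'a ring \<Rightarrow> ((nat \<Rightarrow> nat) \<Rightarrow> 'a) \<Rightarrow> ((nat \<Rightarrow> nat) \<Rightarrow> 'a) \<Rightarrow> ((nat \<Rightarrow> nat) \<Rightarrow> 'a)" where
  "mp_mult S p q = (\<lambda>m. \<Oplus>\<^bsub>S\<^esub> ab \<in> {(a, b). p a \<noteq> \<zero>\<^bsub>S\<^esub> \<and> q b \<noteq> \<zero>\<^bsub>S\<^esub> \<and> (\<lambda>i. a i + b i) = m}.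
       p (fst ab) \<otimes>\<^bsub>S\<^esub> q (snd ab))"

definition finite_type :: "'a ring \<Rightarrow> 'a set \<Rightarrow> bool" where
  "finite_type S R \<longleftrightarrow> (\<exists>n s. (\<forall>i<n. s i \<in> carrier S) \<and>
      (\<forall>x \<in> carrier S. \<exists>p \<in> mpolys S R n. mp_eval S n s p = x))"

text \<open>S \<cong> R[X_0..X_{n-1}]/J with J a finitely generated ideal: the kernel of the surjective
  R-algebra map X_i \<mapsto> s i is generated by a finite set G.\<close>
definition finitely_presented :: "'a ring \<Rightarrow> 'a set \<Rightarrow> bool" where
  "finitely_presented S R \<longleftrightarrow> (\<exists>n s. (\<forall>i<n. s i \<in> carrier S) \<and>
      (\<forall>x \<in> carrier S. \<exists>p \<in> mpolys S R n. mp_eval S n s p = x) \<and>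
      (\<exists>G. finite G \<and> G \<subseteq> {p \<in> mpolys S R n. mp_eval S n s p = \<zero>\<^bsub>S\<^esub>} \<and>
         (\<forall>p \<in> {p \<in> mpolys S R n. mp_eval S n s p = \<zero>\<^bsub>S\<^esub>}.
            \<exists>h. (\<forall>g \<in> G. h g \<in> mpolys S R n) \<and>
                p = (\<lambda>m. \<Oplus>\<^bsub>S\<^esub> g \<in> G. mp_mult S (h g) g m))))"

text \<open>Tensor product A \<otimes>_R S for an R-submodule A of R: the free abelian group on A \<times> S
  (finitely supported integer functions) modulo the subgroup tens_rel generated by the
  bilinearity and R-balancedness relations.\<close>
definition indic :: "'x \<Rightarrow> 'x \<Rightarrow> int" where
  "indic a p = (if p = a then 1 else 0)"

inductive_set tens_rel :: "'a ring \<Rightarrow> 'a set \<Rightarrow> 'a set \<Rightarrow> (('a \<times> 'a) \<Rightarrow> int) set"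
  for S :: "'a ring" and R :: "'a set" and A :: "'a set" where
  zero: "(\<lambda>_. 0) \<in> tens_rel S R A"
| add: "f \<in> tens_rel S R A \<Longrightarrow> g \<in> tens_rel S R A \<Longrightarrow> (\<lambda>p. f p + g p) \<in> tens_rel S R A"
| neg: "f \<in> tens_rel S R A \<Longrightarrow> (\<lambda>p. - f p) \<in> tens_rel S R A"
| lin1: "x \<in> A \<Longrightarrow> y \<in> A \<Longrightarrow> s \<in> carrier S \<Longrightarrow>
     (\<lambda>p. indic (x \<oplus>\<^bsub>S\<^esub> y, s) p - indic (x, s) p - indic (y, s) p) \<in> tens_rel S R A"
| lin2: "x \<in> A \<Longrightarrow> s \<in> carrier S \<Longrightarrow> t \<in> carrier S \<Longrightarrow>
     (\<lambda>p. indic (x, s \<oplus>\<^bsub>S\<^esub> t) p - indic (x, s) p - indic (x, t) p) \<in> tens_rel S R A"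
| bal: "r \<in> R \<Longrightarrow> x \<in> A \<Longrightarrow> s \<in> carrier S \<Longrightarrow>
     (\<lambda>p. indic (r \<otimes>\<^bsub>S\<^esub> x, s) p - indic (x, r \<otimes>\<^bsub>S\<^esub> s) p) \<in> tens_rel S R A"

text \<open>S is a flat R-module: for every ideal I of R the induced map I \<otimes>_R S \<rightarrow> R \<otimes>_R S is
  injective (ideal criterion for flatness).\<close>
definition flat_ext :: "'a ring \<Rightarrow> 'a set \<Rightarrow> bool" where
  "flat_ext S R \<longleftrightarrow> (\<forall>I. ideal I (subR S R) \<longrightarrow>
     (\<forall>f. finite {p. f p \<noteq> 0} \<longrightarrow> {p. f p \<noteq> 0} \<subseteq> I \<times> carrier S \<longrightarrow>
          f \<in> tens_rel S R R \<longrightarrow> f \<in> tens_rel S R I))"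

text \<open>Omega_{S/R}: free S-module on symbols ds (s \<in> S), elements represented as finitely supported
  coefficient functions, modulo the S-submodule omega_rel generated by d(a+b)-da-db,
  d(ab)-a db-b da, and dr for r \<in> R.\<close>
definition unitv :: "'a ring \<Rightarrow> 'a \<Rightarrow> 'a \<Rightarrow> 'a" where
  "unitv S a t = (if t = a then \<one>\<^bsub>S\<^esub> else \<zero>\<^bsub>S\<^esub>)"

inductive_set omega_rel :: "'a ring \<Rightarrow> 'a set \<Rightarrow> ('a \<Rightarrow> 'a) set"
  for S :: "'a ring" and R :: "'a set" where
  zero: "(\<lambda>_. \<zero>\<^bsub>S\<^esub>) \<in> omega_rel S R"
| add: "f \<in> omega_rel S R \<Longrightarrow> g \<in> omega_rel S R \<Longrightarrow> (\<lambda>t. f t \<oplus>\<^bsub>S\<^esub> g t) \<in> omega_rel S R"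
| smult: "c \<in> carrier S \<Longrightarrow> f \<in> omega_rel S R \<Longrightarrow> (\<lambda>t. c \<otimes>\<^bsub>S\<^esub> f t) \<in> omega_rel S R"
| dadd: "a \<in> carrier S \<Longrightarrow> b \<in> carrier S \<Longrightarrow>
     (\<lambda>t. unitv S (a \<oplus>\<^bsub>S\<^esub> b) t \<ominus>\<^bsub>S\<^esub> unitv S a t \<ominus>\<^bsub>S\<^esub> unitv S b t) \<in> omega_rel S R"
| dmult: "a \<in> carrier S \<Longrightarrow> b \<in> carrier S \<Longrightarrow>
     (\<lambda>t. unitv S (a \<otimes>\<^bsub>S\<^esub> b) t \<ominus>\<^bsub>S\<^esub> a \<otimes>\<^bsub>S\<^esub> unitv S b t \<ominus>\<^bsub>S\<^esub> b \<otimes>\<^bsub>S\<^esub> unitv S a t)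
       \<in> omega_rel S R"
| dconst: "r \<in> R \<Longrightarrow> unitv S r \<in> omega_rel S R"

definition kaehler_zero :: "'a ring \<Rightarrow> 'a set \<Rightarrow> bool" where
  "kaehler_zero S R \<longleftrightarrow> (\<forall>s \<in> carrier S. unitv S s \<in> omega_rel S R)"

definition unramified :: "'a ring \<Rightarrow> 'a set \<Rightarrow> bool" where
  "unramified S R \<longleftrightarrow> finite_type S R \<and> kaehler_zero S R"

definition etale :: "'a ring \<Rightarrow> 'a set \<Rightarrow> bool" where
  "etale S R \<longleftrightarrow> flat_ext S R \<and> finitely_presented S R \<and> unramified S R"

definition loc_rel :: "'a ring \<Rightarrow> 'a set \<Rightarrow> 'a set \<Rightarrow> (('a \<times> 'a) \<times> ('a \<times> 'a)) set" where
  "loc_rel S R U = {((a, s), (b, t)). a \<in> R \<and> b \<in> R \<and> s \<in> U \<and> t \<in> U \<and>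
       (\<exists>u \<in> U. u \<otimes>\<^bsub>S\<^esub> (a \<otimes>\<^bsub>S\<^esub> t \<ominus>\<^bsub>S\<^esub> b \<otimes>\<^bsub>S\<^esub> s) = \<zero>\<^bsub>S\<^esub>)}"

definition loc_mult :: "'a ring \<Rightarrow> 'a set \<Rightarrow> 'a set \<Rightarrow> ('a \<times> 'a) set \<Rightarrow> ('a \<times> 'a) set \<Rightarrow> ('a \<times> 'a) set" where
  "loc_mult S R U XX YY = loc_rel S R U `` {z. \<exists>a s b t. (a, s) \<in> XX \<and> (b, t) \<in> YY \<and> z = (a \<otimes>\<^bsub>S\<^esub> b, s \<otimes>\<^bsub>S\<^esub> t)}"

definition loc_add :: "'a ring \<Rightarrow> 'a set \<Rightarrow> 'a set \<Rightarrow> ('a \<times> 'a) set \<Rightarrow> ('a \<times> 'a) set \<Rightarrow> ('a \<times> 'a) set" where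
  "loc_add S R U XX YY = loc_rel S R U `` {z. \<exists>a s b t. (a, s) \<in> XX \<and> (b, t) \<in> YY \<and> z = (a \<otimes>\<^bsub>S\<^esub> t \<oplus>\<^bsub>S\<^esub> b \<otimes>\<^bsub>S\<^esub> s, s \<otimes>\<^bsub>S\<^esub> t)}"

definition localization :: "'a ring \<Rightarrow> 'a set \<Rightarrow> 'a set \<Rightarrow> ('a \<times> 'a) set ring" where
  "localization S R U =
    \<lparr> carrier = (R \<times> U) // loc_rel S R U,
      monoid.mult = loc_mult S R U,
      one = loc_rel S R U `` {(\<one>\<^bsub>S\<^esub>, \<one>\<^bsub>S\<^esub>)},
      ring.zero = loc_rel S R U `` {(\<zero>\<^bsub>S\<^esub>, \<one>\<^bsub>S\<^esub>)},
      ring.add = loc_add S R U \<rparr>"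

abbreviation loc_at :: "'a ring \<Rightarrow> 'a set \<Rightarrow> 'a set \<Rightarrow> ('a \<times> 'a) set ring" where
  "loc_at S R P \<equiv> localization S R (R - P)"

text \<open>Supp_R(S/R): primes P of R with (S/R)_P \<noteq> 0, i.e. some class of S/R is not killed by any
  element of R - P.\<close>
definition supp :: "'a ring \<Rightarrow> 'a set \<Rightarrow> 'a set set" where
  "supp S R = {P. primeideal P (subR S R) \<and>
                  (\<exists>s \<in> carrier S. \<forall>t \<in> R - P. t \<otimes>\<^bsub>S\<^esub> s \<notin> R)}"

primrec ideal_pow :: "('b, 'c) ring_scheme \<Rightarrow> 'b set \<Rightarrow> nat \<Rightarrow> 'b set" where
  "ideal_pow A I 0 = carrier A"
| "ideal_pow A I (Suc n) = ideal_prod A I (ideal_pow A I n)"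

definition SPIR :: "('b, 'c) ring_scheme \<Rightarrow> bool" where
  "SPIR A \<longleftrightarrow> cring A \<and> (\<exists>!M. maximalideal M A) \<and> \<not> field A \<and>
     (\<forall>M. maximalideal M A \<longrightarrow> principalideal M A \<and> (\<exists>n. ideal_pow A M n = {\<zero>\<^bsub>A\<^esub>}))"

end

theory Submission
  imports Defs
begin

text \<open>Let \<open>C = (R:S)\<close>, \<open>A = R/C\<close> and \<open>B = S/C\<close>; the subrings between \<open>R\<close> and \<open>S\<close> are those between
  \<open>A\<close> and \<open>B\<close>. Since \<open>A\<close> is Artinian and \<open>B\<close> is generated by finitely many integral elements, \<open>B\<close> and all
  intermediate rings have the descending chain condition on \<open>A\<close>-submodules, hence split into local
  rings with nilpotent maximal ideals along primitive idempotents. Let \<open>e\<close> be such an idempotent of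
  \<open>A\<close>, with maximal ideal \<open>M\<close>, and let \<open>f\<close> range over those of \<open>B\<close> below \<open>e\<close>; these correspond to the
  primes of \<open>S\<close> over \<open>M\<close>. Unramifiedness and trivial residue extensions give \<open>Bf = Af\<close>; there are at
  least two \<open>f\<close>, since otherwise \<open>e\<close> would lie in the conductor; flatness then gives \<open>C\<^sub>M = 0\<close> and shows
  that \<open>Be\<close> is free over \<open>Ae\<close> with basis the idempotents \<open>f\<close>. So locally the extension is the diagonal
  \<open>K \<subseteq> K\<^sup>n\<close> with \<open>K = R\<^sub>M = Ae\<close> Artinian local and \<open>n \<ge> 2\<close>.

  Ideals \<open>I\<close> of \<open>A\<close> embed into the intermediate rings through congruence modulo \<open>I\<close> of the
  coordinates. If \<open>K\<close> is infinite with finitely many ideals, then its residue field is infinite and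
  its maximal ideal is principal. When \<open>K\<close> is finite, a field, or \<open>n = 2\<close>, the subalgebras of \<open>K\<^sup>n\<close> are
  determined by finite data: a subset, a set of idempotents, or an ideal. When \<open>K\<close> is infinite, not a
  field and \<open>n \<ge> 3\<close>, the algebras \<open>K + K z (f\<^sub>1 + \<alpha> f\<^sub>2)\<close>, with \<open>z\<close> in the socle and \<open>\<alpha>\<close> running through the
  residue field, are pairwise distinct.\<close>

section \<open>Artinian rings and primitive idempotents\<close>


text \<open>The chain condition lives on \<open>R/C\<close>, whereas flatness and differentials live
  on \<open>R\<close>, and flatness does not pass to \<open>A\<close> inside \<open>B\<close> before
  \<open>C\<close> is known to vanish locally. For that, two primes of \<open>S\<close> over
  \<open>M\<close> are essential: a \<open>c\<close> in \<open>C\<close> turns any \<open>s\<close>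
  into a relation \<open>c s = r\<close> over \<open>R\<close>, and flatness expresses it through
  relations with coefficients in \<open>R\<close>. If no element outside \<open>M\<close> killed
  \<open>c\<close>, these would force \<open>s\<close> to be congruent to one fraction over
  \<open>R\<close> at both primes, which fails for an \<open>s\<close> lying in only one of them.
  \<open>Bf = Af\<close> is a form of Nakayama's lemma. With \<open>P\<close> the prime at
  \<open>f\<close> and \<open>m\<close> its trace on \<open>A\<close>, unramifiedness gives
  \<open>P = mB + P^2\<close>; nilpotency of \<open>P\<close> at \<open>f\<close> removes
  \<open>P^2\<close>, the residue condition gives \<open>B = A + P\<close>, and nilpotency of
  \<open>m\<close> at \<open>f\<close> removes the remaining \<open>mB\<close>. In the last family
  the third idempotent detects the summand from \<open>K\<close>: the coordinate of
  \<open>z(f1 + \<alpha> f2)\<close> there is zero, so no constant survives when two members are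
  compared; \<open>z\<close> is in the socle so that squares vanish and only the residue class of
  \<open>\<alpha>\<close> matters.\<close>

definition prim_idem :: "('a, 'b) ring_scheme \<Rightarrow> 'a \<Rightarrow> bool" where
  "prim_idem A e \<longleftrightarrow> e \<in> carrier A \<and> e \<otimes>\<^bsub>A\<^esub> e = e \<and> e \<noteq> \<zero>\<^bsub>A\<^esub> \<and>
     (\<forall>g \<in> carrier A. g \<otimes>\<^bsub>A\<^esub> g = g \<longrightarrow> g \<otimes>\<^bsub>A\<^esub> e = g \<longrightarrow> g = \<zero>\<^bsub>A\<^esub> \<or> g = e)"

text \<open>For primitive \<open>e\<close> in an Artinian ring this is the inverse image under
  \<open>x \<mapsto> x e\<close> of the maximal ideal of the local ring with unit \<open>e\<close>.
  Writing it inside \<open>A\<close> gives a prime of \<open>A\<close> directly, without a second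
  ring whose unit is \<open>e\<close>.\<close>

definition idem_rad :: "('a, 'b) ring_scheme \<Rightarrow> 'a \<Rightarrow> 'a set" where
  "idem_rad A e = {x \<in> carrier A. \<exists>n::nat. x [^]\<^bsub>A\<^esub> n \<otimes>\<^bsub>A\<^esub> e = \<zero>\<^bsub>A\<^esub>}"

text \<open>Only the \<open>n\<close>-fold products, not the ideal they generate.\<close>
primrec prods :: "('a, 'b) ring_scheme \<Rightarrow> 'a set \<Rightarrow> nat \<Rightarrow> 'a set" where
  "prods A I 0 = {\<one>\<^bsub>A\<^esub>}"
| "prods A I (Suc n) = {x \<otimes>\<^bsub>A\<^esub> y | x y. x \<in> I \<and> y \<in> prods A I n}"

definition orth_decomp :: "('a, 'b) ring_scheme \<Rightarrow> 'a set \<Rightarrow> 'a \<Rightarrow> bool" where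
  "orth_decomp A E e \<longleftrightarrow> finite E \<and> (\<forall>g \<in> E. prim_idem A g) \<and>
     (\<forall>g \<in> E. \<forall>h \<in> E. g \<noteq> h \<longrightarrow> g \<otimes>\<^bsub>A\<^esub> h = \<zero>\<^bsub>A\<^esub>) \<and> (\<Oplus>\<^bsub>A\<^esub>g\<in>E. g) = e"

lemma artinian_wf:
  assumes "artinian A"
  shows "wf {(I, J). ideal I A \<and> ideal J A \<and> I \<subset> J}"
  using assms unfolding artinian_def wf_iff_no_infinite_down_chain by (simp, blast)

lemma artinian_stable:
  assumes "artinian A" "\<And>n. ideal (f n) A" "\<And>n. f (Suc n) \<subseteq> f n"
  shows "\<exists>n. f (Suc n) = f n"
proof (rule ccontr)
  assume "\<not> ?thesis"
  then have "\<forall>n. ideal (f n) A \<and> f (Suc n) \<subset> f n" using assms(2,3) by blast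
  then show False using assms(1) unfolding artinian_def by (metis (no_types, lifting))
qed

lemma prim_idemD:
  assumes "prim_idem A e"
  shows "e \<in> carrier A" "e \<otimes>\<^bsub>A\<^esub> e = e" "e \<noteq> \<zero>\<^bsub>A\<^esub>"
    "\<And>g. g \<in> carrier A \<Longrightarrow> g \<otimes>\<^bsub>A\<^esub> g = g \<Longrightarrow> g \<otimes>\<^bsub>A\<^esub> e = g \<Longrightarrow> g = \<zero>\<^bsub>A\<^esub> \<or> g = e"
  using assms unfolding prim_idem_def by auto

lemma orth_decompD:
  assumes "orth_decomp A E e"
  shows "finite E" "\<And>g. g \<in> E \<Longrightarrow> prim_idem A g" "E \<subseteq> carrier A"
    "\<And>g h. g \<in> E \<Longrightarrow> h \<in> E \<Longrightarrow> g \<noteq> h \<Longrightarrow> g \<otimes>\<^bsub>A\<^esub> h = \<zero>\<^bsub>A\<^esub>" "(\<Oplus>\<^bsub>A\<^esub>g\<in>E. g) = e"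
  using assms unfolding orth_decomp_def by (auto dest: prim_idemD)

context cring
begin

lemma idem_diff:
  assumes [simp]: "e \<in> carrier R" "g \<in> carrier R" and g: "g \<otimes> g = g" "g \<otimes> e = g" and e: "e \<otimes> e = e"
  shows "(e \<ominus> g) \<otimes> (e \<ominus> g) = e \<ominus> g" "(e \<ominus> g) \<otimes> e = e \<ominus> g" "(e \<ominus> g) \<otimes> g = \<zero>" "g \<oplus> (e \<ominus> g) = e"
proof -
  have eg: "e \<otimes> g = g" using g m_comm by simp
  show "(e \<ominus> g) \<otimes> e = e \<ominus> g"
    unfolding minus_eq using g e eg by (simp add: l_distr r_distr l_minus r_minus)
  show 3: "(e \<ominus> g) \<otimes> g = \<zero>" 
    unfolding minus_eq using g e eg by (simp add: l_distr r_distr l_minus r_minus r_neg)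
  show "(e \<ominus> g) \<otimes> (e \<ominus> g) = e \<ominus> g"
  proof -
    have "(e \<ominus> g) \<otimes> (e \<ominus> g) = (e \<ominus> g) \<otimes> e \<ominus> (e \<ominus> g) \<otimes> g"
      by (simp add: minus_eq l_distr r_distr l_minus r_minus)
    also have "\<dots> = e \<ominus> g" using 3 \<open>(e \<ominus> g) \<otimes> e = e \<ominus> g\<close> by (simp add: minus_eq)
    finally show ?thesis .
  qed
  show "g \<oplus> (e \<ominus> g) = e" using assms(1,2) by algebra
qed

lemma orth_decomp_idem:
  assumes E: "orth_decomp R E e" and g: "g \<in> E"
  shows "g \<otimes> e = g"
proof -
  note d = orth_decompD[OF E]
  have c: "g \<in> carrier R" using d(3) g by auto
  have "g \<otimes> e = (\<Oplus>h\<in>E. g \<otimes> h)"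
    using d(5) finsum_rdistr[OF d(1) c, of "\<lambda>x. x"] d(3) by (auto simp: subset_iff)
  also have "\<dots> = (\<Oplus>h\<in>E. if h = g then g else \<zero>)"
    using d g c prim_idemD[OF d(2)] by (intro finsum_cong') auto
  also have "\<dots> = g"
    using add.finprod_singleton_swap[OF g d(1), of "\<lambda>_. g"] c by auto
  finally show ?thesis .
qed

text \<open>Induction on the ideal generated by \<open>e\<close>: if \<open>e\<close> is neither
  zero nor primitive, it splits as \<open>g\<close> plus \<open>e \<ominus> g\<close>, and both
  summands generate strictly smaller ideals. Elements of the two decompositions are orthogonal
  because they lie below \<open>g\<close> and \<open>e \<ominus> g\<close>.\<close>

lemma orth_decomp_exists:
  assumes art: "artinian R" and e: "e \<in> carrier R" "e \<otimes> e = e"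
  shows "\<exists>E. orth_decomp R E e"
  using e
proof (induction e rule: wf_induct_rule[OF wf_inv_image[OF artinian_wf[OF art], of "\<lambda>e. PIdl e"]])
  case (1 e)
  note [simp] = 1(2) and ee = 1(3)
  show ?case
  proof (cases "e = \<zero>")
    case True
    then show ?thesis by (intro exI[of _ "{}"]) (auto simp: orth_decomp_def)
  next
    case ne: False
    show ?thesis
    proof (cases "prim_idem R e")
      case True
      then show ?thesis by (intro exI[of _ "{e}"]) (auto simp: orth_decomp_def)
    next
      case False
      then obtain g where [simp]: "g \<in> carrier R" and g: "g \<otimes> g = g" "g \<otimes> e = g" and g0: "g \<noteq> \<zero>" "g \<noteq> e"
        using ne ee unfolding prim_idem_def by auto
      note dg = idem_diff[OF 1(2) \<open>g \<in> carrier R\<close> g ee]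
      have sub: "PIdl h \<subseteq> PIdl e" if h: "h \<in> carrier R" "h \<otimes> e = h" for h
      proof
        fix x assume "x \<in> PIdl h"
        then obtain y where y: "y \<in> carrier R" "x = y \<otimes> h" unfolding cgenideal_def by auto
        then have "x = (y \<otimes> h) \<otimes> e" using h by (simp add: m_assoc)
        then show "x \<in> PIdl e" using y h unfolding cgenideal_def by auto
      qed
      have self: "e \<in> PIdl e" using cgenideal_self by simp
      have "e \<notin> PIdl g"
      proof
        assume "e \<in> PIdl g"
        then obtain y where y: "y \<in> carrier R" "e = y \<otimes> g" unfolding cgenideal_def by auto
        then have "e \<otimes> g = e" using g by (simp add: m_assoc)
        then show False using g g0 m_comm[of e g] by simp
      qed
      then have lt1: "PIdl g \<subset> PIdl e" using sub[OF _ g(2)] self by auto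
      have "e \<notin> PIdl (e \<ominus> g)"
      proof
        assume "e \<in> PIdl (e \<ominus> g)"
        then obtain y where y: "y \<in> carrier R" "e = y \<otimes> (e \<ominus> g)" unfolding cgenideal_def by auto
        then have "e \<otimes> g = y \<otimes> ((e \<ominus> g) \<otimes> g)" by (metis m_assoc minus_closed 1(2) \<open>g \<in> carrier R\<close>)
        then show False using dg g g0 m_comm[of e g] y by simp
      qed
      then have lt2: "PIdl (e \<ominus> g) \<subset> PIdl e" using sub[OF _ dg(2)] self by auto
      obtain E1 where E1: "orth_decomp R E1 g"
        using 1(1)[of g] lt1 g cgenideal_ideal by (auto simp: inv_image_def)
      obtain E2 where E2: "orth_decomp R E2 (e \<ominus> g)"
        using 1(1)[of "e \<ominus> g"] lt2 dg cgenideal_ideal by (auto simp: inv_image_def)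
      note d1 = orth_decompD[OF E1] and d2 = orth_decompD[OF E2]
      have orth: "x \<otimes> y = \<zero>" if "x \<in> E1" "y \<in> E2" for x y
      proof -
        have c: "x \<in> carrier R" "y \<in> carrier R" using that d1(3) d2(3) by auto
        have "x \<otimes> y = (x \<otimes> g) \<otimes> (y \<otimes> (e \<ominus> g))"
          using orth_decomp_idem[OF E1 that(1)] orth_decomp_idem[OF E2 that(2)] by simp
        also have "\<dots> = (x \<otimes> y) \<otimes> ((e \<ominus> g) \<otimes> g)" using c by (simp add: m_ac)
        finally show ?thesis using dg c by simp
      qed
      have disj: "E1 \<inter> E2 = {}" using orth d1(2) d2(2) by (metis disjoint_iff prim_idemD(2,3))
      have orth': "x \<otimes> y = \<zero>" if "x \<in> E2" "y \<in> E1" for x y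
        using orth[OF that(2,1)] m_comm that d1(3) d2(3) by (metis subsetD)
      have "(\<Oplus>g\<in>E1 \<union> E2. g) = g \<oplus> (e \<ominus> g)"
        using finsum_Un_disjoint[OF d1(1) d2(1) disj, of "\<lambda>x. x"] d1(3,5) d2(3,5) by (auto simp: subset_iff)
      then have "orth_decomp R (E1 \<union> E2) e"
        unfolding orth_decomp_def using d1 d2 orth orth' dg(4) by auto
      then show ?thesis by blast
    qed
  qed
qed

text \<open>A form of Fitting's lemma. The ideals generated by \<open>x^n e\<close> become
  stationary, whence \<open>x^n e = x^(2n) y^n e\<close> for some \<open>y\<close>; then
  \<open>x^n y^n e\<close> is an idempotent below \<open>e\<close>, so it is \<open>e\<close>,
  making \<open>x\<close> a unit at \<open>e\<close>, or zero, making \<open>x\<close> nilpotent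
  there.\<close>

lemma prim_idem_unit_or_nil:
  assumes art: "artinian R" and e: "prim_idem R e" and x[simp]: "x \<in> carrier R"
  shows "(\<exists>y \<in> carrier R. x \<otimes> y \<otimes> e = e) \<or> x \<in> idem_rad R e"
proof -
  note e' = prim_idemD[OF e]
  note [simp] = e'(1)
  define f where "f n = PIdl (x [^] n \<otimes> e)" for n :: nat
  have id: "ideal (f n) R" for n unfolding f_def by (intro cgenideal_ideal) simp
  have sub: "f (Suc n) \<subseteq> f n" for n
  proof
    fix z assume "z \<in> f (Suc n)"
    then obtain y where y: "y \<in> carrier R" "z = y \<otimes> (x [^] Suc n \<otimes> e)" unfolding f_def cgenideal_def by auto
    then have "z = (y \<otimes> x) \<otimes> (x [^] n \<otimes> e)" by (simp add: m_ac)
    then show "z \<in> f n" using y unfolding f_def cgenideal_def by auto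
  qed
  \<comment> \<open>The chain is shifted by one so that \<open>n = Suc k\<close> is positive; at the
    end one factor \<open>x\<close> has to be split off from \<open>x^n\<close>.\<close>
  obtain k where k: "f (Suc (Suc k)) = f (Suc k)"
    using artinian_stable[OF art, of "\<lambda>n. f (Suc n)"] id sub by auto
  define n where "n = Suc k"
  have "x [^] n \<otimes> e \<in> f (Suc n)" using k cgenideal_self unfolding n_def f_def by simp
  then obtain y where y[simp]: "y \<in> carrier R" and "x [^] n \<otimes> e = y \<otimes> (x [^] Suc n \<otimes> e)"
    unfolding f_def cgenideal_def by auto
  then have st: "x [^] n \<otimes> e = x [^] Suc n \<otimes> (y \<otimes> e)" by (simp add: m_ac)
  have st': "x [^] n \<otimes> e = x [^] (n + j) \<otimes> (y [^] j \<otimes> e)" for j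
  proof (induction j)
    case (Suc j)
    have "x [^] n \<otimes> e = x [^] (n + j) \<otimes> (y [^] j \<otimes> e)" by fact
    also have "\<dots> = (x [^] n \<otimes> e) \<otimes> (x [^] j \<otimes> y [^] j)" by (simp add: nat_pow_mult[symmetric] m_ac)
    also have "\<dots> = (x [^] Suc n \<otimes> (y \<otimes> e)) \<otimes> (x [^] j \<otimes> y [^] j)" using st by simp
    also have "\<dots> = x [^] (n + Suc j) \<otimes> (y [^] Suc j \<otimes> e)" by (simp add: nat_pow_mult[symmetric] m_ac)
    finally show ?case .
  qed simp
  define g where "g = x [^] n \<otimes> y [^] n \<otimes> e"
  have [simp]: "g \<in> carrier R" unfolding g_def by simp
  have xg: "x [^] n \<otimes> g = x [^] n \<otimes> e"
    using st'[of n] unfolding g_def by (simp add: m_ac nat_pow_mult[symmetric])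
  have ge: "g \<otimes> e = g" unfolding g_def using e'(2) by (simp add: m_assoc)
  have "g \<otimes> g = y [^] n \<otimes> e \<otimes> (x [^] n \<otimes> g)" by (simp add: g_def m_ac)
  also have "\<dots> = y [^] n \<otimes> x [^] n \<otimes> (e \<otimes> e)" unfolding xg by (simp add: m_ac)
  also have "\<dots> = g" unfolding e'(2) by (simp add: g_def m_ac)
  finally have "g \<otimes> g = g" .
  with ge have "g = \<zero> \<or> g = e" using e'(4) by simp
  then show ?thesis
  proof
    assume "g = \<zero>"
    then have "x [^] n \<otimes> e = \<zero>" using xg by simp
    then show ?thesis unfolding idem_rad_def by auto
  next
    assume "g = e"
    then have "x \<otimes> (x [^] k \<otimes> y [^] n) \<otimes> e = e" unfolding g_def n_def by (simp add: m_ac)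
    then show ?thesis by (intro disjI1 bexI[of _ "x [^] k \<otimes> y [^] n"]) auto
  qed
qed

lemma geom_sum_inverse:
  assumes [simp]: "u \<in> carrier R"
  shows "\<exists>w \<in> carrier R. (\<one> \<ominus> u) \<otimes> w = \<one> \<ominus> u [^] (n::nat)"
proof (induction n)
  case 0
  show ?case by (intro bexI[of _ \<zero>]) (auto simp: minus_eq r_neg)
next
  case (Suc n)
  then obtain w where [simp]: "w \<in> carrier R" and w: "(\<one> \<ominus> u) \<otimes> w = \<one> \<ominus> u [^] n" by auto
  have p: "u [^] n \<in> carrier R" by simp
  have "(\<one> \<ominus> u) \<otimes> (w \<oplus> u [^] n) = (\<one> \<ominus> u) \<otimes> w \<oplus> (\<one> \<ominus> u) \<otimes> u [^] n" by (simp add: r_distr)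
  also have "\<dots> = (\<one> \<ominus> u [^] n) \<oplus> (\<one> \<ominus> u) \<otimes> u [^] n" unfolding w ..
  also have "\<dots> = \<one> \<ominus> u [^] n \<otimes> u"
    using p assms by algebra
  finally show ?case by (intro bexI[of _ "w \<oplus> u [^] n"]) auto
qed

lemma unit_not_in_idem_rad:
  assumes e: "prim_idem R e" and c: "x \<in> carrier R" "y \<in> carrier R" and xy: "x \<otimes> y \<otimes> e = e"
  shows "x \<notin> idem_rad R e"
proof
  assume "x \<in> idem_rad R e"
  then obtain n :: nat where n: "x [^] n \<otimes> e = \<zero>" unfolding idem_rad_def by auto
  note e' = prim_idemD[OF e]
  have "(x [^] m \<otimes> y [^] m) \<otimes> e = e" for m :: nat
  proof (induction m)
    case (Suc m)
    have "(x [^] Suc m \<otimes> y [^] Suc m) \<otimes> e = (x [^] m \<otimes> y [^] m) \<otimes> (x \<otimes> y \<otimes> e)"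
      using c e' by (simp add: m_ac)
    then show ?case using Suc xy by simp
  qed (use e' in simp)
  from this[of n] have "y [^] n \<otimes> (x [^] n \<otimes> e) = e" using c e' by (simp add: m_ac)
  then show False using n e' c by simp
qed

lemma idem_rad_mult:
  assumes "x \<in> idem_rad R e" "e \<in> carrier R" "y \<in> carrier R"
  shows "x \<otimes> y \<in> idem_rad R e"
proof -
  obtain n :: nat where n: "x [^] n \<otimes> e = \<zero>" and x: "x \<in> carrier R" using assms unfolding idem_rad_def by auto
  have "(x \<otimes> y) [^] n \<otimes> e = y [^] n \<otimes> (x [^] n \<otimes> e)"
    using x assms by (simp add: nat_pow_distrib m_ac)
  then show ?thesis using n x assms unfolding idem_rad_def by auto
qed

text \<open>Only sums are delicate. If \<open>x \<oplus> y\<close> had an inverse \<open>z\<close>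
  at \<open>e\<close>, then \<open>y z\<close> would agree at \<open>e\<close> with
  \<open>\<one> \<ominus> x z\<close>, where \<open>x z\<close> is nilpotent; a geometric sum
  inverts it and makes \<open>y\<close> a unit at \<open>e\<close>.\<close>

lemma idem_rad_ideal:
  assumes art: "artinian R" and e: "prim_idem R e"
  shows "ideal (idem_rad R e) R"
proof (rule idealI)
  note e' = prim_idemD[OF e]
  note [simp] = e'(1)
  have sub: "idem_rad R e \<subseteq> carrier R" unfolding idem_rad_def by auto
  show "ring R" by (rule ring_axioms)
  have add: "x \<oplus> y \<in> idem_rad R e" if xy: "x \<in> idem_rad R e" "y \<in> idem_rad R e" for x y
  proof (rule ccontr)
    have [simp]: "x \<in> carrier R" "y \<in> carrier R" using xy sub by auto
    assume "x \<oplus> y \<notin> idem_rad R e"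
    then obtain z where [simp]: "z \<in> carrier R" and z: "(x \<oplus> y) \<otimes> z \<otimes> e = e"
      using prim_idem_unit_or_nil[OF art e, of "x \<oplus> y"] by auto
    have "x \<otimes> z \<in> idem_rad R e" using idem_rad_mult xy by simp
    then obtain n :: nat where n: "(x \<otimes> z) [^] n \<otimes> e = \<zero>" unfolding idem_rad_def by auto
    obtain w where w[simp]: "w \<in> carrier R" and "(\<one> \<ominus> (x \<otimes> z)) \<otimes> w = \<one> \<ominus> (x \<otimes> z) [^] n"
      using geom_sum_inverse[of "x \<otimes> z" n] by auto
    then have "(\<one> \<ominus> (x \<otimes> z)) \<otimes> w \<otimes> e = \<one> \<otimes> e \<ominus> (x \<otimes> z) [^] n \<otimes> e"
      by (simp add: minus_eq l_distr l_minus)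
    then have we: "(\<one> \<ominus> (x \<otimes> z)) \<otimes> w \<otimes> e = e" using n by (simp add: minus_eq)
    have yz: "y \<otimes> z \<otimes> e = (\<one> \<ominus> x \<otimes> z) \<otimes> e"
    proof -
      have "y \<otimes> z \<otimes> e = (x \<oplus> y) \<otimes> z \<otimes> e \<ominus> x \<otimes> z \<otimes> e"
        using \<open>x \<in> carrier R\<close> \<open>y \<in> carrier R\<close> \<open>z \<in> carrier R\<close> e'(1) by algebra
      also have "\<dots> = (\<one> \<ominus> x \<otimes> z) \<otimes> e" unfolding z
        using \<open>x \<in> carrier R\<close> \<open>z \<in> carrier R\<close> e'(1) by algebra
      finally show ?thesis .
    qed
    have "y \<otimes> (z \<otimes> w) \<otimes> e = (y \<otimes> z \<otimes> e) \<otimes> w" by (simp add: m_ac)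
    also have "\<dots> = e" unfolding yz using we by (simp add: m_ac)
    finally show False using unit_not_in_idem_rad[OF e, of y "z \<otimes> w"] xy by simp
  qed
  have z: "\<zero> \<in> idem_rad R e" unfolding idem_rad_def by (auto intro!: exI[of _ "1::nat"])
  have m: "\<ominus> x \<in> idem_rad R e" if "x \<in> idem_rad R e" for x
  proof -
    have "x \<otimes> \<ominus> \<one> = \<ominus> x" using that sub by (auto simp: r_minus)
    then show ?thesis using idem_rad_mult[OF that, of "\<ominus> \<one>"] by simp
  qed
  show "subgroup (idem_rad R e) (add_monoid R)"
    using sub add z m by (auto simp: subgroup_def a_inv_def)
  show "\<And>a x. a \<in> idem_rad R e \<Longrightarrow> x \<in> carrier R \<Longrightarrow> x \<otimes> a \<in> idem_rad R e"
    using idem_rad_mult[of _ e] m_comm sub by (metis e'(1) subsetD)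
  show "\<And>a x. a \<in> idem_rad R e \<Longrightarrow> x \<in> carrier R \<Longrightarrow> a \<otimes> x \<in> idem_rad R e"
    using idem_rad_mult[of _ e] by simp
qed

lemma idem_rad_iff:
  assumes art: "artinian R" and e: "prim_idem R e" and x[simp]: "x \<in> carrier R"
  shows "x \<in> idem_rad R e \<longleftrightarrow> \<not> (\<exists>y \<in> carrier R. x \<otimes> y \<otimes> e = e)"
  using prim_idem_unit_or_nil[OF assms] unit_not_in_idem_rad[OF e] by auto

lemma idem_rad_prime:
  assumes art: "artinian R" and e: "prim_idem R e"
  shows "primeideal (idem_rad R e) R"
proof (rule primeidealI[OF idem_rad_ideal[OF assms] is_cring])
  note e' = prim_idemD[OF e]
  have "e \<notin> idem_rad R e" using unit_not_in_idem_rad[OF e, of e \<one>] e' by simp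
  then show "carrier R \<noteq> idem_rad R e" using e' by auto
  fix a b assume [simp]: "a \<in> carrier R" "b \<in> carrier R" and ab: "a \<otimes> b \<in> idem_rad R e"
  show "a \<in> idem_rad R e \<or> b \<in> idem_rad R e"
  proof (rule ccontr)
    assume "\<not> ?thesis"
    then obtain c d where cd: "c \<in> carrier R" "a \<otimes> c \<otimes> e = e" "d \<in> carrier R" "b \<otimes> d \<otimes> e = e"
      using idem_rad_iff[OF assms] by auto
    have "(a \<otimes> b) \<otimes> (c \<otimes> d) \<otimes> e = (a \<otimes> c) \<otimes> (b \<otimes> d \<otimes> e)" using cd(1,3) e'(1) by (simp add: m_ac)
    also have "\<dots> = e" using cd by simp
    finally show False using unit_not_in_idem_rad[OF e, of "a \<otimes> b" "c \<otimes> d"] ab cd by simp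
  qed
qed

text \<open>The elements of \<open>E\<close> sum to one, so a prime omits some
  \<open>e \<in> E\<close>. Then \<open>x^n e = 0\<close> forces \<open>x\<close> into
  \<open>P\<close>, while a unit at \<open>e\<close> in \<open>P\<close> would put \<open>e\<close>
  itself into \<open>P\<close>.\<close>

lemma prime_eq_idem_rad:
  assumes art: "artinian R" and E: "orth_decomp R E \<one>" and P: "primeideal P R"
  shows "\<exists>e \<in> E. P = idem_rad R e"
proof -
  interpret P: primeideal P R by fact
  note d = orth_decompD[OF E]
  have "\<exists>e \<in> E. e \<notin> P"
  proof (rule ccontr)
    assume "\<not> ?thesis"
    then have "E \<subseteq> P" by auto
    have "(\<Oplus>g\<in>F. g) \<in> P" if "finite F" "F \<subseteq> P" for F using that
    proof (induction F rule: finite_induct)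
      case (insert x F)
      then have c: "x \<in> carrier R" "F \<subseteq> carrier R" using P.a_subset by auto
      then have "(\<Oplus>g\<in>insert x F. g) = x \<oplus> (\<Oplus>g\<in>F. g)" using insert by (intro finsum_insert) auto
      then show ?case using insert P.a_closed by auto
    qed (simp add: P.zero_closed)
    from this[OF d(1) \<open>E \<subseteq> P\<close>] have "\<one> \<in> P" using d(5) by simp
    then show False using P.one_imp_carrier P.I_notcarr by simp
  qed
  then obtain e where e: "e \<in> E" "e \<notin> P" by auto
  note pe = d(2)[OF e(1)] and e' = prim_idemD[OF d(2)[OF e(1)]]
  have "x \<in> P" if x: "x \<in> idem_rad R e" for x
  proof -
    obtain n :: nat where n: "x [^] n \<otimes> e = \<zero>" and c: "x \<in> carrier R" using x unfolding idem_rad_def by auto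
    have "x [^] n \<in> P" using n P.I_prime[of "x [^] n" e] c e' e(2) P.zero_closed by auto
    then show ?thesis
    proof (induction n)
      case 0
      then show ?case using P.one_imp_carrier P.I_notcarr by simp
    next
      case (Suc n)
      then show ?case using P.I_prime[of "x [^] n" x] c by auto
    qed
  qed
  moreover have "x \<in> idem_rad R e" if x: "x \<in> P" for x
  proof (rule ccontr)
    have c: "x \<in> carrier R" using x P.a_subset by auto
    assume "x \<notin> idem_rad R e"
    then obtain y where y: "y \<in> carrier R" "x \<otimes> y \<otimes> e = e" using idem_rad_iff[OF art pe c] by auto
    have "x \<otimes> (y \<otimes> e) \<in> P" using x P.I_r_closed y e' by simp
    then show False using y c e' e by (simp add: m_assoc)
  qed
  ultimately show ?thesis using e by blast
qed

end


section \<open>Ideals of a commutative ring and nilpotency of \<open>idem_rad\<close>\<close>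

context cring
begin

lemma cring_idealI:
  assumes "I \<subseteq> carrier R" "\<zero> \<in> I" "\<And>x y. x \<in> I \<Longrightarrow> y \<in> I \<Longrightarrow> x \<oplus> y \<in> I"
    "\<And>a x. a \<in> carrier R \<Longrightarrow> x \<in> I \<Longrightarrow> a \<otimes> x \<in> I"
  shows "ideal I R"
proof (rule idealI)
  show "ring R" by (rule ring_axioms)
  have neg: "\<ominus> x \<in> I" if "x \<in> I" for x
  proof -
    have "\<ominus> \<one> \<otimes> x = \<ominus> x" using that assms(1) by (auto simp: l_minus)
    then show ?thesis using assms(4)[of "\<ominus> \<one>" x] that by simp
  qed
  show "subgroup I (add_monoid R)" using assms neg by (auto simp: subgroup_def a_inv_def)
  show "\<And>a x. a \<in> I \<Longrightarrow> x \<in> carrier R \<Longrightarrow> x \<otimes> a \<in> I" using assms by simp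
  show "\<And>a x. a \<in> I \<Longrightarrow> x \<in> carrier R \<Longrightarrow> a \<otimes> x \<in> I" using assms m_comm by (metis subsetD)
qed

lemma ideal_facts:
  assumes "ideal I R"
  shows "I \<subseteq> carrier R" "\<zero> \<in> I" "\<And>x y. x \<in> I \<Longrightarrow> y \<in> I \<Longrightarrow> x \<oplus> y \<in> I"
    "\<And>a x. a \<in> carrier R \<Longrightarrow> x \<in> I \<Longrightarrow> a \<otimes> x \<in> I"
    "\<And>a x. a \<in> carrier R \<Longrightarrow> x \<in> I \<Longrightarrow> x \<otimes> a \<in> I" "\<And>x. x \<in> I \<Longrightarrow> \<ominus> x \<in> I"
    "\<And>x y. x \<in> I \<Longrightarrow> y \<in> I \<Longrightarrow> x \<ominus> y \<in> I"
proof -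
  interpret ideal I R by fact
  show "I \<subseteq> carrier R" "\<zero> \<in> I" "\<And>x y. x \<in> I \<Longrightarrow> y \<in> I \<Longrightarrow> x \<oplus> y \<in> I"
    "\<And>a x. a \<in> carrier R \<Longrightarrow> x \<in> I \<Longrightarrow> a \<otimes> x \<in> I"
    "\<And>a x. a \<in> carrier R \<Longrightarrow> x \<in> I \<Longrightarrow> x \<otimes> a \<in> I" "\<And>x. x \<in> I \<Longrightarrow> \<ominus> x \<in> I"
    "\<And>x y. x \<in> I \<Longrightarrow> y \<in> I \<Longrightarrow> x \<ominus> y \<in> I"
    using a_subset I_l_closed I_r_closed by (auto simp: minus_eq)
qed

lemma ideal_scale:
  assumes I: "ideal I R" and a[simp]: "a \<in> carrier R"
  shows "ideal ((\<lambda>x. a \<otimes> x) ` I) R"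
proof (rule cring_idealI)
  note f = ideal_facts[OF I]
  note [simp] = subsetD[OF f(1)]
  show "(\<lambda>x. a \<otimes> x) ` I \<subseteq> carrier R" by auto
  show "\<zero> \<in> (\<lambda>x. a \<otimes> x) ` I" using f(2) by (intro image_eqI[of _ _ \<zero>]) auto
  show "x \<oplus> y \<in> (\<lambda>x. a \<otimes> x) ` I" if xy: "x \<in> (\<lambda>x. a \<otimes> x) ` I" "y \<in> (\<lambda>x. a \<otimes> x) ` I" for x y
  proof -
    obtain u v where "u \<in> I" "v \<in> I" "x = a \<otimes> u" "y = a \<otimes> v" using xy by auto
    then show ?thesis using f(3) by (intro image_eqI[of _ _ "u \<oplus> v"]) (auto simp: r_distr)
  qed
  show "c \<otimes> x \<in> (\<lambda>x. a \<otimes> x) ` I" if cx: "c \<in> carrier R" "x \<in> (\<lambda>x. a \<otimes> x) ` I" for c x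
  proof -
    obtain u where "u \<in> I" "x = a \<otimes> u" using cx by auto
    then show ?thesis using f(4) cx by (intro image_eqI[of _ _ "c \<otimes> u"]) (auto simp: m_ac)
  qed
qed

lemma ideal_pow_ideal:
  assumes "ideal I R" shows "ideal (ideal_pow R I n) R"
  by (induction n) (auto simp: oneideal ideal_prod_is_ideal assms)

lemma prods_subset_ideal_pow: "prods R I n \<subseteq> ideal_pow R I n"
  by (induction n) (auto intro: ideal_prod.prod)

text \<open>That each element is nilpotent at \<open>e\<close> gives no common exponent by itself.
  The powers of \<open>Q = idem_rad R e\<close> stabilise at some \<open>P\<close> with
  \<open>QP = P\<close>. If \<open>Pe\<close> were nonzero, a minimal ideal \<open>L\<close> with
  \<open>LPe\<close> nonzero would contain an \<open>l\<close> with \<open>l P e\<close> nonzero;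
  then \<open>l Q\<close> has the same property, so it equals \<open>L\<close>, and
  \<open>l = l x\<close> with \<open>x\<close> nilpotent at \<open>e\<close> is absurd.\<close>

lemma idem_rad_nilpotent:
  assumes art: "artinian R" and e: "prim_idem R e"
  shows "\<exists>k. \<forall>x \<in> prods R (idem_rad R e) k. x \<otimes> e = \<zero>"
proof -
  define Q where "Q = idem_rad R e"
  note e' = prim_idemD[OF e]
  note [simp] = e'(1)
  have Q: "ideal Q R" using idem_rad_ideal[OF assms] unfolding Q_def .
  note q = ideal_facts[OF Q]
  have id: "ideal (ideal_pow R Q n) R" for n by (rule ideal_pow_ideal[OF Q])
  have "ideal_pow R Q (Suc n) \<subseteq> ideal_pow R Q n" for n
    using ideal_prod_inter[OF Q id] by auto
  then obtain n where n: "ideal_pow R Q (Suc n) = ideal_pow R Q n"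
    using artinian_stable[OF art id] by blast
  define P where "P = ideal_pow R Q n"
  have P: "ideal P R" using id unfolding P_def .
  note p = ideal_facts[OF P]
  have QP: "ideal_prod R Q P = P" using n unfolding P_def by simp
  have "p \<otimes> e = \<zero>" if p0: "p \<in> P" for p
  proof (rule ccontr)
    assume ne: "p \<otimes> e \<noteq> \<zero>"
    let ?r = "{(I, J). ideal I R \<and> ideal J R \<and> I \<subset> J}"
    define F where "F = {L. ideal L R \<and> (\<exists>l\<in>L. \<exists>p\<in>P. l \<otimes> p \<otimes> e \<noteq> \<zero>)}"
    have ne: "carrier R \<in> F" 
    proof -
      have "\<one> \<otimes> p \<otimes> e \<noteq> \<zero>" using ne p0 p(1) by auto
      then show ?thesis unfolding F_def using oneideal p0 by blast
    qed
    obtain L where L: "L \<in> F" and min: "\<And>J. (J, L) \<in> ?r \<Longrightarrow> J \<notin> F"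
      by (rule wfE_min[OF artinian_wf[OF art] ne]) blast
    obtain l p where lp: "l \<in> L" "p \<in> P" "l \<otimes> p \<otimes> e \<noteq> \<zero>" and LI: "ideal L R" using L unfolding F_def by auto
    have [simp]: "l \<in> carrier R" "p \<in> carrier R" using lp p(1) ideal_facts(1)[OF LI] by auto
    define L' where "L' = (\<lambda>x. l \<otimes> x) ` Q"
    have L'I: "ideal L' R" unfolding L'_def by (rule ideal_scale[OF Q]) simp
    have sub: "L' \<subseteq> L" unfolding L'_def using ideal_facts(5)[OF LI] lp q(1) by auto
    have "L' \<in> F"
    proof (rule ccontr)
      assume "L' \<notin> F"
      then have z: "l \<otimes> x \<otimes> y \<otimes> e = \<zero>" if "x \<in> Q" "y \<in> P" for x y
        using L'I that unfolding F_def L'_def by auto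
      have "l \<otimes> y \<otimes> e = \<zero>" if "y \<in> ideal_prod R Q P" for y
        using that
      proof (induction y rule: ideal_prod.induct)
        case (prod i j)
        then have "i \<in> carrier R" "j \<in> carrier R" using p(1) q(1) by auto
        then show ?case using z[OF prod] by (simp add: m_assoc)
      next
        case (sum s1 s2)
        then have "s1 \<in> carrier R" "s2 \<in> carrier R" using QP p(1) by auto
        then have "l \<otimes> (s1 \<oplus> s2) \<otimes> e = l \<otimes> s1 \<otimes> e \<oplus> l \<otimes> s2 \<otimes> e" by (simp add: l_distr r_distr)
        then show ?case using sum by simp
      qed
      then show False using lp QP by auto
    qed
    then have "L' = L" using min[of L'] L'I LI sub by auto
    then obtain x where x: "x \<in> Q" "l = l \<otimes> x" using lp(1) unfolding L'_def by auto
    then obtain m :: nat where m: "x [^] m \<otimes> e = \<zero>" and [simp]: "x \<in> carrier R" unfolding Q_def idem_rad_def by auto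
    have "l = l \<otimes> x [^] j" for j :: nat
    proof (induction j)
      case (Suc j)
      have "l \<otimes> x [^] Suc j = (l \<otimes> x [^] j) \<otimes> x" by (simp add: m_assoc)
      also have "\<dots> = l \<otimes> x" using Suc by simp
      finally show ?case using x by simp
    qed simp
    from this[of m] have "l \<otimes> p \<otimes> e = (l \<otimes> x [^] m) \<otimes> p \<otimes> e" by simp
    also have "\<dots> = l \<otimes> p \<otimes> (x [^] m \<otimes> e)" by (simp add: m_ac)
    finally show False using lp m by simp
  qed
  then show ?thesis using prods_subset_ideal_pow unfolding P_def Q_def by blast
qed

end

section \<open>Descending chains of submodules in integral extensions\<close>

text \<open>Negatives are not demanded; they are obtained from
  \<open>\<ominus> \<one> \<in> A\<close> whenever \<open>A\<close> is a subring.\<close>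

definition submod :: "('a, 'b) ring_scheme \<Rightarrow> 'a set \<Rightarrow> 'a set \<Rightarrow> bool" where
  "submod B A N \<longleftrightarrow> N \<subseteq> carrier B \<and> \<zero>\<^bsub>B\<^esub> \<in> N \<and> (\<forall>x\<in>N. \<forall>y\<in>N. x \<oplus>\<^bsub>B\<^esub> y \<in> N) \<and>
     (\<forall>a\<in>A. \<forall>x\<in>N. a \<otimes>\<^bsub>B\<^esub> x \<in> N)"

definition dcc :: "('a, 'b) ring_scheme \<Rightarrow> 'a set \<Rightarrow> 'a set \<Rightarrow> bool" where
  "dcc B A V \<longleftrightarrow> wf {(N, N'). submod B A N \<and> submod B A N' \<and> N \<subset> N' \<and> N' \<subseteq> V}"

text \<open>The \<open>T\<close>-span of \<open>1, s, ..., s^(n-1)\<close>. That \<open>s^n\<close>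
  lies in it says that \<open>s\<close> is a root of a monic polynomial of degree \<open>n\<close>
  over \<open>T\<close>, which is the form of integrality used from here on.\<close>

primrec power_span :: "('a, 'b) ring_scheme \<Rightarrow> 'a set \<Rightarrow> 'a \<Rightarrow> nat \<Rightarrow> 'a set" where
  "power_span B T s 0 = {\<zero>\<^bsub>B\<^esub>}"
| "power_span B T s (Suc n) =
     {v \<oplus>\<^bsub>B\<^esub> t \<otimes>\<^bsub>B\<^esub> s [^]\<^bsub>B\<^esub> n | v t. v \<in> power_span B T s n \<and> t \<in> T}"

lemma power_spanI:
  "v \<in> power_span B T s n \<Longrightarrow> t \<in> T \<Longrightarrow> v \<oplus>\<^bsub>B\<^esub> t \<otimes>\<^bsub>B\<^esub> s [^]\<^bsub>B\<^esub> n \<in> power_span B T s (Suc n)"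
  by auto

lemma submodD:
  assumes "submod B A N"
  shows "N \<subseteq> carrier B" "\<zero>\<^bsub>B\<^esub> \<in> N" "\<And>x y. x \<in> N \<Longrightarrow> y \<in> N \<Longrightarrow> x \<oplus>\<^bsub>B\<^esub> y \<in> N"
    "\<And>a x. a \<in> A \<Longrightarrow> x \<in> N \<Longrightarrow> a \<otimes>\<^bsub>B\<^esub> x \<in> N"
  using assms unfolding submod_def by auto

lemma submod_Int:
  assumes "submod B A M" "submod B A N" shows "submod B A (M \<inter> N)"
  using assms unfolding submod_def by auto

context cring
begin

lemma submod_minus:
  assumes A: "subring A R" and N: "submod R A N" and x: "x \<in> N" "y \<in> N"
  shows "x \<ominus> y \<in> N"
proof -
  have c: "x \<in> carrier R" "y \<in> carrier R" using submodD(1)[OF N] x by auto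
  have "\<ominus> \<one> \<in> A" using subringE(3,5)[OF A] by simp
  then have "x \<oplus> (\<ominus> \<one> \<otimes> y) \<in> N" using submodD(3,4)[OF N] x by simp
  then show ?thesis using c by (simp add: l_minus minus_eq)
qed

text \<open>A submodule \<open>N\<close> of \<open>V + Tb\<close> is controlled by \<open>N \<inter> V\<close> together with the submodule of \<open>T\<close>
  formed by the coefficients of \<open>b\<close> occurring in \<open>N\<close>; strict descent is lexicographic in this pair.\<close>
lemma dcc_extend:
  assumes A: "subring A R" and V: "submod R A V" and T: "submod R A T" and b[simp]: "b \<in> carrier R"
    and dV: "dcc R A V" and dT: "dcc R A T"
  shows "dcc R A {v \<oplus> t \<otimes> b | v t. v \<in> V \<and> t \<in> T}"
proof -
  let ?r = "\<lambda>V. {(N, N'). submod R A N \<and> submod R A N' \<and> N \<subset> N' \<and> N' \<subseteq> V}"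
  let ?W = "{v \<oplus> t \<otimes> b | v t. v \<in> V \<and> t \<in> T}"
  define h where "h N = {t \<in> T. \<exists>v\<in>V. v \<oplus> t \<otimes> b \<in> N}" for N
  note v = submodD[OF V] and t = submodD[OF T]
  note [simp] = subsetD[OF v(1)] subsetD[OF t(1)]
  have AC[simp]: "a \<in> A \<Longrightarrow> a \<in> carrier R" for a using subringE(1)[OF A] by auto
  have hm: "submod R A (h N)" if N: "submod R A N" for N
    unfolding submod_def
  proof (intro conjI ballI)
    note n = submodD[OF N]
    show "h N \<subseteq> carrier R" unfolding h_def by auto
    show "\<zero> \<in> h N" unfolding h_def using t(2) v(2) n(2) by (auto intro!: bexI[of _ \<zero>])
    fix x assume "x \<in> h N"
    then obtain u where u: "u \<in> V" "u \<oplus> x \<otimes> b \<in> N" and x[simp]: "x \<in> T" unfolding h_def by auto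
    {
      fix y assume "y \<in> h N"
      then obtain w where w: "w \<in> V" "w \<oplus> y \<otimes> b \<in> N" and y[simp]: "y \<in> T" unfolding h_def by auto
      have c: "u \<in> carrier R" "w \<in> carrier R" "x \<in> carrier R" "y \<in> carrier R" using u w by auto
      have "(u \<oplus> w) \<oplus> (x \<oplus> y) \<otimes> b = (u \<oplus> x \<otimes> b) \<oplus> (w \<oplus> y \<otimes> b)" using c b by algebra
      then show "x \<oplus> y \<in> h N" unfolding h_def using u w n v t by (auto intro!: bexI[of _ "u \<oplus> w"])
    }
    fix a assume a: "a \<in> A"
    have c: "u \<in> carrier R" "x \<in> carrier R" "a \<in> carrier R" using u a by auto
    have "(a \<otimes> u) \<oplus> (a \<otimes> x) \<otimes> b = a \<otimes> (u \<oplus> x \<otimes> b)" using c b by algebra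
    then show "a \<otimes> x \<in> h N" unfolding h_def using u n v t a by (auto intro!: bexI[of _ "a \<otimes> u"])
  qed
  have "?r ?W \<subseteq> inv_image (?r V <*lex*> ?r T) (\<lambda>N. (N \<inter> V, h N))"
  proof (rule subrelI)
    fix N N' assume "(N, N') \<in> ?r ?W"
    then have N: "submod R A N" and N': "submod R A N'" and lt: "N \<subset> N'" and W: "N' \<subseteq> ?W" by auto
    note n = submodD[OF N] and n' = submodD[OF N']
    have "N \<inter> V \<subset> N' \<inter> V \<or> (N \<inter> V = N' \<inter> V \<and> h N \<subset> h N')"
    proof (rule ccontr)
      assume "\<not> ?thesis"
      then have eq: "N \<inter> V = N' \<inter> V" "h N = h N'" using lt unfolding h_def by blast+
      have "N' \<subseteq> N"
      proof
        fix x assume x: "x \<in> N'"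
        then obtain u s where us: "x = u \<oplus> s \<otimes> b" "u \<in> V" "s \<in> T" using W by blast
        then have "s \<in> h N" using x eq(2) unfolding h_def by auto
        then obtain w where w: "w \<in> V" "w \<oplus> s \<otimes> b \<in> N" unfolding h_def by auto
        have c: "u \<in> carrier R" "w \<in> carrier R" "s \<in> carrier R" using us w by auto
        have "x \<ominus> (w \<oplus> s \<otimes> b) \<in> N'" using submod_minus[OF A N' x] w lt by auto
        moreover have "x \<ominus> (w \<oplus> s \<otimes> b) = u \<ominus> w" unfolding us(1) using c b by algebra
        ultimately have "u \<ominus> w \<in> N' \<inter> V" using submod_minus[OF A V] us w by auto
        then have "(u \<ominus> w) \<oplus> (w \<oplus> s \<otimes> b) \<in> N" using eq n(3) w by auto
        moreover have "(u \<ominus> w) \<oplus> (w \<oplus> s \<otimes> b) = x" unfolding us(1) using c b by algebra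
        ultimately show "x \<in> N" by simp
      qed
      then show False using lt by auto
    qed
    then show "(N, N') \<in> inv_image (?r V <*lex*> ?r T) (\<lambda>N. (N \<inter> V, h N))"
      using submod_Int[OF N V] submod_Int[OF N' V] hm[OF N] hm[OF N']
      by (auto simp: inv_image_def h_def)
  qed
  moreover have "wf (inv_image (?r V <*lex*> ?r T) (\<lambda>N. (N \<inter> V, h N)))"
    using dV dT unfolding dcc_def by (intro wf_inv_image wf_lex_prod)
  ultimately show ?thesis unfolding dcc_def using wf_subset by blast
qed

lemma dcc_zero: "dcc R A {\<zero>}"
proof -
  have "{(N, N'). submod R A N \<and> submod R A N' \<and> N \<subset> N' \<and> N' \<subseteq> {\<zero>}} = {}"
    by (auto dest: submodD(2))
  then show ?thesis unfolding dcc_def by (simp only: wf_on_bot)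
qed

context
  fixes A T :: "'a set" and s :: 'a
  assumes A: "subring A R" and T: "subring T R" and AT: "A \<subseteq> T" and s[simp]: "s \<in> carrier R"
begin

lemma power_span_submod: "submod R T (power_span R T s n)"
proof (induction n)
  case 0
  show ?case using subringE(1)[OF T] by (auto simp: submod_def)
next
  case (Suc n)
  note v = submodD[OF Suc]
  have tc: "t \<in> T \<Longrightarrow> t \<in> carrier R" for t using subringE(1)[OF T] by auto
  have sn: "s [^] n \<in> carrier R" by simp
  show ?case unfolding submod_def
  proof (intro conjI ballI)
    show "power_span R T s (Suc n) \<subseteq> carrier R" using v(1) tc by auto
    show "\<zero> \<in> power_span R T s (Suc n)" using v(2) subringE(2)[OF T] by (auto intro!: exI[of _ \<zero>])
    fix x assume "x \<in> power_span R T s (Suc n)"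
    then obtain w t where x: "x = w \<oplus> t \<otimes> s [^] n" "w \<in> power_span R T s n" "t \<in> T" by auto
    have c: "w \<in> carrier R" "t \<in> carrier R" using x v(1) tc by auto
    {
      fix y assume "y \<in> power_span R T s (Suc n)"
      then obtain w' t' where y: "y = w' \<oplus> t' \<otimes> s [^] n" "w' \<in> power_span R T s n" "t' \<in> T" by auto
      have c': "w' \<in> carrier R" "t' \<in> carrier R" using y v(1) tc by auto
      have "x \<oplus> y = (w \<oplus> w') \<oplus> (t \<oplus> t') \<otimes> s [^] n" unfolding x y using c c' sn by algebra
      then show "x \<oplus> y \<in> power_span R T s (Suc n)" using power_spanI[OF v(3)[OF x(2) y(2)] subringE(7)[OF T x(3) y(3)]] by simp
    }
    fix a assume a: "a \<in> T"
    have "a \<otimes> x = (a \<otimes> w) \<oplus> (a \<otimes> t) \<otimes> s [^] n" unfolding x using c tc[OF a] sn by algebra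
    then show "a \<otimes> x \<in> power_span R T s (Suc n)" using power_spanI[OF v(4)[OF a x(2)] subringE(6)[OF T a x(3)]] by simp
  qed
qed

lemma power_span_mono: "power_span R T s n \<subseteq> power_span R T s (Suc n)"
proof
  fix x assume x: "x \<in> power_span R T s n"
  then have "x = x \<oplus> \<zero> \<otimes> s [^] n" using submodD(1)[OF power_span_submod, of n] by (auto simp: subset_iff)
  then show "x \<in> power_span R T s (Suc n)" using power_spanI[OF x, of \<zero>] subringE(2)[OF T] by auto
qed

lemma power_span_shift: "x \<in> power_span R T s n \<Longrightarrow> s \<otimes> x \<in> power_span R T s (Suc n)"
proof (induction n arbitrary: x)
  case 0
  then show ?case using submodD(2)[OF power_span_submod, of "Suc 0"] by simp
next
  case (Suc n)
  then obtain w t where x: "x = w \<oplus> t \<otimes> s [^] n" "w \<in> power_span R T s n" "t \<in> T" by auto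
  have c: "w \<in> carrier R" "t \<in> carrier R" using x subringE(1)[OF T] submodD(1)[OF power_span_submod] by auto
  have "s \<otimes> x = s \<otimes> w \<oplus> t \<otimes> s [^] Suc n" unfolding x using c by (simp add: r_distr m_ac)
  then show ?case using Suc.IH[OF x(2)] x(3) by auto
qed

lemma dcc_power_span:
  assumes d: "dcc R A T"
  shows "dcc R A (power_span R T s n)"
proof (induction n)
  case 0
  show ?case using dcc_zero by simp
next
  case (Suc n)
  have 1: "submod R A (power_span R T s n)" for n
    using power_span_submod[of n] AT unfolding submod_def by auto
  have 2: "submod R A T" using subringE[OF T] AT unfolding submod_def by auto
  show ?case using dcc_extend[OF A 1 2 _ Suc d, of "s [^] n"] by simp
qed

text \<open>Once \<open>s^n\<close> lies in the span, the span is stable under multiplication by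
  \<open>s\<close>, hence by every power of \<open>s\<close> and by every
  \<open>T\<close>-combination of powers; this makes it a ring.\<close>

lemma power_span_closed:
  assumes n: "s [^] n \<in> power_span R T s n" and y: "y \<in> power_span R T s n"
  shows "x \<in> power_span R T s m \<Longrightarrow> x \<otimes> y \<in> power_span R T s n"
proof -
  let ?P = "power_span R T s n"
  note v = submodD[OF power_span_submod]
  have sub: "power_span R T s (Suc n) \<subseteq> ?P" using n v(3,4) by auto
  have sc: "s \<otimes> x \<in> ?P" if "x \<in> ?P" for x using power_span_shift[OF that] sub by auto
  have pc: "s [^] m \<otimes> y \<in> ?P" for m :: nat
  proof (induction m)
    case (Suc m)
    have "y \<in> carrier R" using y v(1) by auto
    then have "s [^] Suc m \<otimes> y = s \<otimes> (s [^] m \<otimes> y)" by (simp add: m_ac)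
    then show ?case using sc[OF Suc] by simp
  qed (use y v(1)[of n] in \<open>auto simp: subset_iff\<close>)
  show "x \<in> power_span R T s m \<Longrightarrow> x \<otimes> y \<in> ?P"
  proof (induction m arbitrary: x)
    case 0
    then show ?case using v(2)[of n] y v(1)[of n] by (auto simp: subset_iff)
  next
    case (Suc m)
    then obtain w t where x: "x = w \<oplus> t \<otimes> s [^] m" "w \<in> power_span R T s m" "t \<in> T" by auto
    have c: "w \<in> carrier R" "t \<in> carrier R" "y \<in> carrier R" using x subringE(1)[OF T] v(1) y by auto
    have "x \<otimes> y = w \<otimes> y \<oplus> t \<otimes> (s [^] m \<otimes> y)" unfolding x using c by (simp add: l_distr m_assoc)
    then show ?case using Suc.IH[OF x(2)] pc v(3,4) x(3) by auto
  qed
qed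

text \<open>The witness is \<open>T[s]\<close>, which integrality turns into the span of finitely
  many powers of \<open>s\<close>; each power costs one application of
  \<open>dcc_extend\<close>.\<close>

lemma integral_adjoin_dcc:
  assumes d: "dcc R A T" and n: "s [^] n \<in> power_span R T s n"
  shows "\<exists>T'. subring T' R \<and> T \<subseteq> T' \<and> s \<in> T' \<and> dcc R A T'"
proof -
  let ?P = "power_span R T s n"
  note v = submodD[OF power_span_submod]
  \<comment> \<open>For \<open>n = 0\<close> the span is the zero module and the assumption itself
    reads \<open>\<one> = \<zero>\<close>; otherwise \<open>\<one>\<close> is the first spanning
    power.\<close>
  have one: "\<one> \<in> ?P"
  proof (cases n)
    case 0
    then show ?thesis using n by simp
  next
    case (Suc m)
    have "\<one> \<in> power_span R T s (Suc k)" for k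
    proof (induction k)
      case 0
      show ?case using subringE(1,3)[OF T] by (auto intro!: exI[of _ \<one>])
    next
      case (Suc k)
      then show ?case using power_span_mono by blast
    qed
    then show ?thesis using Suc by simp
  qed
  have "subring ?P R"
  proof (rule subringI)
    show "?P \<subseteq> carrier R" by (rule v(1))
    show "\<one> \<in> ?P" by (rule one)
    show "\<And>h. h \<in> ?P \<Longrightarrow> \<ominus> h \<in> ?P"
    proof -
      fix h assume h: "h \<in> ?P"
      then have "\<zero> \<ominus> h \<in> ?P" using submod_minus[OF T power_span_submod] v(2) by blast
      then show "\<ominus> h \<in> ?P" using h v(1) by (auto simp: minus_eq subset_iff)
    qed
    show "\<And>a b. a \<in> ?P \<Longrightarrow> b \<in> ?P \<Longrightarrow> a \<otimes> b \<in> ?P" using power_span_closed[OF n] by blast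
    show "\<And>a b. a \<in> ?P \<Longrightarrow> b \<in> ?P \<Longrightarrow> a \<oplus> b \<in> ?P" by (rule v(3))
  qed
  moreover have "T \<subseteq> ?P"
  proof
    fix t assume t: "t \<in> T"
    then have "t \<otimes> \<one> \<in> ?P" using v(4) one by blast
    then show "t \<in> ?P" using t subringE(1)[OF T] by auto
  qed
  moreover have "s \<in> ?P"
  proof -
    have "s \<otimes> \<one> \<in> power_span R T s (Suc n)" using power_span_shift[OF one] .
    moreover have "power_span R T s (Suc n) \<subseteq> ?P" using n v(3,4) by auto
    ultimately show ?thesis by auto
  qed
  ultimately show ?thesis using dcc_power_span[OF d] by blast
qed

end

lemma power_span_subset:
  "A \<subseteq> T \<Longrightarrow> power_span R A s n \<subseteq> power_span R T s n"
proof (induction n)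
  case (Suc n)
  then show ?case by (auto simp: subset_iff)
qed simp

text \<open>Generators are adjoined one at a time. Integrality over \<open>A\<close> is inherited
  over the ring \<open>T\<close> reached so far, while the chain condition continues to refer to
  \<open>A\<close>-submodules.\<close>

lemma integral_list_dcc:
  assumes A: "subring A R" and d: "dcc R A A"
    and int: "\<And>s. s \<in> carrier R \<Longrightarrow> \<exists>n. s [^] (n::nat) \<in> power_span R A s n"
  shows "set ss \<subseteq> carrier R \<Longrightarrow> \<exists>T. subring T R \<and> A \<subseteq> T \<and> set ss \<subseteq> T \<and> dcc R A T"
proof (induction ss)
  case Nil
  then show ?case using A d by auto
next
  case (Cons s ss)
  then obtain T where T: "subring T R" "A \<subseteq> T" "set ss \<subseteq> T" "dcc R A T" by auto
  obtain n where "s [^] (n::nat) \<in> power_span R A s n" using int Cons.prems by auto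
  then have "s [^] n \<in> power_span R T s n" using power_span_subset[OF T(2)] by auto
  then obtain T' where "subring T' R" "T \<subseteq> T'" "s \<in> T'" "dcc R A T'"
    using integral_adjoin_dcc[OF A T(1,2) _ T(4), of s n] Cons.prems by auto
  then show ?case using T by (intro exI[of _ T']) auto
qed

lemma subring_cring: "subring T R \<Longrightarrow> cring (R\<lparr>carrier := T\<rparr>)"
  using subcring_iff subringE(1) subcringI' by blast

lemma ideal_subring_submod:
  assumes T: "subring T R" "A \<subseteq> T" and I: "ideal I (R\<lparr>carrier := T\<rparr>)"
  shows "submod R A I" "I \<subseteq> T"
proof -
  interpret T: cring "R\<lparr>carrier := T\<rparr>" by (rule subring_cring[OF T(1)])
  note f = T.ideal_facts[OF I]
  show "I \<subseteq> T" using f(1) by simp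
  then show "submod R A I" unfolding submod_def using f T(2) subringE(1)[OF T(1)] by auto
qed

text \<open>Ideals of an intermediate ring are \<open>A\<close>-submodules of the whole ring. One
  chain condition over \<open>A\<close> thus makes every intermediate ring Artinian, so that an
  arbitrary \<open>T\<close> has its own primitive idempotents.\<close>

lemma dcc_artinian:
  assumes d: "dcc R A (carrier R)" and T: "subring T R" "A \<subseteq> T"
  shows "artinian (R\<lparr>carrier := T\<rparr>)"
  unfolding artinian_def
proof
  assume "\<exists>f. \<forall>n. ideal (f n) (R\<lparr>carrier := T\<rparr>) \<and> f (Suc n) \<subset> f n"
  then obtain f where f: "\<And>n. ideal (f n) (R\<lparr>carrier := T\<rparr>)" "\<And>n. f (Suc n) \<subset> f n" by blast
  have "(f (Suc n), f n) \<in> {(N, N'). submod R A N \<and> submod R A N' \<and> N \<subset> N' \<and> N' \<subseteq> carrier R}" for n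
    using f(2) ideal_subring_submod(1)[OF T f(1)] submodD(1)[OF ideal_subring_submod(1)[OF T f(1)]] by auto
  then show False using d unfolding dcc_def wf_iff_no_infinite_down_chain by blast
qed

lemma artinian_dcc:
  assumes A: "subring A R" and art: "artinian (R\<lparr>carrier := A\<rparr>)"
  shows "dcc R A A"
proof -
  interpret A: cring "R\<lparr>carrier := A\<rparr>" by (rule subring_cring[OF A])
  have "ideal N (R\<lparr>carrier := A\<rparr>)" if "submod R A N" "N \<subseteq> A" for N
    using that by (intro A.cring_idealI) (auto dest: submodD)
  then have "{(N, N'). submod R A N \<and> submod R A N' \<and> N \<subset> N' \<and> N' \<subseteq> A} \<subseteq>
      {(I, J). ideal I (R\<lparr>carrier := A\<rparr>) \<and> ideal J (R\<lparr>carrier := A\<rparr>) \<and> I \<subset> J}" by auto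
  then show ?thesis unfolding dcc_def using wf_subset[OF artinian_wf[OF art]] by blast
qed

end


lemma prodsI: "x \<in> I \<Longrightarrow> y \<in> prods B I n \<Longrightarrow> x \<otimes>\<^bsub>B\<^esub> y \<in> prods B I (Suc n)"
  by auto

lemma prods_mono: "I \<subseteq> J \<Longrightarrow> prods B I n \<subseteq> prods B J n"
  by (induction n) auto

lemma prods_carrier_update: "prods (B\<lparr>carrier := T\<rparr>) I n = prods B I n"
  by (induction n) auto

context cring
begin

lemma finsum_closed_set:
  assumes "finite E" "\<zero> \<in> N" "\<And>x y. x \<in> N \<Longrightarrow> y \<in> N \<Longrightarrow> x \<oplus> y \<in> N" "N \<subseteq> carrier R"
    "\<And>x. x \<in> E \<Longrightarrow> f x \<in> N"
  shows "(\<Oplus>x\<in>E. f x) \<in> N"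
  using assms(1,5)
proof (induction E rule: finite_induct)
  case (insert x E)
  then have "(\<Oplus>x\<in>insert x E. f x) = f x \<oplus> (\<Oplus>x\<in>E. f x)"
    using assms(4) by (intro finsum_insert) auto
  then show ?case using insert assms(3) by auto
qed (simp add: assms(2))

lemma finsum_subring:
  assumes T: "subring T R" and "finite E" "E \<subseteq> T"
  shows "finsum (R\<lparr>carrier := T\<rparr>) (\<lambda>x. x) E = finsum R (\<lambda>x. x) E"
  using assms(2,3)
proof (induction E rule: finite_induct)
  interpret T: cring "R\<lparr>carrier := T\<rparr>" by (rule subring_cring[OF T])
  case empty
  show ?case by (simp add: T.finsum_empty[simplified])
next
  interpret T: cring "R\<lparr>carrier := T\<rparr>" by (rule subring_cring[OF T])
  case (insert x E)
  have "finsum (R\<lparr>carrier := T\<rparr>) (\<lambda>x. x) (insert x E) = x \<oplus> finsum (R\<lparr>carrier := T\<rparr>) (\<lambda>x. x) E"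
    using T.finsum_insert[OF insert(1,2), of "\<lambda>x. x"] insert(4) by (auto simp: subset_iff Pi_def)
  also have "\<dots> = x \<oplus> finsum R (\<lambda>x. x) E" using insert by simp
  also have "\<dots> = finsum R (\<lambda>x. x) (insert x E)"
    using insert subringE(1)[OF T] by (intro finsum_insert[symmetric]) auto
  finally show ?case .
qed

end

section \<open>Local structure of the extension\<close>

text \<open>Condition \<open>unram\<close> expresses \<open>Q = (Q \<inter> A)B + Q\<^sup>2\<close> without generated ideals; \<open>cond\<close> says that the
  conductor of \<open>A\<close> in \<open>B\<close> vanishes.\<close>
locale art_ext = cring B for B :: "'b ring" (structure) +
  fixes A E F :: "'b set"
  assumes A: "subring A B"
    and dccB: "dcc B A (carrier B)"
    and res: "\<And>Q s. primeideal Q B \<Longrightarrow> s \<in> carrier B \<Longrightarrow> \<exists>a\<in>A. s \<ominus> a \<in> Q"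
    and unram: "\<And>Q W. primeideal Q B \<Longrightarrow> ideal W B \<Longrightarrow> Q \<inter> A \<subseteq> W \<Longrightarrow>
        (\<And>x y. x \<in> Q \<Longrightarrow> y \<in> Q \<Longrightarrow> x \<otimes> y \<in> W) \<Longrightarrow> Q \<subseteq> W"
    and flat: "\<And>Q Q' a f. primeideal Q B \<Longrightarrow> primeideal Q' B \<Longrightarrow> Q \<noteq> Q' \<Longrightarrow> Q \<inter> A = Q' \<inter> A \<Longrightarrow>
        a \<in> A \<Longrightarrow> f \<in> carrier B \<Longrightarrow> f \<notin> Q \<Longrightarrow> a \<otimes> f = \<zero> \<Longrightarrow> \<exists>v\<in>A. v \<notin> Q \<and> v \<otimes> a = \<zero>"
    and cond: "\<And>a. a \<in> A \<Longrightarrow> (\<And>b. b \<in> carrier B \<Longrightarrow> a \<otimes> b \<in> A) \<Longrightarrow> a = \<zero>"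
    and E: "orth_decomp (B\<lparr>carrier := A\<rparr>) E \<one>"
    and F: "orth_decomp B F \<one>"
begin

abbreviation M where "M e \<equiv> idem_rad (B\<lparr>carrier := A\<rparr>) e"
abbreviation Q where "Q f \<equiv> idem_rad B f"
definition Fe where "Fe e = {f \<in> F. e \<otimes> f = f}"

lemma AC[simp]: "a \<in> A \<Longrightarrow> a \<in> carrier B" using subringE(1)[OF A] by auto

lemma A_closed[simp]:
  "\<zero> \<in> A" "\<one> \<in> A" "a \<in> A \<Longrightarrow> \<ominus> a \<in> A" "a \<in> A \<Longrightarrow> b \<in> A \<Longrightarrow> a \<otimes> b \<in> A"
  "a \<in> A \<Longrightarrow> b \<in> A \<Longrightarrow> a \<oplus> b \<in> A" "a \<in> A \<Longrightarrow> b \<in> A \<Longrightarrow> a \<ominus> b \<in> A" "a \<in> A \<Longrightarrow> a [^] (n::nat) \<in> A"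
proof -
  show 1: "\<zero> \<in> A" "\<one> \<in> A" "a \<in> A \<Longrightarrow> \<ominus> a \<in> A" "a \<in> A \<Longrightarrow> b \<in> A \<Longrightarrow> a \<otimes> b \<in> A"
  "a \<in> A \<Longrightarrow> b \<in> A \<Longrightarrow> a \<oplus> b \<in> A" for a b using subringE[OF A] by auto
  then show "a \<in> A \<Longrightarrow> b \<in> A \<Longrightarrow> a \<ominus> b \<in> A" by (simp add: minus_eq)
  show "a \<in> A \<Longrightarrow> a [^] (n::nat) \<in> A" by (induction n) (auto simp: 1)
qed

lemma cringA: "cring (B\<lparr>carrier := A\<rparr>)" by (rule subring_cring[OF A])

lemma artA: "artinian (B\<lparr>carrier := A\<rparr>)" using dcc_artinian[OF dccB A] by simp

lemma artB: "artinian B"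
  using dcc_artinian[OF dccB carrier_is_subring] subringE(1)[OF A] by simp

lemmas dE = orth_decompD[OF E, simplified]
lemmas dF = orth_decompD[OF F]

lemma E_idem: 
  assumes "e \<in> E" shows "e \<in> A" "e \<otimes> e = e" "e \<noteq> \<zero>"
  using prim_idemD[OF dE(2)[OF assms]] by auto

lemma F_idem: 
  assumes "f \<in> F" shows "f \<in> carrier B" "f \<otimes> f = f" "f \<noteq> \<zero>"
  using prim_idemD[OF dF(2)[OF assms]] by auto

lemma E_sum: "(\<Oplus>e\<in>E. e) = \<one>"
  using dE(5) finsum_subring[OF A dE(1)] dE(3) by simp

lemma M_ideal: "e \<in> E \<Longrightarrow> ideal (M e) (B\<lparr>carrier := A\<rparr>)"
  using cring.idem_rad_ideal[OF cringA artA dE(2)] .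

lemma M_prime: "e \<in> E \<Longrightarrow> primeideal (M e) (B\<lparr>carrier := A\<rparr>)"
  using cring.idem_rad_prime[OF cringA artA dE(2)] .

lemma M_iff: "x \<in> M e \<longleftrightarrow> x \<in> A \<and> (\<exists>n::nat. x [^] n \<otimes> e = \<zero>)"
  unfolding idem_rad_def by (simp add: nat_pow_consistent[symmetric])

lemma M_unit:
  assumes "e \<in> E" "a \<in> A" "a \<notin> M e" shows "\<exists>b\<in>A. a \<otimes> b \<otimes> e = e"
  using cring.idem_rad_iff[OF cringA artA dE(2)[OF assms(1)], of a] assms(2,3) by simp

lemma M_not_unit:
  assumes "e \<in> E" "a \<in> M e" "b \<in> A" shows "a \<otimes> b \<otimes> e \<noteq> e"
  using cring.idem_rad_iff[OF cringA artA dE(2)[OF assms(1)], of a] assms(2,3) M_iff by simp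

lemma A_ideal_facts:
  assumes "ideal I (B\<lparr>carrier := A\<rparr>)"
  shows "I \<subseteq> A" "\<zero> \<in> I" "\<And>x y. x \<in> I \<Longrightarrow> y \<in> I \<Longrightarrow> x \<oplus> y \<in> I"
    "\<And>a x. a \<in> A \<Longrightarrow> x \<in> I \<Longrightarrow> a \<otimes> x \<in> I" "\<And>a x. a \<in> A \<Longrightarrow> x \<in> I \<Longrightarrow> x \<otimes> a \<in> I"
    "\<And>x. x \<in> I \<Longrightarrow> \<ominus> x \<in> I" "\<And>x y. x \<in> I \<Longrightarrow> y \<in> I \<Longrightarrow> x \<ominus> y \<in> I"
proof -
  note m = cring.ideal_facts[OF cringA assms, simplified]
  show 1: "I \<subseteq> A" "\<zero> \<in> I" "\<And>x y. x \<in> I \<Longrightarrow> y \<in> I \<Longrightarrow> x \<oplus> y \<in> I"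
    "\<And>a x. a \<in> A \<Longrightarrow> x \<in> I \<Longrightarrow> a \<otimes> x \<in> I" "\<And>a x. a \<in> A \<Longrightarrow> x \<in> I \<Longrightarrow> x \<otimes> a \<in> I"
    using m by auto
  show 2: "\<ominus> x \<in> I" if "x \<in> I" for x
  proof -
    have "\<ominus> \<one> \<otimes> x \<in> I" using 1(4) that by simp
    then show ?thesis using that 1(1) by (auto simp: l_minus subset_iff)
  qed
  show "\<And>x y. x \<in> I \<Longrightarrow> y \<in> I \<Longrightarrow> x \<ominus> y \<in> I" using 1 2 by (simp add: minus_eq)
qed

lemma M_facts:
  assumes "e \<in> E"
  shows "M e \<subseteq> A" "\<zero> \<in> M e" "\<And>x y. x \<in> M e \<Longrightarrow> y \<in> M e \<Longrightarrow> x \<oplus> y \<in> M e"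
    "\<And>a x. a \<in> A \<Longrightarrow> x \<in> M e \<Longrightarrow> a \<otimes> x \<in> M e" "\<And>a x. a \<in> A \<Longrightarrow> x \<in> M e \<Longrightarrow> x \<otimes> a \<in> M e"
    "\<And>x. x \<in> M e \<Longrightarrow> \<ominus> x \<in> M e" "\<And>x y. x \<in> M e \<Longrightarrow> y \<in> M e \<Longrightarrow> x \<ominus> y \<in> M e"
    "\<one> \<notin> M e"
  using A_ideal_facts[OF M_ideal[OF assms]] M_not_unit[OF assms, of \<one> \<one>] E_idem[OF assms] by auto

lemma M_nilpotent:
  assumes "e \<in> E" shows "\<exists>k. \<forall>x\<in>prods B (M e) k. x \<otimes> e = \<zero>"
  using cring.idem_rad_nilpotent[OF cringA artA dE(2)[OF assms]] by (simp add: prods_carrier_update)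

lemma Q_prime: "f \<in> F \<Longrightarrow> primeideal (Q f) B" using idem_rad_prime[OF artB dF(2)] .

lemma idem_mult_F:
  assumes "g \<in> carrier B" "g \<otimes> g = g" "f \<in> F"
  shows "g \<otimes> f = \<zero> \<or> g \<otimes> f = f"
proof -
  note f = F_idem[OF assms(3)]
  have "(g \<otimes> f) \<otimes> (g \<otimes> f) = (g \<otimes> g) \<otimes> (f \<otimes> f)" using assms(1) f(1) by (simp add: m_ac)
  then have 1: "(g \<otimes> f) \<otimes> (g \<otimes> f) = g \<otimes> f" using assms f by simp
  have "(g \<otimes> f) \<otimes> f = g \<otimes> f" using assms f by (simp add: m_assoc)
  then show ?thesis using prim_idemD(4)[OF dF(2)[OF assms(3)], of "g \<otimes> f"] 1 assms f by simp
qed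

lemma sum_F_mult:
  assumes "x \<in> carrier B" shows "x = (\<Oplus>f\<in>F. x \<otimes> f)"
proof -
  have "x \<otimes> (\<Oplus>f\<in>F. f) = (\<Oplus>f\<in>F. x \<otimes> f)" using finsum_rdistr[OF dF(1) assms, of "\<lambda>x. x"] dF(3) by auto
  then show ?thesis using dF(5) assms by simp
qed

lemma sum_E_mult:
  assumes "x \<in> carrier B" shows "x = (\<Oplus>e\<in>E. x \<otimes> e)"
proof -
  have "x \<otimes> (\<Oplus>f\<in>E. f) = (\<Oplus>f\<in>E. x \<otimes> f)" 
    using finsum_rdistr[OF dE(1) assms, of "\<lambda>x. x"] dE(3) by (auto simp: subset_iff Pi_def)
  then show ?thesis using E_sum assms by simp
qed

lemma idem_sum_F:
  assumes "g \<in> carrier B" "g \<otimes> g = g"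
  shows "g = (\<Oplus>f\<in>{f\<in>F. g \<otimes> f = f}. f)"
proof -
  have "g = (\<Oplus>f\<in>F. g \<otimes> f)" by (rule sum_F_mult[OF assms(1)])
  also have "\<dots> = (\<Oplus>f\<in>{f\<in>F. g \<otimes> f = f}. g \<otimes> f)"
  proof (rule add.finprod_mono_neutral_cong_right)
    show "\<And>i. i \<in> F - {f \<in> F. g \<otimes> f = f} \<Longrightarrow> g \<otimes> i = \<zero>" using idem_mult_F[OF assms] by auto
  qed (use dF(1,3) assms in auto)
  also have "\<dots> = (\<Oplus>f\<in>{f\<in>F. g \<otimes> f = f}. f)" using dF(3) by (intro finsum_cong') auto
  finally show ?thesis .
qed

lemma Fe_sum: "e \<in> E \<Longrightarrow> e = (\<Oplus>f\<in>Fe e. f)"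
  unfolding Fe_def using idem_sum_F E_idem by auto

lemma Fe_F: "f \<in> Fe e \<Longrightarrow> f \<in> F" "f \<in> Fe e \<Longrightarrow> e \<otimes> f = f" "finite (Fe e)"
  unfolding Fe_def using dF(1) by auto

lemma sum_Fe_mult:
  assumes "x \<in> carrier B" "e \<in> E" shows "x \<otimes> e = (\<Oplus>f\<in>Fe e. x \<otimes> f)"
proof -
  have "x \<otimes> (\<Oplus>f\<in>Fe e. f) = (\<Oplus>f\<in>Fe e. x \<otimes> f)"
    using finsum_rdistr[OF Fe_F(3) assms(1), of "\<lambda>x. x"] F_idem(1) Fe_F(1) by auto
  then show ?thesis using Fe_sum[OF assms(2)] by simp
qed

lemma Fe_exists:
  assumes "f \<in> F" shows "\<exists>e\<in>E. f \<in> Fe e"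
proof (rule ccontr)
  assume "\<not> ?thesis"
  then have z: "e \<otimes> f = \<zero>" if "e \<in> E" for e
    using idem_mult_F[of e f] E_idem[OF that] assms that unfolding Fe_def by auto
  have "f = (\<Oplus>e\<in>E. f \<otimes> e)" using sum_E_mult F_idem[OF assms] by auto
  also have "\<dots> = (\<Oplus>e\<in>E. \<zero>)" using z m_comm F_idem[OF assms] E_idem by (intro finsum_cong') auto
  finally show False using F_idem[OF assms] by simp
qed

text \<open>Multiplication by \<open>f\<close> factors through multiplication by \<open>e\<close>:
  nilpotency at \<open>e\<close> passes to \<open>f\<close>, and an inverse at \<open>e\<close>
  remains an inverse at \<open>f\<close>.\<close>

lemma Q_Int_A:
  assumes e: "e \<in> E" and f: "f \<in> Fe e"
  shows "Q f \<inter> A = M e"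
proof -
  note e' = E_idem[OF e] and f' = F_idem[OF Fe_F(1)[OF f]] and ef = Fe_F(2)[OF f]
  have "x \<in> Q f" if xm: "x \<in> M e" for x
  proof -
    obtain n :: nat where n: "x [^] n \<otimes> e = \<zero>" and x: "x \<in> A" using xm M_iff[of x e] by auto
    have "x [^] n \<otimes> f = (x [^] n \<otimes> e) \<otimes> f" using x e' f' ef by (simp add: m_assoc)
    then show ?thesis using n x f' unfolding idem_rad_def by auto
  qed
  moreover have "x \<in> M e" if x: "x \<in> Q f" "x \<in> A" for x
  proof (rule ccontr)
    assume "x \<notin> M e"
    then obtain b where b: "b \<in> A" "x \<otimes> b \<otimes> e = e" using M_unit[OF e x(2)] by auto
    have "x \<otimes> b \<otimes> f = (x \<otimes> b \<otimes> e) \<otimes> f" using x(2) b(1) e'(1) f'(1) ef by (simp add: m_assoc)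
    also have "\<dots> = f" using b ef by simp
    finally show False using unit_not_in_idem_rad[OF dF(2)[OF Fe_F(1)[OF f]], of x b] x b by simp
  qed
  ultimately show ?thesis using M_facts(1)[OF e] by auto
qed

text \<open>The Nakayama argument in terms of colon modules. \<open>c1\<close> replaces squares by
  arbitrary powers in the assumption \<open>unram\<close>; \<open>c2\<close> is an induction on the
  exponent of \<open>m = P \<inter> A\<close> that absorbs the powers of \<open>m\<close> one by one
  into a submodule \<open>N\<close> containing \<open>Af\<close>.\<close>

lemma local_eq:
  assumes f: "f \<in> F" and b: "b \<in> carrier B"
  shows "\<exists>a\<in>A. b \<otimes> f = a \<otimes> f"
proof -
  define P where "P = Q f"
  define m where "m = P \<inter> A"
  note f' = F_idem[OF f]
  note [simp] = f'(1)
  have pr: "primeideal P B" unfolding P_def by (rule Q_prime[OF f])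
  then have PI: "ideal P B" by (rule primeideal.axioms(1))
  note p = ideal_facts[OF PI]
  obtain k where k: "\<And>x. x \<in> prods B P k \<Longrightarrow> x \<otimes> f = \<zero>"
    using idem_rad_nilpotent[OF artB dF(2)[OF f]] unfolding P_def by blast
  have pc: "prods B P i \<subseteq> carrier B" for i using p(1) by (induction i) auto
  have c1: "\<And>W. ideal W B \<Longrightarrow> m \<subseteq> W \<Longrightarrow> prods B P (Suc i) \<subseteq> W \<Longrightarrow> P \<subseteq> W" for i
  proof (induction i)
    case 0
    have "x \<in> prods B P (Suc 0)" if "x \<in> P" for x using that p(1) by (auto intro!: exI[of _ x])
    then show ?case using 0 by blast
  next
    case (Suc i)
    note w = ideal_facts[OF Suc.prems(1)]
    \<comment> \<open>The colon ideal \<open>(W : P)\<close>. It contains \<open>m\<close> and needs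
      one factor from \<open>P\<close> less, so the induction hypothesis gives
      \<open>PP \<subseteq> W\<close>, which is what \<open>unram\<close> asks for.\<close>
    define W' where "W' = {y \<in> carrier B. \<forall>x\<in>P. x \<otimes> y \<in> W}"
    have "ideal W' B"
    proof (rule cring_idealI)
      show "x \<oplus> y \<in> W'" if "x \<in> W'" "y \<in> W'" for x y
        using that w p(1) unfolding W'_def by (auto simp: r_distr subset_iff)
      show "a \<otimes> x \<in> W'" if "a \<in> carrier B" "x \<in> W'" for a x
      proof -
        have "y \<otimes> (a \<otimes> x) \<in> W" if y: "y \<in> P" for y
        proof -
          have "a \<otimes> (y \<otimes> x) \<in> W" using w(4) \<open>a \<in> carrier B\<close> \<open>x \<in> W'\<close> y unfolding W'_def by auto
          moreover have "a \<otimes> (y \<otimes> x) = y \<otimes> (a \<otimes> x)"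
            using \<open>a \<in> carrier B\<close> \<open>x \<in> W'\<close> y p(1) unfolding W'_def by (auto simp: m_lcomm subset_iff)
          ultimately show ?thesis by simp
        qed
        then show ?thesis using that unfolding W'_def by auto
      qed
    qed (use w p(1) in \<open>auto simp: W'_def\<close>)
    moreover have "m \<subseteq> W'"
      using Suc.prems(2) w p(1) unfolding W'_def m_def by (auto simp: subset_iff)
    moreover have "prods B P (Suc i) \<subseteq> W'"
    proof
      fix x assume x: "x \<in> prods B P (Suc i)"
      have "y \<otimes> x \<in> W" if "y \<in> P" for y
        using Suc.prems(3) prodsI[OF that x] by blast
      then show "x \<in> W'" using x pc unfolding W'_def by blast
    qed
    ultimately have "P \<subseteq> W'" by (rule Suc.IH)
    then show ?case using unram[OF pr Suc.prems(1)] Suc.prems(2) unfolding W'_def m_def by blast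
  qed
  have mA: "x \<in> m \<Longrightarrow> x \<in> A" for x unfolding m_def by auto
  have mc: "prods B m i \<subseteq> carrier B" for i using mA by (induction i) auto
  have c2: "\<And>N. submod B A N \<Longrightarrow> (\<And>a. a \<in> A \<Longrightarrow> a \<otimes> f \<in> N) \<Longrightarrow>
      (\<And>x b. x \<in> prods B m i \<Longrightarrow> b \<in> carrier B \<Longrightarrow> x \<otimes> b \<otimes> f \<in> N) \<Longrightarrow> \<forall>b\<in>carrier B. b \<otimes> f \<in> N" for i
  proof (induction i)
    case 0
    show ?case
    proof
      fix b assume "b \<in> carrier B"
      then show "b \<otimes> f \<in> N" using 0(3)[of \<one> b] by simp
    qed
  next
    case (Suc i)
    note n = submodD[OF Suc.prems(1)]
    \<comment> \<open>The colon submodule \<open>(N : m)\<close> needs one factor from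
      \<open>m\<close> less; the induction hypothesis yields
      \<open>m B f \<subseteq> N\<close>.\<close>
    define N' where "N' = {y \<in> carrier B. \<forall>x\<in>m. x \<otimes> y \<in> N}"
    have "submod B A N'"
      unfolding submod_def
    proof (intro conjI ballI)
      show "a \<otimes> x \<in> N'" if a: "a \<in> A" "x \<in> N'" for a x
      proof -
        have "y \<otimes> (a \<otimes> x) \<in> N" if y: "y \<in> m" for y
        proof -
          have "a \<otimes> (y \<otimes> x) \<in> N" using n(4) a y unfolding N'_def by auto
          moreover have "a \<otimes> (y \<otimes> x) = y \<otimes> (a \<otimes> x)"
            using a y mA unfolding N'_def by (auto simp: m_lcomm)
          ultimately show ?thesis by simp
        qed
        then show ?thesis using a unfolding N'_def by auto
      qed
    qed (use n mA in \<open>auto simp: N'_def r_distr\<close>)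
    moreover have "a \<otimes> f \<in> N'" if a: "a \<in> A" for a
    proof -
      have "x \<otimes> (a \<otimes> f) \<in> N" if "x \<in> m" for x
        using Suc.prems(2)[of "x \<otimes> a"] mA[OF that] a by (simp add: m_assoc)
      then show ?thesis using a unfolding N'_def by auto
    qed
    moreover have "x \<otimes> b \<otimes> f \<in> N'" if x: "x \<in> prods B m i" "b \<in> carrier B" for x b
    proof -
      have xc: "x \<in> carrier B" using x mc by auto
      have "y \<otimes> (x \<otimes> b \<otimes> f) \<in> N" if "y \<in> m" for y
      proof -
        have "y \<otimes> x \<in> prods B m (Suc i)" using that x by auto
        then have "y \<otimes> x \<otimes> b \<otimes> f \<in> N" using Suc.prems(3) x by simp
        then show ?thesis using that x xc mA by (simp add: m_assoc)
      qed
      then show ?thesis using xc x unfolding N'_def by auto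
    qed
    ultimately have N': "\<forall>b\<in>carrier B. b \<otimes> f \<in> N'" by (rule Suc.IH)
    \<comment> \<open>The largest ideal whose product with \<open>Bf\<close> stays in
      \<open>N\<close>. It contains \<open>m\<close> by the previous step and \<open>P^(k+1)\<close>
      because \<open>P^k\<close> vanishes at \<open>f\<close>, so it contains \<open>P\<close>; then
      \<open>B = A + P\<close> brings all of \<open>Bf\<close> into \<open>N\<close>.\<close>
    define W where "W = {y \<in> carrier B. \<forall>b\<in>carrier B. y \<otimes> b \<otimes> f \<in> N}"
    have W: "ideal W B"
    proof (rule cring_idealI)
      show "a \<otimes> x \<in> W" if a: "a \<in> carrier B" "x \<in> W" for a x
      proof -
        have "a \<otimes> x \<otimes> b \<otimes> f \<in> N" if b: "b \<in> carrier B" for b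
        proof -
          have "x \<otimes> (a \<otimes> b) \<otimes> f \<in> N" using a b unfolding W_def by auto
          moreover have "x \<otimes> (a \<otimes> b) \<otimes> f = a \<otimes> x \<otimes> b \<otimes> f" using a b unfolding W_def by (simp add: m_ac)
          ultimately show ?thesis by simp
        qed
        then show ?thesis using a unfolding W_def by auto
      qed
    qed (use n in \<open>auto simp: W_def l_distr\<close>)
    have "m \<subseteq> W"
    proof
      fix x assume x: "x \<in> m"
      then have "x \<otimes> b \<otimes> f \<in> N" if "b \<in> carrier B" for b
        using N' that mA[OF x] unfolding N'_def by (auto simp: m_assoc)
      then show "x \<in> W" using mA[OF x] unfolding W_def by auto
    qed
    moreover have "prods B P (Suc k) \<subseteq> W"
    proof
      fix x assume "x \<in> prods B P (Suc k)"
      then obtain y z where yz: "x = y \<otimes> z" "y \<in> P" "z \<in> prods B P k" by auto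
      have c: "y \<in> carrier B" "z \<in> carrier B" using yz p(1) pc by auto
      have "x \<otimes> b \<otimes> f \<in> N" if b: "b \<in> carrier B" for b
      proof -
        have "x \<otimes> b \<otimes> f = y \<otimes> b \<otimes> (z \<otimes> f)" unfolding yz using c b by (simp add: m_ac)
        then show ?thesis using k[OF yz(3)] n(2) c b by simp
      qed
      then show "x \<in> W" using c yz(1) unfolding W_def by auto
    qed
    ultimately have PW: "P \<subseteq> W" using c1[OF W] by blast
    show ?case
    proof
      fix b assume b: "b \<in> carrier B"
      obtain a where a: "a \<in> A" "b \<ominus> a \<in> P" using res[OF pr b] by auto
      then have "(b \<ominus> a) \<otimes> \<one> \<otimes> f \<in> N" using PW unfolding W_def by auto
      then have "(b \<ominus> a) \<otimes> \<one> \<otimes> f \<oplus> a \<otimes> f \<in> N" using n(3) Suc.prems(2) a by auto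
      moreover have "(b \<ominus> a) \<otimes> \<one> \<otimes> f \<oplus> a \<otimes> f = b \<otimes> f"
        using b AC[OF a(1)] f'(1) by algebra
      ultimately show "b \<otimes> f \<in> N" by simp
    qed
  qed
  define N where "N = {a \<otimes> f | a. a \<in> A}"
  have "submod B A N"
    unfolding submod_def
  proof (intro conjI ballI)
    show "\<zero> \<in> N" unfolding N_def by (auto intro!: exI[of _ \<zero>])
    fix x assume "x \<in> N"
    then obtain a where a: "a \<in> A" "x = a \<otimes> f" unfolding N_def by auto
    show "c \<otimes> x \<in> N" if "c \<in> A" for c
      unfolding N_def using a that by (auto intro!: exI[of _ "c \<otimes> a"] simp: m_assoc)
    fix y assume "y \<in> N"
    then obtain a' where a': "a' \<in> A" "y = a' \<otimes> f" unfolding N_def by auto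
    show "x \<oplus> y \<in> N"
      unfolding N_def using a a' by (auto intro!: exI[of _ "a \<oplus> a'"] simp: l_distr)
  qed (auto simp: N_def)
  moreover have "a \<otimes> f \<in> N" if "a \<in> A" for a unfolding N_def using that by auto
  moreover have "x \<otimes> b \<otimes> f \<in> N" if x: "x \<in> prods B m k" "b \<in> carrier B" for x b
  proof -
    have "x \<in> prods B P k" using prods_mono[of m P B k] x unfolding m_def by auto
    then have "b \<otimes> (x \<otimes> f) = \<zero>" using k x by simp
    then have "x \<otimes> b \<otimes> f = \<zero>" using x mc[of k] by (metis f'(1) m_comm m_assoc subsetD)
    moreover have "\<zero> \<in> N" unfolding N_def by (auto intro!: exI[of _ \<zero>])
    ultimately show ?thesis by simp
  qed
  ultimately have "\<forall>b\<in>carrier B. b \<otimes> f \<in> N" by (rule c2)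
  then show ?thesis using b unfolding N_def by auto
qed

lemma Fe_two:
  assumes e: "e \<in> E"
  shows "\<exists>f\<in>Fe e. \<exists>g\<in>Fe e. f \<noteq> g"
proof (rule ccontr)
  assume "\<not> ?thesis"
  then have "Fe e = {} \<or> (\<exists>f. Fe e = {f})" by blast
  then show False
  proof
    assume "Fe e = {}"
    then show False using Fe_sum[OF e] E_idem[OF e] by simp
  next
    assume "\<exists>f. Fe e = {f}"
    then obtain f where f: "Fe e = {f}" by auto
    then have fF: "f \<in> F" using Fe_F by auto
    have "e = f" using Fe_sum[OF e] f F_idem[OF fF] by simp
    have "e \<otimes> b \<in> A" if b: "b \<in> carrier B" for b
    proof -
      obtain a where "a \<in> A" "b \<otimes> f = a \<otimes> f" using local_eq[OF fF b] by auto
      then have "e \<otimes> b = a \<otimes> e" using \<open>e = f\<close> b F_idem[OF fF] m_comm by simp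
      then show ?thesis using \<open>a \<in> A\<close> E_idem[OF e] by simp
    qed
    then show False using cond[of e] E_idem[OF e] by auto
  qed
qed

lemma Q_inj:
  assumes "f \<in> F" "g \<in> F" "f \<noteq> g" shows "Q f \<noteq> Q g"
proof -
  have "f \<notin> Q f" using unit_not_in_idem_rad[OF dF(2)[OF assms(1)], of f \<one>] F_idem[OF assms(1)] by simp
  moreover have "f \<in> Q g" unfolding idem_rad_def using dF(4)[OF assms] F_idem[OF assms(1)]
    by (auto intro!: exI[of _ "1::nat"])
  ultimately show ?thesis by auto
qed

text \<open>This is the freeness of \<open>Be\<close>: a coefficient is determined at
  \<open>e\<close> by a single coordinate. A second idempotent \<open>g\<close> below
  \<open>e\<close> supplies the other prime over \<open>M e\<close> that the assumption
  \<open>flat\<close> asks for; the annihilator \<open>v\<close> it yields is invertible at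
  \<open>e\<close>.\<close>

lemma coef_zero:
  assumes e: "e \<in> E" and f: "f \<in> Fe e" and a: "a \<in> A" "a \<otimes> f = \<zero>"
  shows "a \<otimes> e = \<zero>"
proof -
  obtain g where g: "g \<in> Fe e" "g \<noteq> f" using Fe_two[OF e] by metis
  note fF = Fe_F(1)[OF f] and gF = Fe_F(1)[OF g(1)]
  have "f \<notin> Q f" using unit_not_in_idem_rad[OF dF(2)[OF fF], of f \<one>] F_idem[OF fF] by simp
  then obtain v where v: "v \<in> A" "v \<notin> Q f" "v \<otimes> a = \<zero>"
    using flat[OF Q_prime[OF fF] Q_prime[OF gF] Q_inj[OF fF gF g(2)[symmetric]], of a f]
      Q_Int_A[OF e] f g a F_idem[OF fF] by auto
  then have "v \<notin> M e" using Q_Int_A[OF e f] by auto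
  then obtain b where b: "b \<in> A" "v \<otimes> b \<otimes> e = e" using M_unit[OF e v(1)] by auto
  have "a \<otimes> e = a \<otimes> (v \<otimes> b \<otimes> e)" using b by simp
  also have "\<dots> = b \<otimes> e \<otimes> (v \<otimes> a)" using a(1) v(1) b(1) E_idem[OF e] by (simp add: m_ac)
  finally show ?thesis using v b E_idem[OF e] by simp
qed

lemma M_inj:
  assumes "e \<in> E" "e' \<in> E" "M e = M e'" shows "e = e'"
proof (rule ccontr)
  assume "e \<noteq> e'"
  then have "e \<otimes> e' = \<zero>" using dE(4) assms by simp
  then have "e \<in> M e'" using M_iff E_idem[OF assms(1)] by (auto intro!: exI[of _ "1::nat"])
  then have "e \<in> M e" using assms by simp
  then show False using M_not_unit[OF assms(1), of e \<one>] E_idem[OF assms(1)] by simp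
qed

lemma primes_over:
  assumes e: "e \<in> E"
  shows "{P. primeideal P B \<and> P \<inter> A = M e} = Q ` Fe e"
proof (intro equalityI subsetI)
  fix P assume "P \<in> {P. primeideal P B \<and> P \<inter> A = M e}"
  then have P: "primeideal P B" "P \<inter> A = M e" by auto
  obtain f where f: "f \<in> F" "P = Q f" using prime_eq_idem_rad[OF artB F P(1)] by auto
  obtain e' where e': "e' \<in> E" "f \<in> Fe e'" using Fe_exists[OF f(1)] by auto
  have "M e' = M e" using Q_Int_A[OF e'] P f by simp
  then show "P \<in> Q ` Fe e" using M_inj[OF e'(1) e] e' f by auto
next
  fix P assume "P \<in> Q ` Fe e"
  then show "P \<in> {P. primeideal P B \<and> P \<inter> A = M e}" using Q_Int_A[OF e] Q_prime Fe_F(1) by auto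
qed

lemma card_primes_over:
  assumes e: "e \<in> E"
  shows "card {P. primeideal P B \<and> P \<inter> A = M e} = card (Fe e)"
  unfolding primes_over[OF e] using Q_inj Fe_F(1) by (intro card_image) (meson inj_onI)

end


section \<open>Counting intermediate rings\<close>

lemma finite_image_factor:
  assumes "finite (k ` D)" "\<And>x y. x \<in> D \<Longrightarrow> y \<in> D \<Longrightarrow> k x = k y \<Longrightarrow> h x = h y"
  shows "finite (h ` D)"
proof -
  have "h ` D \<subseteq> (\<lambda>s. h (SOME x. x \<in> D \<and> k x = s)) ` k ` D"
  proof
    fix z assume "z \<in> h ` D"
    then obtain x where x: "x \<in> D" "z = h x" by auto
    define y where "y = (SOME y. y \<in> D \<and> k y = k x)"
    have "y \<in> D \<and> k y = k x" unfolding y_def by (rule someI[of _ x]) (use x in auto)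
    then have "z = h y" using assms(2) x by metis
    then show "z \<in> (\<lambda>s. h (SOME x. x \<in> D \<and> k x = s)) ` k ` D" using x unfolding y_def by auto
  qed
  then show ?thesis using assms(1) finite_subset by blast
qed

section \<open>Infinite residue fields and principal maximal ideals\<close>

context art_ext
begin

lemma A_idealI:
  assumes "I \<subseteq> A" "\<zero> \<in> I" "\<And>x y. x \<in> I \<Longrightarrow> y \<in> I \<Longrightarrow> x \<oplus> y \<in> I"
    "\<And>a x. a \<in> A \<Longrightarrow> x \<in> I \<Longrightarrow> a \<otimes> x \<in> I"
  shows "ideal I (B\<lparr>carrier := A\<rparr>)"
  using assms by (intro cring.cring_idealI[OF cringA]) auto

lemma ideal_scale_A:
  assumes "ideal I (B\<lparr>carrier := A\<rparr>)" "a \<in> A"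
  shows "ideal ((\<lambda>x. a \<otimes> x) ` I) (B\<lparr>carrier := A\<rparr>)"
  using cring.ideal_scale[OF cringA assms(1), of a] assms(2) by simp

lemma A_whole_ideal: "ideal A (B\<lparr>carrier := A\<rparr>)"
  by (rule A_idealI) auto

text \<open>A minimal infinite ideal below \<open>e\<close> is a finite union of principal ideals, and each of these would
  be finite if the residue field were.\<close>
lemma residue_infinite:
  assumes fm: "FMIR (B\<lparr>carrier := A\<rparr>)" and e: "e \<in> E" and inf: "infinite ((\<lambda>a. e \<otimes> a) ` A)"
    and D: "finite D" "D \<subseteq> A"
  shows "\<exists>\<alpha>\<in>A. \<forall>x\<in>D. \<alpha> \<ominus> x \<notin> M e"
proof (rule ccontr)
  assume "\<not> ?thesis"
  then have cov: "\<exists>x\<in>D. \<alpha> \<ominus> x \<in> M e" if "\<alpha> \<in> A" for \<alpha> using that by blast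
  note e' = E_idem[OF e] and m = M_facts[OF e]
  let ?eA = "(\<lambda>a. e \<otimes> a) ` A"
  have "I \<subseteq> ?eA \<longrightarrow> ideal I (B\<lparr>carrier := A\<rparr>) \<longrightarrow> finite I" for I
  proof (induction I rule: wf_induct_rule[OF artinian_wf[OF artA]])
    case (1 I)
    show ?case
    proof (intro impI)
      assume sub: "I \<subseteq> ?eA" and I: "ideal I (B\<lparr>carrier := A\<rparr>)"
      note i = A_ideal_facts[OF I]
      let ?J = "\<lambda>x. (\<lambda>a. x \<otimes> a) ` A"
      have "finite (?J x)" if x: "x \<in> I" for x
      proof (cases "x = \<zero>")
        case True
        then have "?J x \<subseteq> {\<zero>}" by auto
        then show ?thesis using finite_subset by blast
      next
        case False
        have xA: "x \<in> A" using x i(1) by auto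
        have xe: "x \<otimes> e = x"
        proof -
          obtain a where a: "a \<in> A" "x = e \<otimes> a" using x sub by auto
          have "e \<otimes> a \<otimes> e = (e \<otimes> e) \<otimes> a" using a(1) e'(1) by (simp add: m_ac)
          then show ?thesis using a e' by simp
        qed
        \<comment> \<open>\<open>x M\<close> omits \<open>x\<close> because elements of
          \<open>M e\<close> are nilpotent at \<open>e\<close>, so it is a smaller ideal and finite
          by induction; the residue representatives in \<open>D\<close> then cover
          \<open>x A\<close> by finitely many cosets of \<open>x M\<close>.\<close>
        let ?K = "(\<lambda>a. x \<otimes> a) ` M e"
        have K: "ideal ?K (B\<lparr>carrier := A\<rparr>)" by (rule ideal_scale_A[OF M_ideal[OF e] xA])
        have KI: "?K \<subseteq> I" using i(5) x m(1) by auto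
        have "x \<notin> ?K"
        proof
          assume "x \<in> ?K"
          then obtain y where y: "y \<in> M e" "x = x \<otimes> y" by auto
          then obtain n :: nat where n: "y [^] n \<otimes> e = \<zero>" "y \<in> A" using M_iff[of y e] by auto
          have "x = x \<otimes> y [^] j" for j :: nat
          proof (induction j)
            case (Suc j)
            have "x \<otimes> y [^] Suc j = (x \<otimes> y [^] j) \<otimes> y" using xA n(2) by (simp add: m_assoc)
            then show ?case using Suc y(2) by simp
          qed (use xA in simp)
          from this[of n] have "x \<otimes> e = x \<otimes> (y [^] n \<otimes> e)" using xA n(2) e'(1) m_assoc by (metis AC nat_pow_closed)
          then show False using n xe False xA by simp
        qed
        then have "?K \<subset> I" using KI x by auto
        then have fK: "finite ?K" using 1[of ?K] K I KI sub by auto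
        have "?J x \<subseteq> (\<Union>y\<in>D. (\<lambda>k. x \<otimes> y \<oplus> k) ` ?K)"
        proof
          fix z assume "z \<in> ?J x"
          then obtain a where a: "a \<in> A" "z = x \<otimes> a" by auto
          obtain y where y: "y \<in> D" "a \<ominus> y \<in> M e" using cov[OF a(1)] by auto
          have c: "x \<in> carrier B" "a \<in> carrier B" "y \<in> carrier B" using xA a y D by auto
          have "z = x \<otimes> y \<oplus> x \<otimes> (a \<ominus> y)" unfolding a(2) using c by algebra
          then show "z \<in> (\<Union>y\<in>D. (\<lambda>k. x \<otimes> y \<oplus> k) ` ?K)" using y by auto
        qed
        then show ?thesis using fK D(1) finite_subset by (metis (no_types, lifting) finite_UN finite_imageI)
      qed
      moreover have "finite (?J ` I)"
      proof -
        have "?J ` I \<subseteq> {I. ideal I (B\<lparr>carrier := A\<rparr>)}"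
          using ideal_scale_A[OF A_whole_ideal] i(1) by auto
        then show ?thesis using fm unfolding FMIR_def using finite_subset by blast
      qed
      ultimately have "finite (\<Union>(?J ` I))" by blast
      moreover have "I \<subseteq> \<Union>(?J ` I)"
      proof
        fix x assume x: "x \<in> I"
        then have "x = x \<otimes> \<one>" using i(1) by auto
        then have "x \<in> ?J x" by (rule image_eqI) simp
        then show "x \<in> \<Union>(?J ` I)" using x by blast
      qed
      ultimately show "finite I" using finite_subset by blast
    qed
  qed
  from this[of ?eA] ideal_scale_A[OF A_whole_ideal e'(1)] inf show False by auto
qed

text \<open>Among the ideals generated by \<open>x + \<alpha>y\<close>, with \<open>\<alpha>\<close> in the infinite residue field, two coincide and
  so contain both \<open>x\<close> and \<open>y\<close>.\<close>
lemma M_principal: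
  assumes fm: "FMIR (B\<lparr>carrier := A\<rparr>)" and e: "e \<in> E" and inf: "infinite ((\<lambda>a. e \<otimes> a) ` A)"
  shows "\<exists>x\<in>M e. \<forall>y\<in>M e. \<exists>z\<in>A. e \<otimes> y = e \<otimes> (x \<otimes> z)"
proof -
  note e' = E_idem[OF e] and m = M_facts[OF e]
  define J where "J x = (\<lambda>a. (e \<otimes> x) \<otimes> a) ` A" for x
  have JI: "ideal (J x) (B\<lparr>carrier := A\<rparr>)" if "x \<in> A" for x
    unfolding J_def using that e' by (intro ideal_scale_A[OF A_whole_ideal]) simp
  have fin: "finite (J ` D)" if "D \<subseteq> A" for D
    by (rule finite_subset[OF _ fm[unfolded FMIR_def]]) (use JI that in auto)
  have self: "e \<otimes> x \<in> J x" if "x \<in> A" for x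
    unfolding J_def using that e' by (intro image_eqI[of _ _ \<one>]) auto
  have "J ` M e \<noteq> {}" using m(2) by auto
  \<comment> \<open>A maximal one among the finitely many ideals \<open>J x\<close>; the rest of the
    argument shows that it contains \<open>e y\<close> for every \<open>y \<in> M e\<close>.\<close>
  then obtain x where x: "x \<in> M e" and max: "\<And>y. y \<in> M e \<Longrightarrow> J x \<subseteq> J y \<Longrightarrow> J x = J y"
    using finite_has_maximal[OF fin[OF m(1)]] by auto
  have xA: "x \<in> A" using x m(1) by auto
  have "\<exists>z\<in>A. e \<otimes> y = e \<otimes> (x \<otimes> z)" if y: "y \<in> M e" for y
  proof -
    have yA: "y \<in> A" using y m(1) by auto
    define g where "g \<alpha> = J (x \<oplus> \<alpha> \<otimes> y)" for \<alpha>
    have "g ` A = J ` (\<lambda>\<alpha>. x \<oplus> \<alpha> \<otimes> y) ` A" unfolding g_def by auto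
    moreover have "(\<lambda>\<alpha>. x \<oplus> \<alpha> \<otimes> y) ` A \<subseteq> A" using xA yA by auto
    ultimately have "finite (g ` A)" using fin by presburger
    then obtain D where D: "D \<subseteq> A" "finite D" "g ` A = g ` D"
      using finite_subset_image[OF _ subset_refl, of g A] by blast
    obtain \<alpha> where \<alpha>: "\<alpha> \<in> A" "\<forall>x\<in>D. \<alpha> \<ominus> x \<notin> M e" using residue_infinite[OF fm e inf D(2,1)] by auto
    then obtain \<beta> where \<beta>: "\<beta> \<in> D" "g \<alpha> = g \<beta>" using D(3) by blast
    have \<beta>A: "\<beta> \<in> A" using \<beta> D by auto
    \<comment> \<open>The generators for \<open>\<alpha>\<close> and for \<open>\<beta>\<close> both
      lie in the common ideal; their difference is \<open>(\<alpha> \<ominus> \<beta>) y\<close> at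
      \<open>e\<close>, and this scalar is invertible there because it is not in
      \<open>M e\<close>.\<close>
    obtain c where c: "c \<in> A" "(\<alpha> \<ominus> \<beta>) \<otimes> c \<otimes> e = e"
      using M_unit[OF e, of "\<alpha> \<ominus> \<beta>"] \<alpha> \<beta> \<beta>A by auto
    let ?z = "x \<oplus> \<alpha> \<otimes> y"
    have zA: "?z \<in> A" using xA yA \<alpha> by simp
    have zM: "?z \<in> M e" using x y \<alpha> m by simp
    note j = A_ideal_facts[OF JI[OF zA]]
    have 1: "e \<otimes> ?z \<in> J ?z" by (rule self[OF zA])
    have 2: "e \<otimes> (x \<oplus> \<beta> \<otimes> y) \<in> J ?z" using self[of "x \<oplus> \<beta> \<otimes> y"] \<beta> \<beta>A xA yA unfolding g_def by simp
    have cc: "x \<in> carrier B" "y \<in> carrier B" "\<alpha> \<in> carrier B" "\<beta> \<in> carrier B" "c \<in> carrier B" "e \<in> carrier B"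
      using xA yA \<alpha> \<beta>A c e' by auto
    have "c \<otimes> (e \<otimes> ?z \<ominus> e \<otimes> (x \<oplus> \<beta> \<otimes> y)) \<in> J ?z" using j(4)[OF c(1) j(7)[OF 1 2]] .
    moreover have "c \<otimes> (e \<otimes> ?z \<ominus> e \<otimes> (x \<oplus> \<beta> \<otimes> y)) = ((\<alpha> \<ominus> \<beta>) \<otimes> c \<otimes> e) \<otimes> y"
      using cc by algebra
    ultimately have yJ: "e \<otimes> y \<in> J ?z" using c by simp
    have "e \<otimes> ?z \<ominus> \<alpha> \<otimes> (e \<otimes> y) \<in> J ?z" using j(7)[OF 1 j(4)[OF \<alpha>(1) yJ]] .
    moreover have "e \<otimes> ?z \<ominus> \<alpha> \<otimes> (e \<otimes> y) = e \<otimes> x" using cc by algebra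
    ultimately have "e \<otimes> x \<in> J ?z" by simp
    then have "J x \<subseteq> J ?z" using j(5) unfolding J_def[of x] by auto
    then have "J x = J ?z" using max zM by auto
    then have "e \<otimes> y \<in> J x" using yJ by simp
    then obtain a where "a \<in> A" "e \<otimes> y = (e \<otimes> x) \<otimes> a" unfolding J_def by auto
    then show ?thesis using cc by (auto intro!: bexI[of _ a] simp: m_assoc)
  qed
  then show ?thesis using x by auto
qed

section \<open>Embedding the ideals of \<open>A\<close> into the intermediate rings\<close>

lemma F_orth: "f \<in> F \<Longrightarrow> g \<in> F \<Longrightarrow> f \<otimes> g = (if f = g then f else \<zero>)"
  using dF(4) F_idem by auto

lemma coef_eq:
  assumes "e \<in> E" "f \<in> Fe e" "a \<in> A" "c \<in> A" "a \<otimes> f = c \<otimes> f"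
  shows "e \<otimes> a = e \<otimes> c"
proof -
  note f = F_idem[OF Fe_F(1)[OF assms(2)]] and e' = E_idem[OF assms(1)]
  have cc: "a \<in> carrier B" "c \<in> carrier B" "f \<in> carrier B" "e \<in> carrier B" using assms f e' by auto
  have "(a \<ominus> c) \<otimes> f = a \<otimes> f \<ominus> c \<otimes> f" using cc by algebra
  also have "\<dots> = \<zero>" using assms(5) cc by (simp add: minus_eq r_neg)
  finally have "(a \<ominus> c) \<otimes> e = \<zero>" using coef_zero[OF assms(1,2)] assms by simp
  then have "e \<otimes> c \<oplus> (a \<ominus> c) \<otimes> e = e \<otimes> c" using cc by simp
  moreover have "e \<otimes> c \<oplus> (a \<ominus> c) \<otimes> e = e \<otimes> a" using cc by algebra
  ultimately show ?thesis by simp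
qed

text \<open>The coordinates \<open>a\<close> and \<open>c\<close> of \<open>t\<close> are determined
  only up to elements killed by \<open>e\<close>, by \<open>coef_eq\<close>; the factor
  \<open>e\<close> makes the congruence independent of the choice, so asking for some pair of
  representatives suffices.\<close>

definition cong_subring :: "'b set \<Rightarrow> 'b set" where
  "cong_subring I = {t \<in> carrier B. \<forall>e\<in>E. \<forall>f\<in>Fe e. \<forall>g\<in>Fe e. \<exists>a\<in>A. \<exists>c\<in>A.
     t \<otimes> f = a \<otimes> f \<and> t \<otimes> g = c \<otimes> g \<and> e \<otimes> (a \<ominus> c) \<in> I}"

lemma cong_subring_subring:
  assumes I: "ideal I (B\<lparr>carrier := A\<rparr>)"
  shows "subring (cong_subring I) B" "A \<subseteq> cong_subring I"
proof -
  note i = A_ideal_facts[OF I]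
  show AT: "A \<subseteq> cong_subring I"
  proof
    fix a assume a: "a \<in> A"
    have "e \<otimes> (a \<ominus> a) \<in> I" if "e \<in> E" for e using a E_idem[OF that] i(2) by (simp add: minus_eq r_neg)
    then show "a \<in> cong_subring I" unfolding cong_subring_def using a by auto
  qed
  have mult: "s \<otimes> t \<in> cong_subring I" and add: "s \<oplus> t \<in> cong_subring I"
    if st: "s \<in> cong_subring I" "t \<in> cong_subring I" for s t
  proof -
    have stc: "s \<in> carrier B" "t \<in> carrier B" using st unfolding cong_subring_def by auto
    {
      fix e f g assume efg: "e \<in> E" "f \<in> Fe e" "g \<in> Fe e"
      obtain a c where ac: "a \<in> A" "c \<in> A" "s \<otimes> f = a \<otimes> f" "s \<otimes> g = c \<otimes> g" "e \<otimes> (a \<ominus> c) \<in> I"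
        using st(1) efg unfolding cong_subring_def by blast
      obtain a' c' where ac': "a' \<in> A" "c' \<in> A" "t \<otimes> f = a' \<otimes> f" "t \<otimes> g = c' \<otimes> g" "e \<otimes> (a' \<ominus> c') \<in> I"
        using st(2) efg unfolding cong_subring_def by blast
      have cc: "a \<in> carrier B" "c \<in> carrier B" "a' \<in> carrier B" "c' \<in> carrier B"
        "e \<in> carrier B" "f \<in> carrier B" "g \<in> carrier B"
        using ac ac' efg E_idem F_idem Fe_F(1) by auto
      have "(s \<otimes> t) \<otimes> f = s \<otimes> (t \<otimes> f)" using stc cc by (simp add: m_assoc)
      also have "\<dots> = a' \<otimes> (s \<otimes> f)" unfolding ac'(3) using stc cc by (simp add: m_ac)
      finally have 1: "(s \<otimes> t) \<otimes> f = (a \<otimes> a') \<otimes> f" unfolding ac(3) using cc by (simp add: m_ac)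
      have "(s \<otimes> t) \<otimes> g = s \<otimes> (t \<otimes> g)" using stc cc by (simp add: m_assoc)
      also have "\<dots> = c' \<otimes> (s \<otimes> g)" unfolding ac'(4) using stc cc by (simp add: m_ac)
      finally have 2: "(s \<otimes> t) \<otimes> g = (c \<otimes> c') \<otimes> g" unfolding ac(4) using cc by (simp add: m_ac)
      have "a \<otimes> (e \<otimes> (a' \<ominus> c')) \<oplus> c' \<otimes> (e \<otimes> (a \<ominus> c)) \<in> I" using i ac ac' by blast
      moreover have "a \<otimes> (e \<otimes> (a' \<ominus> c')) \<oplus> c' \<otimes> (e \<otimes> (a \<ominus> c)) = e \<otimes> (a \<otimes> a' \<ominus> c \<otimes> c')"
        using cc by algebra
      ultimately have "\<exists>a\<in>A. \<exists>c\<in>A. s \<otimes> t \<otimes> f = a \<otimes> f \<and> s \<otimes> t \<otimes> g = c \<otimes> g \<and> e \<otimes> (a \<ominus> c) \<in> I"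
        using 1 2 ac(1,2) ac'(1,2) by (intro bexI[of _ "a \<otimes> a'"] bexI[of _ "c \<otimes> c'"]) auto
      moreover {
        have 1: "(s \<oplus> t) \<otimes> f = (a \<oplus> a') \<otimes> f" using ac(3) ac'(3) stc cc by (simp add: l_distr)
        have 2: "(s \<oplus> t) \<otimes> g = (c \<oplus> c') \<otimes> g" using ac(4) ac'(4) stc cc by (simp add: l_distr)
        have "(e \<otimes> (a' \<ominus> c')) \<oplus> (e \<otimes> (a \<ominus> c)) \<in> I" using i ac ac' by blast
        moreover have "(e \<otimes> (a' \<ominus> c')) \<oplus> (e \<otimes> (a \<ominus> c)) = e \<otimes> ((a \<oplus> a') \<ominus> (c \<oplus> c'))"
          using cc by algebra
        ultimately have "\<exists>a\<in>A. \<exists>c\<in>A. (s \<oplus> t) \<otimes> f = a \<otimes> f \<and> (s \<oplus> t) \<otimes> g = c \<otimes> g \<and> e \<otimes> (a \<ominus> c) \<in> I"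
          using 1 2 ac(1,2) ac'(1,2) by (intro bexI[of _ "a \<oplus> a'"] bexI[of _ "c \<oplus> c'"]) auto
      }
      ultimately have "\<exists>a\<in>A. \<exists>c\<in>A. s \<otimes> t \<otimes> f = a \<otimes> f \<and> s \<otimes> t \<otimes> g = c \<otimes> g \<and> e \<otimes> (a \<ominus> c) \<in> I"
        "\<exists>a\<in>A. \<exists>c\<in>A. (s \<oplus> t) \<otimes> f = a \<otimes> f \<and> (s \<oplus> t) \<otimes> g = c \<otimes> g \<and> e \<otimes> (a \<ominus> c) \<in> I" by auto
    }
    then show "s \<otimes> t \<in> cong_subring I" "s \<oplus> t \<in> cong_subring I"
      unfolding cong_subring_def using stc by auto
  qed
  show "subring (cong_subring I) B"
  proof (rule subringI)
    show sub: "cong_subring I \<subseteq> carrier B" unfolding cong_subring_def by auto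
    show "\<one> \<in> cong_subring I" using AT by auto
    show "\<ominus> h \<in> cong_subring I" if h: "h \<in> cong_subring I" for h
    proof -
      have "\<ominus> \<one> \<in> cong_subring I" using AT by auto
      from mult[OF this h] show ?thesis using h sub by (auto simp: l_minus subset_iff)
    qed
  qed (use mult add in auto)
qed

text \<open>The element \<open>a f\<close> has coordinate \<open>a\<close> at \<open>f\<close> and
  zero at the other idempotents. As \<open>Fe_two\<close> provides a companion \<open>g\<close> of
  \<open>f\<close> below the same \<open>e\<close>, membership of \<open>a f\<close> compares
  \<open>a\<close> with zero and yields \<open>a e \<in> I\<close>; these elements sum up to
  \<open>a\<close>.\<close>

lemma cong_subring_determines:
  assumes I: "ideal I (B\<lparr>carrier := A\<rparr>)"
  shows "I = {a \<in> A. \<forall>f\<in>F. a \<otimes> f \<in> cong_subring I}"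
proof (intro equalityI subsetI)
  note i = A_ideal_facts[OF I]
  fix a assume a: "a \<in> I"
  have aA: "a \<in> A" using a i(1) by auto
  have "a \<otimes> f \<in> cong_subring I" if f: "f \<in> F" for f
  proof -
    {
      fix e g h assume e: "e \<in> E" "g \<in> Fe e" "h \<in> Fe e"
      note e' = E_idem[OF e(1)]
      have gF: "g \<in> F" "h \<in> F" using e Fe_F by auto
      define k where "k h = (if f = h then a else \<zero>)" for h
      have kA: "k h \<in> A" "k h \<in> I" for h unfolding k_def using aA a i by auto
      have k: "a \<otimes> f \<otimes> h = k h \<otimes> h" if "h \<in> F" for h
        unfolding k_def using F_orth[OF f that] F_idem[OF f] F_idem[OF that] aA by (auto simp: m_assoc)
      have "e \<otimes> (k g \<ominus> k h) \<in> I" using i(4)[OF e'(1) i(7)[OF kA(2) kA(2)]] .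
      then have "\<exists>x\<in>A. \<exists>c\<in>A. a \<otimes> f \<otimes> g = x \<otimes> g \<and> a \<otimes> f \<otimes> h = c \<otimes> h \<and> e \<otimes> (x \<ominus> c) \<in> I"
        using k[OF gF(1)] k[OF gF(2)] kA by blast
    }
    then show ?thesis unfolding cong_subring_def using F_idem[OF f] aA by auto
  qed
  then show "a \<in> {a \<in> A. \<forall>f\<in>F. a \<otimes> f \<in> cong_subring I}" using aA by auto
next
  note i = A_ideal_facts[OF I]
  fix a assume "a \<in> {a \<in> A. \<forall>f\<in>F. a \<otimes> f \<in> cong_subring I}"
  then have aA: "a \<in> A" and a: "\<And>f. f \<in> F \<Longrightarrow> a \<otimes> f \<in> cong_subring I" by auto
  have "a \<otimes> e \<in> I" if e: "e \<in> E" for e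
  proof -
    note e' = E_idem[OF e]
    obtain f g where fg: "f \<in> Fe e" "g \<in> Fe e" "f \<noteq> g" using Fe_two[OF e] by auto
    have F': "f \<in> F" "g \<in> F" using fg Fe_F by auto
    note f' = F_idem[OF F'(1)] and g' = F_idem[OF F'(2)]
    obtain x c where xc: "x \<in> A" "c \<in> A" "a \<otimes> f \<otimes> f = x \<otimes> f" "a \<otimes> f \<otimes> g = c \<otimes> g" "e \<otimes> (x \<ominus> c) \<in> I"
      using a[OF F'(1)] e fg unfolding cong_subring_def by blast
    have "e \<otimes> a = e \<otimes> x" using xc(3) aA f' coef_eq[OF e fg(1) aA xc(1)] by (simp add: m_assoc)
    moreover have ec: "e \<otimes> \<zero> = e \<otimes> c"
    proof (rule coef_eq[OF e fg(2) A_closed(1) xc(2)])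
      have "a \<otimes> f \<otimes> g = \<zero>" using aA f'(1) g'(1) F_orth[OF F'] fg(3) by (simp add: m_assoc)
      then show "\<zero> \<otimes> g = c \<otimes> g" using xc(4) g'(1) by simp
    qed
    moreover have "e \<otimes> (x \<ominus> c) = e \<otimes> x \<ominus> e \<otimes> c" using e'(1) xc(1,2)
      by (simp add: minus_eq r_distr r_minus)
    moreover have "e \<otimes> c = \<zero>" using ec e'(1) by simp
    ultimately have "e \<otimes> (x \<ominus> c) = a \<otimes> e" using e'(1) aA xc(1) m_comm[of a e] by (simp add: minus_eq)
    then show ?thesis using xc(5) by simp
  qed
  then have "(\<Oplus>e\<in>E. a \<otimes> e) \<in> I"
    using dE(1) i by (intro finsum_closed_set) auto
  then show "a \<in> I" using sum_E_mult[of a] aA by auto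
qed

lemma FIP_imp_FMIR:
  assumes "FIP B A" shows "FMIR (B\<lparr>carrier := A\<rparr>)"
  unfolding FMIR_def
proof (rule inj_on_finite)
  show "finite {T. subring T B \<and> A \<subseteq> T}" using assms unfolding FIP_def .
  show "cong_subring ` {I. ideal I (B\<lparr>carrier := A\<rparr>)} \<subseteq> {T. subring T B \<and> A \<subseteq> T}"
    using cong_subring_subring by auto
  show "inj_on cong_subring {I. ideal I (B\<lparr>carrier := A\<rparr>)}"
  proof (rule inj_onI)
    fix I J assume IJ: "I \<in> {I. ideal I (B\<lparr>carrier := A\<rparr>)}" "J \<in> {I. ideal I (B\<lparr>carrier := A\<rparr>)}"
      and eq: "cong_subring I = cong_subring J"
    have "I = {a \<in> A. \<forall>f\<in>F. a \<otimes> f \<in> cong_subring I}" using IJ by (intro cong_subring_determines) simp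
    also have "\<dots> = J" unfolding eq using IJ by (intro cong_subring_determines[symmetric]) simp
    finally show "I = J" .
  qed
qed

end


section \<open>Necessity of having only two idempotents below \<open>e\<close>\<close>

context art_ext
begin

text \<open>Let \<open>n\<close> be least such that products of \<open>n\<close> elements of
  \<open>M e\<close> vanish at \<open>e\<close>. Since \<open>M e\<close> is nonzero at
  \<open>e\<close>, \<open>n\<close> is at least two, and any product of \<open>n - 1\<close>
  factors that survives at \<open>e\<close> also lies in \<open>M e\<close> and serves as
  \<open>z\<close>.\<close>

lemma socle_exists:
  assumes e: "e \<in> E" and nz: "\<exists>y\<in>M e. e \<otimes> y \<noteq> \<zero>"
  shows "\<exists>z\<in>M e. e \<otimes> z \<noteq> \<zero> \<and> (\<forall>y\<in>M e. e \<otimes> (z \<otimes> y) = \<zero>)"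
proof -
  note e' = E_idem[OF e] and m = M_facts[OF e]
  have mc: "x \<in> M e \<Longrightarrow> x \<in> carrier B" for x using m(1) by auto
  have pc: "prods B (M e) i \<subseteq> carrier B" for i using mc by (induction i) auto
  define P where "P k \<longleftrightarrow> (\<forall>x\<in>prods B (M e) k. e \<otimes> x = \<zero>)" for k
  have ex: "\<exists>k. P k" using M_nilpotent[OF e] m_comm pc e' unfolding P_def by (metis AC subsetD)
  define n where "n = (LEAST k. P k)"
  have Pn: "P n" unfolding n_def using ex by (rule LeastI_ex)
  have min: "\<not> P k" if "k < n" for k using that unfolding n_def by (rule not_less_Least)
  have n0: "n \<noteq> 0" using Pn e' unfolding P_def by (auto intro: ccontr)
  have n1: "n \<noteq> 1"
  proof
    assume n: "n = 1"
    obtain y where y: "y \<in> M e" "e \<otimes> y \<noteq> \<zero>" using nz by auto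
    have "y \<otimes> \<one> \<in> prods B (M e) (Suc 0)" using y by (intro prodsI) auto
    then show False using Pn n y mc unfolding P_def by auto
  qed
  obtain j where j: "n = Suc (Suc j)" using n0 n1 by (metis One_nat_def not0_implies_Suc)
  obtain z where z: "z \<in> prods B (M e) (Suc j)" "e \<otimes> z \<noteq> \<zero>" using min[of "Suc j"] j unfolding P_def by auto
  have pA: "prods B (M e) i \<subseteq> A" for i using m(1) by (induction i) (auto simp: subset_iff)
  have zM: "z \<in> M e" using z(1) pA[of j] m(5) by auto
  have "e \<otimes> (z \<otimes> y) = \<zero>" if y: "y \<in> M e" for y
  proof -
    have "y \<otimes> z \<in> prods B (M e) n" unfolding j by (rule prodsI[OF y z(1)])
    then have "e \<otimes> (y \<otimes> z) = \<zero>" using Pn unfolding P_def by auto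
    then show ?thesis using m_comm[OF mc[OF y] mc[OF zM]] by simp
  qed
  then show ?thesis using zM z by auto
qed

text \<open>A finite set \<open>D\<close> represents all rings \<open>T \<alpha>\<close>. An
  \<open>\<alpha>\<close> outside the residue classes of \<open>D\<close> must share its ring with
  some \<open>\<beta> \<in> D\<close>, but equality of the rings forces
  \<open>\<alpha> \<ominus> \<beta> \<in> M e\<close>.\<close>

lemma FIP_card_two:
  assumes fip: "FIP B A" and e: "e \<in> E" and inf: "infinite ((\<lambda>a. e \<otimes> a) ` A)"
    and nz: "\<exists>y\<in>M e. e \<otimes> y \<noteq> \<zero>"
  shows "card (Fe e) = 2"
proof (rule ccontr)
  assume n2: "card (Fe e) \<noteq> 2"
  note fm = FIP_imp_FMIR[OF fip]
  note e' = E_idem[OF e] and m = M_facts[OF e]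
  obtain f g where fg: "f \<in> Fe e" "g \<in> Fe e" "f \<noteq> g" using Fe_two[OF e] by auto
  have "Fe e \<noteq> {f, g}" using n2 fg(3) by auto
  then obtain h where h: "h \<in> Fe e" "h \<noteq> f" "h \<noteq> g" using fg by auto
  have F': "f \<in> F" "g \<in> F" "h \<in> F" using fg h Fe_F by auto
  note o = F_orth[OF F'(1) F'(1)] F_orth[OF F'(1) F'(2)] F_orth[OF F'(1) F'(3)]
    F_orth[OF F'(2) F'(1)] F_orth[OF F'(2) F'(2)] F_orth[OF F'(2) F'(3)]
  have oo: "f \<otimes> f = f" "f \<otimes> g = \<zero>" "f \<otimes> h = \<zero>" "g \<otimes> f = \<zero>" "g \<otimes> g = g" "g \<otimes> h = \<zero>"
    using o fg(3) h by auto
  have fc: "f \<in> carrier B" "g \<in> carrier B" "h \<in> carrier B" "e \<in> carrier B" using F_idem(1) F' e' by auto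
  obtain z where z: "z \<in> M e" "e \<otimes> z \<noteq> \<zero>" and soc: "\<And>y. y \<in> M e \<Longrightarrow> e \<otimes> (z \<otimes> y) = \<zero>"
    using socle_exists[OF e nz] by auto
  have zA: "z \<in> A" using z m(1) by auto
  have zc: "z \<in> carrier B" using zA by simp
  define w where "w \<alpha> = z \<otimes> (f \<oplus> \<alpha> \<otimes> g)" for \<alpha>
  have wc: "w \<alpha> \<in> carrier B" if "\<alpha> \<in> A" for \<alpha> unfolding w_def using that zc fc by simp
  have we: "e \<otimes> w \<alpha> = w \<alpha>" if "\<alpha> \<in> A" for \<alpha>
  proof -
    have ac: "\<alpha> \<in> carrier B" using that by simp
    have "e \<otimes> w \<alpha> = z \<otimes> (e \<otimes> f \<oplus> \<alpha> \<otimes> (e \<otimes> g))" unfolding w_def using zc fc ac by algebra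
    then show ?thesis unfolding w_def using Fe_F(2) fg by simp
  qed
  \<comment> \<open>The square vanishes since \<open>z\<close> is itself in \<open>M e\<close>,
    which it annihilates at \<open>e\<close>; hence \<open>A + A w\<close> is closed under
    products.\<close>
  have ww: "w \<alpha> \<otimes> w \<alpha> = \<zero>" if "\<alpha> \<in> A" for \<alpha>
  proof -
    have ac: "\<alpha> \<in> carrier B" using that by simp
    have "w \<alpha> \<otimes> w \<alpha> = w \<alpha> \<otimes> (e \<otimes> w \<alpha>)" using we that by simp
    also have "\<dots> = (e \<otimes> (z \<otimes> z)) \<otimes> ((f \<oplus> \<alpha> \<otimes> g) \<otimes> (f \<oplus> \<alpha> \<otimes> g))"
      unfolding w_def using zc fc ac by algebra
    finally show ?thesis using soc[OF z(1)] fc ac by simp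
  qed
  define T where "T \<alpha> = {a \<oplus> c \<otimes> w \<alpha> | a c. a \<in> A \<and> c \<in> A}" for \<alpha>
  have TI: "a \<oplus> c \<otimes> w \<alpha> \<in> T \<alpha>" if "a \<in> A" "c \<in> A" for a c \<alpha> unfolding T_def using that by auto
  have AT: "A \<subseteq> T \<alpha>" if "\<alpha> \<in> A" for \<alpha>
  proof
    fix a assume "a \<in> A"
    then show "a \<in> T \<alpha>" using TI[of a \<zero> \<alpha>] wc[OF that] by simp
  qed
  have Tsub: "subring (T \<alpha>) B" if \<alpha>: "\<alpha> \<in> A" for \<alpha>
  proof (rule subringI)
    show "T \<alpha> \<subseteq> carrier B" unfolding T_def using wc[OF \<alpha>] by auto
    show "\<one> \<in> T \<alpha>" using AT[OF \<alpha>] by auto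
    fix x assume "x \<in> T \<alpha>"
    then obtain a c where x: "x = a \<oplus> c \<otimes> w \<alpha>" "a \<in> A" "c \<in> A" unfolding T_def by auto
    have cc: "a \<in> carrier B" "c \<in> carrier B" "w \<alpha> \<in> carrier B" using x wc[OF \<alpha>] by auto
    have "\<ominus> x = \<ominus> a \<oplus> (\<ominus> c) \<otimes> w \<alpha>" unfolding x using cc by algebra
    then show "\<ominus> x \<in> T \<alpha>" using TI x by simp
    fix y assume "y \<in> T \<alpha>"
    then obtain a' c' where y: "y = a' \<oplus> c' \<otimes> w \<alpha>" "a' \<in> A" "c' \<in> A" unfolding T_def by auto
    have cc': "a' \<in> carrier B" "c' \<in> carrier B" using y by auto
    have "x \<oplus> y = (a \<oplus> a') \<oplus> (c \<oplus> c') \<otimes> w \<alpha>" unfolding x y using cc cc' by algebra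
    then show "x \<oplus> y \<in> T \<alpha>" using TI x y by simp
    have "x \<otimes> y = a \<otimes> a' \<oplus> (a \<otimes> c' \<oplus> a' \<otimes> c) \<otimes> w \<alpha> \<oplus> c \<otimes> c' \<otimes> (w \<alpha> \<otimes> w \<alpha>)"
      unfolding x y using cc cc' by algebra
    then have "x \<otimes> y = a \<otimes> a' \<oplus> (a \<otimes> c' \<oplus> a' \<otimes> c) \<otimes> w \<alpha>" using ww[OF \<alpha>] cc cc' by simp
    then show "x \<otimes> y \<in> T \<alpha>" using TI x y by simp
  qed
  \<comment> \<open>The annihilator of \<open>z\<close> at \<open>e\<close> is no larger than
    \<open>M e\<close>: a unit cannot kill a \<open>z\<close> that is nonzero there.\<close>
  have zM: "y \<in> M e" if y: "y \<in> A" "e \<otimes> (z \<otimes> y) = \<zero>" for y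
  proof (rule ccontr)
    assume "y \<notin> M e"
    then obtain b where b: "b \<in> A" "y \<otimes> b \<otimes> e = e" using M_unit[OF e y(1)] by auto
    have bc: "b \<in> carrier B" "y \<in> carrier B" using b y by auto
    have "e \<otimes> z = (y \<otimes> b \<otimes> e) \<otimes> z" using b by simp
    also have "\<dots> = b \<otimes> (e \<otimes> (z \<otimes> y))" using bc fc zc by algebra
    finally show False using y z bc by simp
  qed
  have key: "\<alpha> \<ominus> \<beta> \<in> M e" if ab: "\<alpha> \<in> A" "\<beta> \<in> A" "T \<alpha> = T \<beta>" for \<alpha> \<beta>
  proof -
    have abc: "\<alpha> \<in> carrier B" "\<beta> \<in> carrier B" using ab by auto
    have "w \<alpha> \<in> T \<alpha>" using TI[of \<zero> \<one> \<alpha>] wc[OF ab(1)] by simp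
    then have "w \<alpha> \<in> T \<beta>" using ab by simp
    then obtain a c where ac: "w \<alpha> = a \<oplus> c \<otimes> w \<beta>" "a \<in> A" "c \<in> A" unfolding T_def by auto
    have acc: "a \<in> carrier B" "c \<in> carrier B" using ac by auto
    have wh: "w \<gamma> \<otimes> h = \<zero>" "w \<gamma> \<otimes> f = z \<otimes> f" "w \<gamma> \<otimes> g = z \<otimes> \<gamma> \<otimes> g" if "\<gamma> \<in> A" for \<gamma>
    proof -
      have gc: "\<gamma> \<in> carrier B" using that by simp
      have "w \<gamma> \<otimes> x = z \<otimes> (f \<otimes> x) \<oplus> z \<otimes> \<gamma> \<otimes> (g \<otimes> x)" if "x \<in> carrier B" for x
        unfolding w_def using zc fc gc that by algebra
      then show "w \<gamma> \<otimes> h = \<zero>" "w \<gamma> \<otimes> f = z \<otimes> f" "w \<gamma> \<otimes> g = z \<otimes> \<gamma> \<otimes> g"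
        using fc oo zc gc by (auto simp: m_assoc)
    qed
    have split: "w \<alpha> \<otimes> x = a \<otimes> x \<oplus> c \<otimes> (w \<beta> \<otimes> x)" if "x \<in> carrier B" for x
      unfolding ac(1) using acc wc[OF ab(2)] that by algebra
    \<comment> \<open>The coordinate at \<open>h\<close> eliminates \<open>a\<close>; the coordinate
      at \<open>f\<close> then says \<open>z = c z\<close> and the one at \<open>g\<close> says
      \<open>z \<alpha> = c z \<beta>\<close>, both at \<open>e\<close>.\<close>
    have "a \<otimes> h = \<zero>" using split[OF fc(3)] wh(1)[OF ab(1)] wh(1)[OF ab(2)] acc fc by simp
    then have ae: "a \<otimes> e = \<zero>" using coef_zero[OF e h(1) ac(2)] by simp
    have ax: "a \<otimes> x = \<zero>" if "x \<in> carrier B" "e \<otimes> x = x" for x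
    proof -
      have "a \<otimes> x = a \<otimes> e \<otimes> x" using that acc fc by (simp add: m_assoc)
      then show ?thesis using ae that by simp
    qed
    have "z \<otimes> f = c \<otimes> (z \<otimes> f)"
      using split[OF fc(1), unfolded wh(2)[OF ab(1)] wh(2)[OF ab(2)] ax[OF fc(1) Fe_F(2)[OF fg(1)]]] acc fc zc by simp
    then have "z \<otimes> f = (c \<otimes> z) \<otimes> f" using acc fc zc by (simp add: m_assoc)
    then have 1: "e \<otimes> z = e \<otimes> (c \<otimes> z)" using coef_eq[OF e fg(1) zA, of "c \<otimes> z"] ac(3) zA by simp
    have "z \<otimes> \<alpha> \<otimes> g = c \<otimes> (z \<otimes> \<beta> \<otimes> g)"
      using split[OF fc(2), unfolded wh(3)[OF ab(1)] wh(3)[OF ab(2)] ax[OF fc(2) Fe_F(2)[OF fg(2)]]] acc fc zc abc by simp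
    then have "(z \<otimes> \<alpha>) \<otimes> g = (c \<otimes> z \<otimes> \<beta>) \<otimes> g" using acc fc zc abc by (simp add: m_assoc)
    then have 2: "e \<otimes> (z \<otimes> \<alpha>) = e \<otimes> (c \<otimes> z \<otimes> \<beta>)" using coef_eq[OF e fg(2), of "z \<otimes> \<alpha>" "c \<otimes> z \<otimes> \<beta>"] ac(3) zA ab(1,2) by simp
    have "e \<otimes> (z \<otimes> (\<alpha> \<ominus> \<beta>)) = e \<otimes> (z \<otimes> \<alpha>) \<ominus> (e \<otimes> z) \<otimes> \<beta>" using fc zc abc by algebra
    also have "\<dots> = e \<otimes> (c \<otimes> z \<otimes> \<beta>) \<ominus> (e \<otimes> (c \<otimes> z)) \<otimes> \<beta>" using 1 2 by simp
    also have "\<dots> = \<zero>" using fc zc abc acc by algebra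
    finally show ?thesis using zM[of "\<alpha> \<ominus> \<beta>"] ab by simp
  qed
  have "T ` A \<subseteq> {T. subring T B \<and> A \<subseteq> T}" using Tsub AT by auto
  then have "finite (T ` A)" using fip unfolding FIP_def using finite_subset by blast
  then obtain D where D: "D \<subseteq> A" "finite D" "T ` A = T ` D"
    using finite_subset_image[OF _ subset_refl, of T A] by blast
  obtain \<alpha> where \<alpha>: "\<alpha> \<in> A" "\<forall>x\<in>D. \<alpha> \<ominus> x \<notin> M e" using residue_infinite[OF fm e inf D(2,1)] by auto
  then obtain \<beta> where \<beta>: "\<beta> \<in> D" "T \<alpha> = T \<beta>" using D(3) by blast
  then show False using key[of \<alpha> \<beta>] \<alpha> D by auto
qed

section \<open>Sufficiency: finitely many traces \<open>Te\<close> of intermediate rings\<close>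

lemma idempotents_finite: "finite {g \<in> carrier B. g \<otimes> g = g}"
proof (rule finite_subset)
  show "{g \<in> carrier B. g \<otimes> g = g} \<subseteq> (\<lambda>D. \<Oplus>f\<in>D. f) ` Pow F" using idem_sum_F by blast
  show "finite ((\<lambda>D. \<Oplus>f\<in>D. f) ` Pow F)" using dF(1) by simp
qed

text \<open>The trace of \<open>T\<close> at \<open>e\<close> is \<open>Te\<close>. Here already
  \<open>Be\<close> is finite, since its elements are given by their coordinates in the finite set
  \<open>eA\<close>, one for each idempotent in \<open>Fe e\<close>.\<close>

lemma trace_finite_if_finite:
  assumes e: "e \<in> E" and fin: "finite ((\<lambda>a. e \<otimes> a) ` A)"
  shows "finite ((\<lambda>T. (\<lambda>t. e \<otimes> t) ` T) ` {T. subring T B \<and> A \<subseteq> T})"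
proof -
  note e' = E_idem[OF e]
  let ?eA = "(\<lambda>a. e \<otimes> a) ` A"
  have "(\<lambda>t. e \<otimes> t) ` carrier B \<subseteq> (\<lambda>c. \<Oplus>f\<in>Fe e. c f \<otimes> f) ` (Fe e \<rightarrow>\<^sub>E ?eA)"
  proof
    fix x assume "x \<in> (\<lambda>t. e \<otimes> t) ` carrier B"
    then obtain b where b: "b \<in> carrier B" "x = e \<otimes> b" by auto
    have "\<exists>c. c \<in> ?eA \<and> b \<otimes> f = c \<otimes> f" if f: "f \<in> Fe e" for f
    proof -
      note f' = F_idem[OF Fe_F(1)[OF f]]
      obtain a where a: "a \<in> A" "b \<otimes> f = a \<otimes> f" using local_eq[OF Fe_F(1)[OF f] b(1)] by auto
      have "(e \<otimes> a) \<otimes> f = a \<otimes> (e \<otimes> f)" using a(1) e'(1) f'(1) by (simp add: m_ac)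
      then show ?thesis using a Fe_F(2)[OF f] by (intro exI[of _ "e \<otimes> a"]) auto
    qed
    then obtain c where c: "\<And>f. f \<in> Fe e \<Longrightarrow> c f \<in> ?eA \<and> b \<otimes> f = c f \<otimes> f" by metis
    have "x = b \<otimes> e" using b m_comm e' by auto
    also have "\<dots> = (\<Oplus>f\<in>Fe e. b \<otimes> f)" by (rule sum_Fe_mult[OF b(1) e])
    also have "\<dots> = (\<Oplus>f\<in>Fe e. restrict c (Fe e) f \<otimes> f)"
    proof (rule finsum_cong')
      show "(\<lambda>f. restrict c (Fe e) f \<otimes> f) \<in> Fe e \<rightarrow> carrier B"
      proof
        fix f assume f: "f \<in> Fe e"
        have "c f \<in> carrier B" using c[OF f] e' by auto
        then show "restrict c (Fe e) f \<otimes> f \<in> carrier B" using f F_idem[OF Fe_F(1)[OF f]] by simp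
      qed
    qed (use c in auto)
    finally have "x = (\<lambda>c. \<Oplus>f\<in>Fe e. c f \<otimes> f) (restrict c (Fe e))" .
    moreover have "restrict c (Fe e) \<in> Fe e \<rightarrow>\<^sub>E ?eA" using c by auto
    ultimately show "x \<in> (\<lambda>c. \<Oplus>f\<in>Fe e. c f \<otimes> f) ` (Fe e \<rightarrow>\<^sub>E ?eA)" by (rule image_eqI)
  qed
  moreover have "finite (Fe e \<rightarrow>\<^sub>E ?eA)" using fin Fe_F(3) by (intro finite_PiE) auto
  ultimately have "finite ((\<lambda>t. e \<otimes> t) ` carrier B)" using finite_subset by blast
  then have "finite (Pow ((\<lambda>t. e \<otimes> t) ` carrier B))" by simp
  moreover have "(\<lambda>T. (\<lambda>t. e \<otimes> t) ` T) ` {T. subring T B \<and> A \<subseteq> T} \<subseteq> Pow ((\<lambda>t. e \<otimes> t) ` carrier B)"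
    by (auto dest: subringE(1))
  ultimately show ?thesis by (rule finite_subset[rotated])
qed

text \<open>The intermediate ring \<open>T\<close> is itself Artinian; as \<open>Be\<close> is reduced, \<open>Te\<close> is spanned over \<open>A\<close> by the
  idempotents of \<open>T\<close>.\<close>
lemma trace_finite_if_field:
  assumes e: "e \<in> E" and z: "\<And>y. y \<in> M e \<Longrightarrow> e \<otimes> y = \<zero>"
  shows "finite ((\<lambda>T. (\<lambda>t. e \<otimes> t) ` T) ` {T. subring T B \<and> A \<subseteq> T})"
proof (rule finite_image_factor)
  note e' = E_idem[OF e]
  let ?k = "\<lambda>T. {g \<in> T. g \<otimes> g = g}"
  have "?k ` {T. subring T B \<and> A \<subseteq> T} \<subseteq> Pow {g \<in> carrier B. g \<otimes> g = g}" using subringE(1) by blast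
  then show "finite (?k ` {T. subring T B \<and> A \<subseteq> T})" using idempotents_finite finite_subset by blast
  have key: "\<exists>a\<in>A. t \<otimes> g = a \<otimes> g"
    if T: "subring T B" "A \<subseteq> T" and g: "prim_idem (B\<lparr>carrier := T\<rparr>) g" and ge: "e \<otimes> g = g" and t: "t \<in> T" for T g t
  proof -
    interpret T: cring "B\<lparr>carrier := T\<rparr>" by (rule subring_cring[OF T(1)])
    have TC: "x \<in> T \<Longrightarrow> x \<in> carrier B" for x using subringE(1)[OF T(1)] by auto
    have art: "artinian (B\<lparr>carrier := T\<rparr>)" by (rule dcc_artinian[OF dccB T])
    note g' = prim_idemD(1-3)[OF g, simplified]
    have gc: "g \<in> carrier B" using g' TC by auto
    obtain f where f: "f \<in> F" "g \<otimes> f = f"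
    proof -
      have "{f \<in> F. g \<otimes> f = f} \<noteq> {}"
      proof
        assume em: "{f \<in> F. g \<otimes> f = f} = {}"
        show False using idem_sum_F[OF gc g'(2), unfolded em] g'(3) by simp
      qed
      then show ?thesis using that by auto
    qed
    have fc: "f \<in> carrier B" "e \<in> carrier B" using F_idem[OF f(1)] e' by auto
    have tc: "t \<in> carrier B" using t TC by auto
    obtain a where a: "a \<in> A" "t \<otimes> f = a \<otimes> f" using local_eq[OF f(1) tc] by auto
    have ac: "a \<in> carrier B" using a by simp
    \<comment> \<open>Subtracting the coordinate of \<open>t\<close> at one \<open>f\<close> below
      \<open>g\<close> gives an element of \<open>T\<close> with a zero coordinate, so it is not a
      unit in the local ring \<open>Tg\<close> and is therefore nilpotent there.\<close>
    define u where "u = t \<ominus> a"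
    have uT: "u \<in> T" unfolding u_def minus_eq using t a T subringE(5,7)[OF T(1)] by blast
    have uc: "u \<in> carrier B" using uT TC by auto
    have "u \<otimes> f = t \<otimes> f \<ominus> a \<otimes> f" unfolding u_def using tc ac fc by algebra
    then have uf: "u \<otimes> f = \<zero>" using a fc ac by (simp add: minus_eq r_neg)
    have "\<not> (\<exists>y\<in>T. u \<otimes> y \<otimes> g = g)"
    proof
      assume "\<exists>y\<in>T. u \<otimes> y \<otimes> g = g"
      then obtain y where y: "y \<in> T" "u \<otimes> y \<otimes> g = g" by auto
      have "f = (u \<otimes> y \<otimes> g) \<otimes> f" using y f by simp
      also have "\<dots> = y \<otimes> g \<otimes> (u \<otimes> f)" using uc TC[OF y(1)] gc fc by (simp add: m_ac)
      finally show False using uf TC[OF y(1)] gc F_idem[OF f(1)] by simp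
    qed
    then have "u \<in> idem_rad (B\<lparr>carrier := T\<rparr>) g" using T.idem_rad_iff[OF art g, of u] uT by simp
    then obtain n :: nat where n: "u [^] n \<otimes> g = \<zero>"
      unfolding idem_rad_def by (auto simp: nat_pow_consistent[symmetric])
    \<comment> \<open>At each \<open>h\<close> below \<open>g\<close> the coordinate
      \<open>c\<close> of \<open>u\<close> is nilpotent, hence in \<open>M e\<close>, which vanishes
      at \<open>e\<close>; so \<open>u g\<close> is zero at every
      \<open>h \<in> Fe e\<close>.\<close>
    have zero: "u \<otimes> g \<otimes> h = \<zero>" if h: "h \<in> Fe e" for h
    proof -
      note h' = F_idem[OF Fe_F(1)[OF h]]
      have "g \<otimes> h = \<zero> \<or> g \<otimes> h = h" using idem_mult_F[OF gc g'(2) Fe_F(1)[OF h]] .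
      then show ?thesis
      proof
        assume "g \<otimes> h = \<zero>"
        then show ?thesis using uc gc h' by (simp add: m_assoc)
      next
        assume gh: "g \<otimes> h = h"
        obtain c where c: "c \<in> A" "u \<otimes> h = c \<otimes> h" using local_eq[OF Fe_F(1)[OF h] uc] by auto
        have cc: "c \<in> carrier B" using c by simp
        have "u [^] j \<otimes> h = c [^] j \<otimes> h" for j :: nat
        proof (induction j)
          case (Suc j)
          have "u [^] Suc j \<otimes> h = u [^] j \<otimes> (u \<otimes> h)" using uc h' by (simp add: m_assoc)
          also have "\<dots> = c \<otimes> (u [^] j \<otimes> h)" unfolding c(2) using uc h'(1) cc by (simp add: m_ac)
          also have "\<dots> = c [^] Suc j \<otimes> h" unfolding Suc using h'(1) cc by (simp add: m_ac)
          finally show ?case .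
        qed simp
        moreover have "u [^] n \<otimes> h = (u [^] n \<otimes> g) \<otimes> h" using gh uc gc h' by (simp add: m_assoc)
        ultimately have "c [^] n \<otimes> h = \<zero>" using n h' by simp
        then have "c [^] n \<otimes> e = \<zero>" using coef_zero[OF e h] c by simp
        then have "c \<in> M e" using c M_iff by auto
        then have ce: "e \<otimes> c = \<zero>" using z by simp
        have "u \<otimes> g \<otimes> h = u \<otimes> (g \<otimes> h)" using uc gc h' by (simp add: m_assoc)
        also have "\<dots> = c \<otimes> (e \<otimes> h)" using gh c(2) Fe_F(2)[OF h] by simp
        also have "\<dots> = (e \<otimes> c) \<otimes> h" using cc fc h'(1) by (simp add: m_ac)
        finally show ?thesis using ce h' by simp
      qed
    qed
    have "u \<otimes> g = u \<otimes> g \<otimes> e" using ge uc gc fc m_comm[of g e] by (simp add: m_assoc)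
    also have "\<dots> = (\<Oplus>h\<in>Fe e. u \<otimes> g \<otimes> h)" using uc gc by (intro sum_Fe_mult[OF _ e]) simp
    also have "\<dots> = (\<Oplus>h\<in>Fe e. \<zero>)" using zero by (intro finsum_cong') auto
    finally have ug: "u \<otimes> g = \<zero>" by simp
    have "t \<otimes> g = u \<otimes> g \<oplus> a \<otimes> g" unfolding u_def using tc ac gc by algebra
    then show ?thesis using ug a ac gc by auto
  qed
  have sub: "(\<lambda>t. e \<otimes> t) ` T \<subseteq> (\<lambda>t. e \<otimes> t) ` T'"
    if T: "subring T B" "A \<subseteq> T" and T': "subring T' B" "A \<subseteq> T'" and eq: "?k T = ?k T'" for T T'
  proof
    fix x assume "x \<in> (\<lambda>t. e \<otimes> t) ` T"
    then obtain t where t: "t \<in> T" "x = e \<otimes> t" by auto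
    interpret T: cring "B\<lparr>carrier := T\<rparr>" by (rule subring_cring[OF T(1)])
    have TC: "x \<in> T \<Longrightarrow> x \<in> carrier B" for x using subringE(1)[OF T(1)] by auto
    have art: "artinian (B\<lparr>carrier := T\<rparr>)" by (rule dcc_artinian[OF dccB T])
    have tc: "t \<in> carrier B" and ec: "e \<in> carrier B" and eT: "e \<in> T" using t TC e' T by auto
    obtain G where G: "orth_decomp (B\<lparr>carrier := T\<rparr>) G \<one>"
      using T.orth_decomp_exists[OF art, of \<one>] T.one_closed by auto
    note dG = orth_decompD[OF G, simplified]
    have GC: "G \<subseteq> carrier B" using dG(3) TC by auto
    have sum: "(\<Oplus>g\<in>G. g) = \<one>" using dG(5) finsum_subring[OF T(1) dG(1) dG(3)] by simp
    \<comment> \<open>Primitivity of \<open>g\<close> in \<open>T\<close> leaves only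
      \<open>e g = 0\<close> or \<open>e g = g\<close>. In the second case \<open>x g\<close> is an
      \<open>A\<close>-multiple of \<open>g\<close>, and \<open>g\<close> lies in \<open>T'\<close>
      because both rings have the same idempotents.\<close>
    have in': "x \<otimes> g \<in> T'" if g: "g \<in> G" for g
    proof -
      have gT: "g \<in> T" "g \<in> carrier B" using g dG(3) TC by auto
      note g' = prim_idemD[OF dG(2)[OF g], simplified]
      have "(e \<otimes> g) \<otimes> (e \<otimes> g) = (e \<otimes> e) \<otimes> (g \<otimes> g)" using ec gT(2) by (simp add: m_ac)
      then have 1: "(e \<otimes> g) \<otimes> (e \<otimes> g) = e \<otimes> g" using e'(2) g'(2) by simp
      have 2: "(e \<otimes> g) \<otimes> g = e \<otimes> g" using ec gT(2) g'(2) by (simp add: m_assoc)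
      have "e \<otimes> g \<in> T" using eT gT(1) subringE(6)[OF T(1)] by simp
      then have "e \<otimes> g = \<zero> \<or> e \<otimes> g = g" using g'(4)[of "e \<otimes> g"] 1 2 by blast
      moreover have xg: "x \<otimes> g = t \<otimes> (e \<otimes> g)" unfolding t(2) using tc ec gT(2) by (simp add: m_ac)
      ultimately show ?thesis
      proof (elim disjE)
        assume "e \<otimes> g = \<zero>"
        then show ?thesis using xg tc subringE(2)[OF T'(1)] by simp
      next
        assume eg: "e \<otimes> g = g"
        obtain a where a: "a \<in> A" "t \<otimes> g = a \<otimes> g" using key[OF T dG(2)[OF g] eg t(1)] by auto
        have "g \<in> T'" using eq gT(1) g'(2) by blast
        then have "a \<otimes> g \<in> T'" using a(1) T' subringE(6)[OF T'(1)] by blast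
        then show ?thesis using xg eg a by simp
      qed
    qed
    have xc: "x \<in> carrier B" using t tc ec by simp
    have "x = x \<otimes> (\<Oplus>g\<in>G. g)" using sum xc by simp
    also have "\<dots> = (\<Oplus>g\<in>G. x \<otimes> g)" using finsum_rdistr[OF dG(1) xc, of "\<lambda>x. x"] GC by auto
    also have "\<dots> \<in> T'" using in' subringE(1,2,7)[OF T'(1)] dG(1) by (intro finsum_closed_set) auto
    finally have xT: "x \<in> T'" .
    have "x = e \<otimes> x" unfolding t(2) using ec tc e'(2) m_assoc[symmetric] by simp
    then show "x \<in> (\<lambda>t. e \<otimes> t) ` T'" using xT by blast
  qed
  fix T T' assume "T \<in> {T. subring T B \<and> A \<subseteq> T}" "T' \<in> {T. subring T B \<and> A \<subseteq> T}" "?k T = ?k T'"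
  then show "(\<lambda>t. e \<otimes> t) ` T = (\<lambda>t. e \<otimes> t) ` T'" using sub[of T T'] sub[of T' T] by auto
qed

text \<open>With \<open>e = f \<oplus> g\<close>, an element with coordinates \<open>a\<close> and
  \<open>b\<close> equals \<open>b e \<oplus> (a \<ominus> b) f\<close> at \<open>e\<close>. As
  \<open>A \<subseteq> T\<close>, only the ideal of those \<open>a\<close> with
  \<open>a f \<in> T\<close> matters, and there are finitely many ideals.\<close>

lemma trace_finite_if_two:
  assumes fm: "FMIR (B\<lparr>carrier := A\<rparr>)" and e: "e \<in> E" and two: "card (Fe e) = 2"
  shows "finite ((\<lambda>T. (\<lambda>t. e \<otimes> t) ` T) ` {T. subring T B \<and> A \<subseteq> T})"
proof -
  note e' = E_idem[OF e]
  obtain f g where fg: "Fe e = {f, g}" "f \<noteq> g" using two card_2_iff by metis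
  have fe: "f \<in> Fe e" "g \<in> Fe e" using fg by auto
  have cc: "f \<in> carrier B" "g \<in> carrier B" "e \<in> carrier B" using fe F_idem(1) Fe_F(1) e' by auto
  have efg: "e = f \<oplus> g" using Fe_sum[OF e] fg cc by simp
  let ?k = "\<lambda>T. {a \<in> A. a \<otimes> f \<in> T}"
  have kI: "ideal (?k T) (B\<lparr>carrier := A\<rparr>)" if T: "subring T B" "A \<subseteq> T" for T
  proof (rule A_idealI)
    show "\<zero> \<in> ?k T" using cc subringE(2)[OF T(1)] by simp
    show "x \<oplus> y \<in> ?k T" if "x \<in> ?k T" "y \<in> ?k T" for x y
      using that cc subringE(7)[OF T(1)] by (simp add: l_distr)
    show "a \<otimes> x \<in> ?k T" if "a \<in> A" "x \<in> ?k T" for a x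
      using that cc subringE(6)[OF T(1), of a "x \<otimes> f"] T(2) by (auto simp: m_assoc)
  qed auto
  show ?thesis
  proof (rule finite_image_factor)
    show "finite (?k ` {T. subring T B \<and> A \<subseteq> T})"
      by (rule finite_subset[OF _ fm[unfolded FMIR_def]]) (use kI in auto)
    have sub: "(\<lambda>t. e \<otimes> t) ` T \<subseteq> (\<lambda>t. e \<otimes> t) ` T'"
      if T: "subring T B" "A \<subseteq> T" and T': "subring T' B" "A \<subseteq> T'" and eq: "?k T = ?k T'" for T T'
    proof
      fix x assume "x \<in> (\<lambda>t. e \<otimes> t) ` T"
      then obtain t where t: "t \<in> T" "x = e \<otimes> t" by auto
      have tc: "t \<in> carrier B" using t subringE(1)[OF T(1)] by auto
      obtain a where a: "a \<in> A" "t \<otimes> f = a \<otimes> f" using local_eq[OF Fe_F(1)[OF fe(1)] tc] by auto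
      obtain b where b: "b \<in> A" "t \<otimes> g = b \<otimes> g" using local_eq[OF Fe_F(1)[OF fe(2)] tc] by auto
      have ac: "a \<in> carrier B" "b \<in> carrier B" using a b by auto
      have "x = t \<otimes> f \<oplus> t \<otimes> g" unfolding t(2) efg using tc cc by algebra
      also have "\<dots> = b \<otimes> (f \<oplus> g) \<oplus> (a \<ominus> b) \<otimes> f" unfolding a(2) b(2) using ac cc by algebra
      finally have x: "x = b \<otimes> e \<oplus> (a \<ominus> b) \<otimes> f" unfolding efg .
      have "(a \<ominus> b) \<otimes> f = e \<otimes> t \<ominus> b \<otimes> e" using x t(2) cc ac tc by algebra
      moreover have "e \<otimes> t \<ominus> b \<otimes> e \<in> T"
      proof -
        have T3: "e \<in> T" "b \<in> T" using e'(1) b(1) T(2) by auto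
        show ?thesis unfolding minus_eq
          using subringE(7)[OF T(1) subringE(6)[OF T(1) T3(1) t(1)] subringE(5)[OF T(1) subringE(6)[OF T(1) T3(2,1)]]] .
      qed
      ultimately have "a \<ominus> b \<in> ?k T" using a b by simp
      then have "(a \<ominus> b) \<otimes> f \<in> T'" using eq by blast
      moreover have "b \<otimes> e \<in> T'" using e'(1) b(1) T'(2) A_closed(4) by blast
      ultimately have xT: "x \<in> T'" unfolding x using subringE(7)[OF T'(1)] by simp
      have "x = e \<otimes> x" unfolding t(2) using cc tc e'(2) m_assoc[symmetric] by simp
      then show "x \<in> (\<lambda>t. e \<otimes> t) ` T'" using xT by blast
    qed
    fix T T' assume "T \<in> {T. subring T B \<and> A \<subseteq> T}" "T' \<in> {T. subring T B \<and> A \<subseteq> T}" "?k T = ?k T'"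
    then show "(\<lambda>t. e \<otimes> t) ` T = (\<lambda>t. e \<otimes> t) ` T'" using sub[of T T'] sub[of T' T] by auto
  qed
qed

text \<open>Since the idempotents of \<open>E\<close> lie in \<open>A\<close> and sum to one, each
  \<open>T\<close> is recovered from its traces: \<open>Te\<close> lies in \<open>T\<close> and
  every \<open>t\<close> is the sum of the \<open>t e\<close>.\<close>

lemma FIP_if_traces_finite:
  assumes "\<And>e. e \<in> E \<Longrightarrow> finite ((\<lambda>T. (\<lambda>t. e \<otimes> t) ` T) ` {T. subring T B \<and> A \<subseteq> T})"
  shows "FIP B A"
  unfolding FIP_def
proof (rule inj_on_finite)
  let ?S = "{T. subring T B \<and> A \<subseteq> T}"
  let ?g = "\<lambda>T. \<lambda>e\<in>E. (\<lambda>t. e \<otimes> t) ` T"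
  show "finite (\<Pi>\<^sub>E e\<in>E. (\<lambda>T. (\<lambda>t. e \<otimes> t) ` T) ` ?S)" using assms dE(1) by (intro finite_PiE) auto
  show "?g ` ?S \<subseteq> (\<Pi>\<^sub>E e\<in>E. (\<lambda>T. (\<lambda>t. e \<otimes> t) ` T) ` ?S)" by auto
  show "inj_on ?g ?S"
  proof (rule inj_onI)
    have sub: "T \<subseteq> T'" if T: "T \<in> ?S" "T' \<in> ?S" "?g T = ?g T'" for T T'
    proof
      fix t assume t: "t \<in> T"
      have tc: "t \<in> carrier B" using t T subringE(1)[of T B] by auto
      have "t \<otimes> e \<in> T'" if e: "e \<in> E" for e
      proof -
        have "?g T e = ?g T' e" using T(3) by simp
        then have "e \<otimes> t \<in> (\<lambda>t. e \<otimes> t) ` T'" using e t by auto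
        then obtain t' where t': "t' \<in> T'" "e \<otimes> t = e \<otimes> t'" by auto
        have "e \<otimes> t' \<in> T'" using t' E_idem[OF e] T subringE(6)[of T' B] by auto
        then show ?thesis using t' m_comm tc E_idem[OF e] by simp
      qed
      then have "(\<Oplus>e\<in>E. t \<otimes> e) \<in> T'" using T dE(1) subringE(1,2,7)[of T' B] by (intro finsum_closed_set) auto
      then show "t \<in> T'" using sum_E_mult[OF tc] by simp
    qed
    fix T T' assume "T \<in> ?S" "T' \<in> ?S" "?g T = ?g T'"
    then show "T = T'" using sub[of T T'] sub[of T' T] by auto
  qed
qed

text \<open>The last two premises of \<open>two\<close> express, without leaving \<open>B\<close>,
  that the maximal ideal of \<open>Ae\<close> has a nonzero generator \<open>x e\<close>; this is
  the special principal case. With a zero generator \<open>Ae\<close> is a field.\<close>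

lemma FIP_if:
  assumes fm: "FMIR (B\<lparr>carrier := A\<rparr>)"
    and two: "\<And>e x. e \<in> E \<Longrightarrow> infinite ((\<lambda>a. e \<otimes> a) ` A) \<Longrightarrow> x \<in> M e \<Longrightarrow> e \<otimes> x \<noteq> \<zero> \<Longrightarrow>
        (\<And>y. y \<in> M e \<Longrightarrow> \<exists>z\<in>A. e \<otimes> y = e \<otimes> (x \<otimes> z)) \<Longrightarrow> card (Fe e) = 2"
  shows "FIP B A"
proof (rule FIP_if_traces_finite)
  fix e assume e: "e \<in> E"
  show "finite ((\<lambda>T. (\<lambda>t. e \<otimes> t) ` T) ` {T. subring T B \<and> A \<subseteq> T})"
  proof (cases "finite ((\<lambda>a. e \<otimes> a) ` A)")
    case True
    then show ?thesis by (rule trace_finite_if_finite[OF e])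
  next
    case False
    obtain x where x: "x \<in> M e" "\<And>y. y \<in> M e \<Longrightarrow> \<exists>z\<in>A. e \<otimes> y = e \<otimes> (x \<otimes> z)"
      using M_principal[OF fm e False] by auto
    note cc = E_idem(1)[OF e] M_facts(1)[OF e]
    show ?thesis
    proof (cases "e \<otimes> x = \<zero>")
      case True
      have "e \<otimes> y = \<zero>" if y: "y \<in> M e" for y
      proof -
        obtain w where w: "w \<in> A" "e \<otimes> y = e \<otimes> (x \<otimes> w)" using x(2)[OF y] by auto
        then have "e \<otimes> y = (e \<otimes> x) \<otimes> w" using cc x(1) by (auto simp: m_assoc subset_iff)
        then show ?thesis using True w by simp
      qed
      then show ?thesis by (rule trace_finite_if_field[OF e])
    next
      case nz: False
      show ?thesis using trace_finite_if_two[OF fm e two[OF e False x(1) nz x(2)]] by simp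
    qed
  qed
qed

end


section \<open>Consequences of vanishing differentials\<close>

context cring
begin

lemma finsum_extend:
  assumes "finite D'" "D \<subseteq> D'" "\<And>t. t \<in> D' - D \<Longrightarrow> g t = \<zero>" "g \<in> D' \<rightarrow> carrier R"
  shows "(\<Oplus>t\<in>D'. g t) = (\<Oplus>t\<in>D. g t)"
  using assms by (intro add.finprod_mono_neutral_cong_right) auto

lemma finsum_minus:
  assumes "finite D" "g \<in> D \<rightarrow> carrier R" "h \<in> D \<rightarrow> carrier R"
  shows "(\<Oplus>t\<in>D. g t \<ominus> h t) = (\<Oplus>t\<in>D. g t) \<ominus> (\<Oplus>t\<in>D. h t)"
proof -
  have h: "(\<lambda>t. \<ominus> \<one> \<otimes> h t) \<in> D \<rightarrow> carrier R" using assms(3) by auto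
  have hc: "(\<Oplus>t\<in>D. h t) \<in> carrier R" using assms(3) by simp
  have "(\<Oplus>t\<in>D. g t \<ominus> h t) = (\<Oplus>t\<in>D. g t \<oplus> \<ominus> \<one> \<otimes> h t)"
    using assms(2,3) by (intro finsum_cong') (auto simp: minus_eq l_minus Pi_def)
  also have "\<dots> = (\<Oplus>t\<in>D. g t) \<oplus> (\<Oplus>t\<in>D. \<ominus> \<one> \<otimes> h t)" using finsum_addf[OF assms(2) h] .
  also have "(\<Oplus>t\<in>D. \<ominus> \<one> \<otimes> h t) = \<ominus> \<one> \<otimes> (\<Oplus>t\<in>D. h t)"
    using finsum_rdistr[OF assms(1) _ assms(3), of "\<ominus> \<one>"] by simp
  finally show ?thesis using hc by (simp add: minus_eq l_minus)
qed

end

text \<open>Says that the \<open>S\<close>-linear map sending the symbol of \<open>t\<close> to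
  \<open>d t\<close> takes \<open>f\<close> into \<open>W\<close>. A finite set \<open>D\<close>
  containing the support is quantified existentially, because members of \<open>omega_rel\<close>
  are plain functions whose support is not recorded.\<close>

definition omega_good :: "'a ring \<Rightarrow> 'a set \<Rightarrow> ('a \<Rightarrow> 'a) \<Rightarrow> ('a \<Rightarrow> 'a) \<Rightarrow> bool" where
  "omega_good S W d f \<longleftrightarrow> (\<forall>t. f t \<in> carrier S) \<and> (\<exists>D. finite D \<and> D \<subseteq> carrier S \<and> (\<forall>t. t \<notin> D \<longrightarrow> f t = \<zero>\<^bsub>S\<^esub>) \<and>
     (\<Oplus>\<^bsub>S\<^esub>t\<in>D. f t \<otimes>\<^bsub>S\<^esub> d t) \<in> W)"

lemma omega_goodE:
  assumes "omega_good S W d f"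
  obtains D where "\<And>t. f t \<in> carrier S" "finite D" "D \<subseteq> carrier S" "\<And>t. t \<notin> D \<Longrightarrow> f t = \<zero>\<^bsub>S\<^esub>"
    "(\<Oplus>\<^bsub>S\<^esub>t\<in>D. f t \<otimes>\<^bsub>S\<^esub> d t) \<in> W"
  using assms unfolding omega_good_def by auto

lemma unitv_sum:
  fixes S (structure)
  assumes "cring S" "finite D" "a \<in> D" "\<And>t. t \<in> D \<Longrightarrow> d t \<in> carrier S"
  shows "(\<Oplus>t\<in>D. unitv S a t \<otimes> d t) = d a"
proof -
  interpret cring S by fact
  have "(\<Oplus>t\<in>D. unitv S a t \<otimes> d t) = (\<Oplus>t\<in>D. if t = a then d a else \<zero>)"
    using assms unfolding unitv_def by (intro finsum_cong') auto
  also have "\<dots> = d a" using add.finprod_singleton_swap[OF assms(3,2), of "\<lambda>_. d a"] assms by auto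
  finally show ?thesis .
qed

text \<open>The universal property of differentials, by induction on the generated relations: a map
  that is an \<open>R\<close>-derivation only modulo \<open>W\<close> still induces a linear map on
  the free module that sends all relations into \<open>W\<close>.\<close>

lemma omega_rel_derivation:
  fixes S (structure)
  assumes "cring S" and W: "ideal W S" and RS: "R \<subseteq> carrier S" and f: "f \<in> omega_rel S R"
    and d: "\<And>t. t \<in> carrier S \<Longrightarrow> d t \<in> carrier S"
    and add: "\<And>a b. a \<in> carrier S \<Longrightarrow> b \<in> carrier S \<Longrightarrow> d (a \<oplus> b) \<ominus> d a \<ominus> d b \<in> W"
    and mult: "\<And>a b. a \<in> carrier S \<Longrightarrow> b \<in> carrier S \<Longrightarrow> d (a \<otimes> b) \<ominus> a \<otimes> d b \<ominus> b \<otimes> d a \<in> W"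
    and const: "\<And>r. r \<in> R \<Longrightarrow> d r \<in> W"
  shows "omega_good S W d f"
proof -
  interpret cring S by fact
  note w = ideal_facts[OF W]
  have uc: "unitv S a t \<in> carrier S" for a t unfolding unitv_def by simp
  have uz: "t \<noteq> a \<Longrightarrow> unitv S a t = \<zero>" for a t unfolding unitv_def by simp
  have dP: "(\<lambda>t. g t \<otimes> d t) \<in> D \<rightarrow> carrier S" if "D \<subseteq> carrier S" "\<And>t. g t \<in> carrier S" for g D
    using that d by auto
  show ?thesis using f
  proof (induction f rule: omega_rel.induct)
    case zero
    show ?case unfolding omega_good_def using w(2) by (auto intro!: exI[of _ "{}"])
  next
    case (add f g)
    obtain D where D: "\<And>t. f t \<in> carrier S" "finite D" "D \<subseteq> carrier S" "\<And>t. t \<notin> D \<Longrightarrow> f t = \<zero>"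
      "(\<Oplus>t\<in>D. f t \<otimes> d t) \<in> W" by (rule omega_goodE[OF add.IH(1)]) blast
    obtain D' where D': "\<And>t. g t \<in> carrier S" "finite D'" "D' \<subseteq> carrier S" "\<And>t. t \<notin> D' \<Longrightarrow> g t = \<zero>"
      "(\<Oplus>t\<in>D'. g t \<otimes> d t) \<in> W" by (rule omega_goodE[OF add.IH(2)]) blast
    have u: "D \<union> D' \<subseteq> carrier S" using D D' by auto
    have "(\<Oplus>t\<in>D \<union> D'. (f t \<oplus> g t) \<otimes> d t) = (\<Oplus>t\<in>D \<union> D'. f t \<otimes> d t \<oplus> g t \<otimes> d t)"
      using dP[OF u D(1)] dP[OF u D'(1)] D(1) D'(1) u d by (intro finsum_cong') (auto simp: l_distr subset_iff)
    also have "\<dots> = (\<Oplus>t\<in>D \<union> D'. f t \<otimes> d t) \<oplus> (\<Oplus>t\<in>D \<union> D'. g t \<otimes> d t)"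
      by (rule finsum_addf[OF dP[OF u D(1)] dP[OF u D'(1)]])
    also have "(\<Oplus>t\<in>D \<union> D'. f t \<otimes> d t) = (\<Oplus>t\<in>D. f t \<otimes> d t)"
      using D(2,4) D'(2) dP[OF u D(1)] u d by (intro finsum_extend) (auto simp: subset_iff)
    also have "(\<Oplus>t\<in>D \<union> D'. g t \<otimes> d t) = (\<Oplus>t\<in>D'. g t \<otimes> d t)"
      using D(2) D'(2,4) dP[OF u D'(1)] u d by (intro finsum_extend) (auto simp: subset_iff)
    finally have "(\<Oplus>t\<in>D \<union> D'. (f t \<oplus> g t) \<otimes> d t) \<in> W" using w(3)[OF D(5) D'(5)] by simp
    moreover have "f t \<oplus> g t = \<zero>" if "t \<notin> D \<union> D'" for t using that D(4)[of t] D'(4)[of t] by simp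
    ultimately show ?case unfolding omega_good_def using D(1,2) D'(1,2) u
      by (intro conjI exI[of _ "D \<union> D'"]) auto
  next
    case (smult c f)
    obtain D where D: "\<And>t. f t \<in> carrier S" "finite D" "D \<subseteq> carrier S" "\<And>t. t \<notin> D \<Longrightarrow> f t = \<zero>"
      "(\<Oplus>t\<in>D. f t \<otimes> d t) \<in> W" by (rule omega_goodE[OF smult.IH]) blast
    have "(\<Oplus>t\<in>D. (c \<otimes> f t) \<otimes> d t) = (\<Oplus>t\<in>D. c \<otimes> (f t \<otimes> d t))"
      using D d smult(1) by (intro finsum_cong') (auto simp: m_assoc subset_iff)
    also have "\<dots> = c \<otimes> (\<Oplus>t\<in>D. f t \<otimes> d t)"
      using finsum_rdistr[OF D(2) smult(1) dP[OF D(3,1)]] by simp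
    finally have "(\<Oplus>t\<in>D. (c \<otimes> f t) \<otimes> d t) \<in> W" using w(4)[OF smult(1) D(5)] by simp
    then show ?case unfolding omega_good_def using D smult(1) by (auto intro!: exI[of _ D])
  next
    case (dadd a b)
    define D where "D = {a \<oplus> b, a, b}"
    have D: "D \<subseteq> carrier S" "finite D" and mem: "a \<oplus> b \<in> D" "a \<in> D" "b \<in> D" using dadd unfolding D_def by auto
    have dc: "t \<in> D \<Longrightarrow> d t \<in> carrier S" for t using D d by auto
    have p: "(\<lambda>t. unitv S x t \<otimes> d t) \<in> D \<rightarrow> carrier S" for x by (rule dP[OF D(1) uc])
    have p2: "(\<lambda>t. unitv S (a \<oplus> b) t \<otimes> d t \<ominus> unitv S a t \<otimes> d t) \<in> D \<rightarrow> carrier S" using dc uc by auto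
    have "(\<Oplus>t\<in>D. (unitv S (a \<oplus> b) t \<ominus> unitv S a t \<ominus> unitv S b t) \<otimes> d t) =
        (\<Oplus>t\<in>D. (unitv S (a \<oplus> b) t \<otimes> d t \<ominus> unitv S a t \<otimes> d t) \<ominus> unitv S b t \<otimes> d t)"
    proof (rule finsum_cong')
      fix t assume "t \<in> D"
      then have c: "d t \<in> carrier S" by (rule dc)
      show "(unitv S (a \<oplus> b) t \<ominus> unitv S a t \<ominus> unitv S b t) \<otimes> d t =
          (unitv S (a \<oplus> b) t \<otimes> d t \<ominus> unitv S a t \<otimes> d t) \<ominus> unitv S b t \<otimes> d t"
        using c uc[of "a \<oplus> b" t] uc[of a t] uc[of b t] by algebra
    qed (use dc uc in auto)
    also have "\<dots> = (\<Oplus>t\<in>D. unitv S (a \<oplus> b) t \<otimes> d t) \<ominus> (\<Oplus>t\<in>D. unitv S a t \<otimes> d t) \<ominus> (\<Oplus>t\<in>D. unitv S b t \<otimes> d t)"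
      unfolding finsum_minus[OF D(2) p2 p] finsum_minus[OF D(2) p p] ..
    also have "\<dots> = d (a \<oplus> b) \<ominus> d a \<ominus> d b"
      by (simp add: unitv_sum[OF \<open>cring S\<close> D(2) _ dc] mem)
    finally have "(\<Oplus>t\<in>D. (unitv S (a \<oplus> b) t \<ominus> unitv S a t \<ominus> unitv S b t) \<otimes> d t) \<in> W"
      using assms(6)[OF dadd] by simp
    moreover have "unitv S (a \<oplus> b) t \<ominus> unitv S a t \<ominus> unitv S b t = \<zero>" if "t \<notin> D" for t
      using uz[of t] that unfolding D_def by (simp add: minus_eq)
    ultimately show ?case unfolding omega_good_def using D uc by (intro conjI exI[of _ D]) auto
  next
    case (dmult a b)
    define D where "D = {a \<otimes> b, a, b}"
    have D: "D \<subseteq> carrier S" "finite D" and mem: "a \<otimes> b \<in> D" "a \<in> D" "b \<in> D" using dmult unfolding D_def by auto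
    have dc: "t \<in> D \<Longrightarrow> d t \<in> carrier S" for t using D d by auto
    have p: "(\<lambda>t. unitv S x t \<otimes> d t) \<in> D \<rightarrow> carrier S" for x by (rule dP[OF D(1) uc])
    have pm: "(\<lambda>t. c \<otimes> (unitv S x t \<otimes> d t)) \<in> D \<rightarrow> carrier S" if "c \<in> carrier S" for c x
      using dc uc that by auto
    have p2: "(\<lambda>t. unitv S (a \<otimes> b) t \<otimes> d t \<ominus> a \<otimes> (unitv S b t \<otimes> d t)) \<in> D \<rightarrow> carrier S" using dc uc dmult by auto
    have "(\<Oplus>t\<in>D. (unitv S (a \<otimes> b) t \<ominus> a \<otimes> unitv S b t \<ominus> b \<otimes> unitv S a t) \<otimes> d t) =
        (\<Oplus>t\<in>D. (unitv S (a \<otimes> b) t \<otimes> d t \<ominus> a \<otimes> (unitv S b t \<otimes> d t)) \<ominus> b \<otimes> (unitv S a t \<otimes> d t))"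
    proof (rule finsum_cong')
      fix t assume "t \<in> D"
      then have c: "d t \<in> carrier S" by (rule dc)
      show "(unitv S (a \<otimes> b) t \<ominus> a \<otimes> unitv S b t \<ominus> b \<otimes> unitv S a t) \<otimes> d t =
          (unitv S (a \<otimes> b) t \<otimes> d t \<ominus> a \<otimes> (unitv S b t \<otimes> d t)) \<ominus> b \<otimes> (unitv S a t \<otimes> d t)"
        using c uc[of "a \<otimes> b" t] uc[of a t] uc[of b t] dmult by algebra
    qed (use dc uc dmult in auto)
    also have "\<dots> = (\<Oplus>t\<in>D. unitv S (a \<otimes> b) t \<otimes> d t) \<ominus> (\<Oplus>t\<in>D. a \<otimes> (unitv S b t \<otimes> d t)) \<ominus> (\<Oplus>t\<in>D. b \<otimes> (unitv S a t \<otimes> d t))"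
      unfolding finsum_minus[OF D(2) p2 pm[OF dmult(2)]] finsum_minus[OF D(2) p pm[OF dmult(1)]] ..
    also have "\<dots> = d (a \<otimes> b) \<ominus> a \<otimes> d b \<ominus> b \<otimes> d a"
      unfolding finsum_rdistr[OF D(2) dmult(1) p, symmetric] finsum_rdistr[OF D(2) dmult(2) p, symmetric]
      by (simp add: unitv_sum[OF \<open>cring S\<close> D(2) _ dc] mem)
    finally have "(\<Oplus>t\<in>D. (unitv S (a \<otimes> b) t \<ominus> a \<otimes> unitv S b t \<ominus> b \<otimes> unitv S a t) \<otimes> d t) \<in> W"
      using mult[OF dmult] by simp
    moreover have "unitv S (a \<otimes> b) t \<ominus> a \<otimes> unitv S b t \<ominus> b \<otimes> unitv S a t = \<zero>" if "t \<notin> D" for t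
      using uz[of t] that dmult unfolding D_def by (simp add: minus_eq)
    ultimately show ?case unfolding omega_good_def using D uc dmult by (intro conjI exI[of _ D]) auto
  next
    case (dconst r)
    have r: "r \<in> carrier S" using dconst RS by auto
    have "(\<Oplus>t\<in>{r}. unitv S r t \<otimes> d t) = d r"
      using unitv_sum[OF \<open>cring S\<close>, of "{r}" r d] d r by auto
    then show ?case unfolding omega_good_def using const[OF dconst] uc uz r by (intro conjI exI[of _ "{r}"]) auto
  qed
qed

text \<open>If \<open>r s\<close> is an element of \<open>R\<close> congruent to \<open>s\<close> modulo \<open>Q\<close>, then \<open>s \<mapsto> s - r s\<close> is an \<open>R\<close>-derivation
  of \<open>S\<close> into \<open>Q/W\<close>, so it is zero.\<close>
lemma unramified_prime:
  fixes S (structure)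
  assumes "cring S" "subring R S" "kaehler_zero S R" and Q: "primeideal Q S"
    and res: "\<And>s. s \<in> carrier S \<Longrightarrow> \<exists>r\<in>R. s \<ominus> r \<in> Q"
    and W: "ideal W S" "Q \<inter> R \<subseteq> W" and QQ: "\<And>x y. x \<in> Q \<Longrightarrow> y \<in> Q \<Longrightarrow> x \<otimes> y \<in> W"
  shows "Q \<subseteq> W"
proof
  interpret cring S by fact
  note w = ideal_facts[OF W(1)] and q = ideal_facts[OF primeideal.axioms(1)[OF Q]]
  note sR = subringE[OF assms(2)]
  obtain r where r: "\<And>s. s \<in> carrier S \<Longrightarrow> r s \<in> R \<and> s \<ominus> r s \<in> Q" using res by metis
  have rR: "r s \<in> R" "r s \<in> carrier S" "s \<ominus> r s \<in> Q" if "s \<in> carrier S" for s using r[OF that] sR(1) by auto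
  define d where "d s = s \<ominus> r s" for s
  have good: "omega_good S W d f" if "f \<in> omega_rel S R" for f
  proof (rule omega_rel_derivation[OF assms(1) W(1) sR(1) that])
    show "\<And>t. t \<in> carrier S \<Longrightarrow> d t \<in> carrier S" unfolding d_def using rR by auto
    fix a b assume ab: "a \<in> carrier S" "b \<in> carrier S"
    have c: "r a \<in> carrier S" "r b \<in> carrier S" "r (a \<oplus> b) \<in> carrier S" "r (a \<otimes> b) \<in> carrier S" using rR ab by auto
    have "d (a \<oplus> b) \<ominus> d a \<ominus> d b = r a \<oplus> r b \<ominus> r (a \<oplus> b)" unfolding d_def using ab c by algebra
    moreover have "r a \<oplus> r b \<ominus> r (a \<oplus> b) \<in> R" using rR ab sR by (simp add: minus_eq)
    moreover have "d (a \<oplus> b) \<ominus> d a \<ominus> d b \<in> Q" unfolding d_def using rR ab q by simp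
    ultimately show "d (a \<oplus> b) \<ominus> d a \<ominus> d b \<in> W" using W(2) by auto
    \<comment> \<open>The Leibniz defect equals \<open>(r a r b - r (a b)) - d a d b\<close>. The
      first part lies in \<open>Q \<inter> R\<close> since both terms represent \<open>a b\<close>
      modulo \<open>Q\<close>; the second is a product of two elements of \<open>Q\<close>.\<close>
    have "d a \<otimes> d b \<in> W" unfolding d_def using QQ rR ab by simp
    moreover have "r a \<otimes> r b \<ominus> r (a \<otimes> b) \<in> W"
    proof -
      have "r a \<otimes> r b \<ominus> r (a \<otimes> b) \<in> R" using rR ab sR by (simp add: minus_eq)
      moreover have "(a \<otimes> b \<ominus> r (a \<otimes> b)) \<ominus> (a \<otimes> (b \<ominus> r b) \<oplus> r b \<otimes> (a \<ominus> r a)) \<in> Q" using rR ab q c by simp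
      moreover have "(a \<otimes> b \<ominus> r (a \<otimes> b)) \<ominus> (a \<otimes> (b \<ominus> r b) \<oplus> r b \<otimes> (a \<ominus> r a)) = r a \<otimes> r b \<ominus> r (a \<otimes> b)"
        using ab c by algebra
      ultimately show ?thesis using W(2) by auto
    qed
    ultimately have "(r a \<otimes> r b \<ominus> r (a \<otimes> b)) \<ominus> d a \<otimes> d b \<in> W" using w by simp
    moreover have "(r a \<otimes> r b \<ominus> r (a \<otimes> b)) \<ominus> d a \<otimes> d b = d (a \<otimes> b) \<ominus> a \<otimes> d b \<ominus> b \<otimes> d a"
      unfolding d_def using ab c by algebra
    ultimately show "d (a \<otimes> b) \<ominus> a \<otimes> d b \<ominus> b \<otimes> d a \<in> W" by simp
  next
    fix x assume x: "x \<in> R"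
    then have xc: "x \<in> carrier S" using sR by auto
    have "d x \<in> R" unfolding d_def minus_eq using x rR[OF xc] sR by simp
    then show "d x \<in> W" using W(2) rR(3)[OF xc] unfolding d_def by auto
  qed
  fix s assume s: "s \<in> Q"
  have sc: "s \<in> carrier S" using s q(1) by auto
  have dc: "d t \<in> carrier S" if "t \<in> carrier S" for t unfolding d_def using rR that by auto
  have "unitv S s \<in> omega_rel S R" using assms(3) sc unfolding kaehler_zero_def by auto
  from good[OF this] obtain D where D: "finite D" "D \<subseteq> carrier S" "\<And>t. t \<notin> D \<Longrightarrow> unitv S s t = \<zero>"
    "(\<Oplus>t\<in>D. unitv S s t \<otimes> d t) \<in> W" unfolding omega_good_def by auto
  \<comment> \<open>The linear map takes the symbol of \<open>s\<close> to \<open>d s\<close>, and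
    that symbol is a relation by hypothesis; an \<open>s\<close> outside the finite set
    \<open>D\<close> is possible only in the trivial ring.\<close>
  have "d s \<in> W"
  proof (cases "s \<in> D")
    case True
    then show ?thesis using unitv_sum[OF assms(1) D(1) True, of d] dc D(2,4) by (simp add: subset_iff)
  next
    case False
    then have "\<one> = \<zero>" using D(3)[of s] unfolding unitv_def by simp
    then have "d s = \<zero>" using dc[OF sc] one_zeroD by blast
    then show ?thesis using w by simp
  qed
  moreover have "r s \<in> W"
  proof -
    have "s \<ominus> (s \<ominus> r s) \<in> Q" using s rR[OF sc] q by simp
    moreover have "s \<ominus> (s \<ominus> r s) = r s" using sc rR[OF sc] by algebra
    ultimately show ?thesis using rR[OF sc] W(2) by auto
  qed
  ultimately have "d s \<oplus> r s \<in> W" using w by simp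
  moreover have "d s \<oplus> r s = s" unfolding d_def using sc rR(2)[OF sc] by algebra
  ultimately show "s \<in> W" by simp
qed


section \<open>Consequences of flatness\<close>

text \<open>The additive extension of \<open>\<phi>\<close> to formal integer combinations,
  evaluated over a finite \<open>D\<close>; enlarging a set that contains the support does not
  change the value.\<close>

definition tens_lin :: "'a ring \<Rightarrow> ('p \<Rightarrow> 'a) \<Rightarrow> 'p set \<Rightarrow> ('p \<Rightarrow> int) \<Rightarrow> 'a" where
  "tens_lin S \<phi> D f = (\<Oplus>\<^bsub>S\<^esub>p\<in>D. [f p] \<cdot>\<^bsub>S\<^esub> \<phi> p)"

lemma tens_lin_facts:
  fixes S (structure)
  assumes "cring S" and \<phi>U: "\<phi> \<in> U \<rightarrow> carrier S" and fin: "finite D" and DU: "D \<subseteq> U"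
  shows "tens_lin S \<phi> D f \<in> carrier S"
    "tens_lin S \<phi> D (\<lambda>p. f p + g p) = tens_lin S \<phi> D f \<oplus> tens_lin S \<phi> D g"
    "tens_lin S \<phi> D (\<lambda>p. f p - g p) = tens_lin S \<phi> D f \<ominus> tens_lin S \<phi> D g"
    "tens_lin S \<phi> D (\<lambda>p. - f p) = \<ominus> tens_lin S \<phi> D f"
    "a \<in> D \<Longrightarrow> tens_lin S \<phi> D (indic a) = \<phi> a"
    "D' \<subseteq> D \<Longrightarrow> (\<And>p. p \<notin> D' \<Longrightarrow> f p = 0) \<Longrightarrow> tens_lin S \<phi> D f = tens_lin S \<phi> D' f"
proof -
  interpret cring S by fact
  have \<phi>: "p \<in> D \<Longrightarrow> \<phi> p \<in> carrier S" for p using \<phi>U DU by auto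
  have z0: "[(0::int)] \<cdot> x = \<zero>" for x by (simp add: add_pow_def int_pow_def nat_pow_def)
  have P: "(\<lambda>p. [h p] \<cdot> \<phi> p) \<in> D \<rightarrow> carrier S" for h :: "'b \<Rightarrow> int" using \<phi> by auto
  show c: "tens_lin S \<phi> D f \<in> carrier S" for f unfolding tens_lin_def using P by simp
  show "tens_lin S \<phi> D (\<lambda>p. f p + g p) = tens_lin S \<phi> D f \<oplus> tens_lin S \<phi> D g"
    unfolding tens_lin_def finsum_addf[OF P P, symmetric]
    using \<phi> by (intro finsum_cong') (auto simp: add.int_pow_mult)
  show d: "tens_lin S \<phi> D (\<lambda>p. f p - g p) = tens_lin S \<phi> D f \<ominus> tens_lin S \<phi> D g" for f g
    unfolding tens_lin_def finsum_minus[OF fin P P, symmetric]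
    using \<phi> by (intro finsum_cong') (auto simp: add.int_pow_diff minus_eq)
  have z: "tens_lin S \<phi> D (\<lambda>p. 0) = \<zero>"
    unfolding tens_lin_def by (simp add: z0)
  show "tens_lin S \<phi> D (\<lambda>p. - f p) = \<ominus> tens_lin S \<phi> D f"
    using d[of "\<lambda>p. 0" f] c[of f] unfolding z by (simp add: minus_eq)
  show "tens_lin S \<phi> D (indic a) = \<phi> a" if a: "a \<in> D"
  proof -
    have "tens_lin S \<phi> D (indic a) = (\<Oplus>p\<in>D. if p = a then \<phi> a else \<zero>)"
      unfolding tens_lin_def using \<phi> a
      by (intro finsum_cong') (auto simp: indic_def add.int_pow_1 z0)
    also have "\<dots> = \<phi> a" using add.finprod_singleton_swap[OF a fin, of "\<lambda>_. \<phi> a"] \<phi> a by auto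
    finally show ?thesis .
  qed
  show "tens_lin S \<phi> D f = tens_lin S \<phi> D' f" if "D' \<subseteq> D" "\<And>p. p \<notin> D' \<Longrightarrow> f p = 0"
    unfolding tens_lin_def using that fin P by (intro finsum_extend) (auto simp: z0)
qed

definition tens_good :: "'a ring \<Rightarrow> ('p \<Rightarrow> 'a) \<Rightarrow> ('p \<Rightarrow> 'a) \<Rightarrow> 'p set \<Rightarrow> ('a \<times> 'a) set \<Rightarrow> ('p \<Rightarrow> int) \<Rightarrow> bool" where
  "tens_good S \<phi> \<psi> U N f \<longleftrightarrow> (\<exists>D. finite D \<and> D \<subseteq> U \<and> (\<forall>p. p \<notin> D \<longrightarrow> f p = 0) \<and>
     (tens_lin S \<phi> D f, tens_lin S \<psi> D f) \<in> N)"

lemma tens_goodI: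
  "finite D \<Longrightarrow> D \<subseteq> U \<Longrightarrow> (\<And>p. p \<notin> D \<Longrightarrow> f p = 0) \<Longrightarrow>
     (tens_lin S \<phi> D f, tens_lin S \<psi> D f) \<in> N \<Longrightarrow> tens_good S \<phi> \<psi> U N f"
  unfolding tens_good_def by blast

lemma tens_goodE:
  assumes "tens_good S \<phi> \<psi> U N f"
  obtains D where "finite D" "D \<subseteq> U" "\<And>p. p \<notin> D \<Longrightarrow> f p = 0" "(tens_lin S \<phi> D f, tens_lin S \<psi> D f) \<in> N"
  using assms unfolding tens_good_def by blast

text \<open>The universal property of the tensor product for two maps at once: if the pair
  \<open>(\<phi>, \<psi>)\<close> is biadditive and balanced only modulo the subgroup
  \<open>N\<close>, then formal combinations that are zero in the tensor product are sent into
  \<open>N\<close>.\<close>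

lemma tens_rel_good:
  fixes S (structure)
  assumes "cring S" and I: "\<And>x y. x \<in> I \<Longrightarrow> y \<in> I \<Longrightarrow> x \<oplus> y \<in> I" "\<And>r x. r \<in> R \<Longrightarrow> x \<in> I \<Longrightarrow> r \<otimes> x \<in> I"
    and RS: "R \<subseteq> carrier S"
    and \<phi>: "\<And>p. p \<in> I \<times> carrier S \<Longrightarrow> \<phi> p \<in> carrier S" and \<psi>: "\<And>p. p \<in> I \<times> carrier S \<Longrightarrow> \<psi> p \<in> carrier S"
    and N0: "(\<zero>, \<zero>) \<in> N" and Nadd: "\<And>x y x' y'. (x, y) \<in> N \<Longrightarrow> (x', y') \<in> N \<Longrightarrow> (x \<oplus> x', y \<oplus> y') \<in> N"
    and Nneg: "\<And>x y. (x, y) \<in> N \<Longrightarrow> (\<ominus> x, \<ominus> y) \<in> N"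
    and lin1: "\<And>x y s. x \<in> I \<Longrightarrow> y \<in> I \<Longrightarrow> s \<in> carrier S \<Longrightarrow>
      (\<phi> (x \<oplus> y, s) \<ominus> \<phi> (x, s) \<ominus> \<phi> (y, s), \<psi> (x \<oplus> y, s) \<ominus> \<psi> (x, s) \<ominus> \<psi> (y, s)) \<in> N"
    and lin2: "\<And>x s t. x \<in> I \<Longrightarrow> s \<in> carrier S \<Longrightarrow> t \<in> carrier S \<Longrightarrow>
      (\<phi> (x, s \<oplus> t) \<ominus> \<phi> (x, s) \<ominus> \<phi> (x, t), \<psi> (x, s \<oplus> t) \<ominus> \<psi> (x, s) \<ominus> \<psi> (x, t)) \<in> N"
    and bal: "\<And>r x s. r \<in> R \<Longrightarrow> x \<in> I \<Longrightarrow> s \<in> carrier S \<Longrightarrow>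
      (\<phi> (r \<otimes> x, s) \<ominus> \<phi> (x, r \<otimes> s), \<psi> (r \<otimes> x, s) \<ominus> \<psi> (x, r \<otimes> s)) \<in> N"
    and f: "f \<in> tens_rel S R I"
  shows "tens_good S \<phi> \<psi> (I \<times> carrier S) N f"
  using f
proof (induction f rule: tens_rel.induct)
  interpret cring S by fact
  let ?U = "I \<times> carrier S"
  have P: "\<phi> \<in> ?U \<rightarrow> carrier S" "\<psi> \<in> ?U \<rightarrow> carrier S" using \<phi> \<psi> by (auto simp del: mem_Sigma_iff)
  note L\<phi> = tens_lin_facts[OF assms(1) P(1)] and L\<psi> = tens_lin_facts[OF assms(1) P(2)]
  {
    case zero
    show ?case by (rule tens_goodI[of "{}"]) (auto simp: tens_lin_def N0)
  next
    case (add f g)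
    obtain D where D: "finite D" "D \<subseteq> ?U" "\<And>p. p \<notin> D \<Longrightarrow> f p = 0" "(tens_lin S \<phi> D f, tens_lin S \<psi> D f) \<in> N"
      using add.IH(1) by (rule tens_goodE) blast
    obtain D' where D': "finite D'" "D' \<subseteq> ?U" "\<And>p. p \<notin> D' \<Longrightarrow> g p = 0" "(tens_lin S \<phi> D' g, tens_lin S \<psi> D' g) \<in> N"
      using add.IH(2) by (rule tens_goodE) blast
    define E where "E = D \<union> D'"
    have E: "finite E" "E \<subseteq> ?U" "D \<subseteq> E" "D' \<subseteq> E" unfolding E_def using D(1,2) D'(1,2) by auto
    have fz: "tens_lin S \<phi> E f = tens_lin S \<phi> D f" "tens_lin S \<psi> E f = tens_lin S \<psi> D f"
      using L\<phi>(6)[OF E(1,2,3) D(3)] L\<psi>(6)[OF E(1,2,3) D(3)] by auto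
    have gz: "tens_lin S \<phi> E g = tens_lin S \<phi> D' g" "tens_lin S \<psi> E g = tens_lin S \<psi> D' g"
      using L\<phi>(6)[OF E(1,2,4) D'(3)] L\<psi>(6)[OF E(1,2,4) D'(3)] by auto
    show ?case
    proof (rule tens_goodI[OF E(1,2)])
      show "f p + g p = 0" if "p \<notin> E" for p
      proof -
        have "p \<notin> D" "p \<notin> D'" using that E(3,4) by auto
        then show ?thesis using D(3) D'(3) by simp
      qed
      show "(tens_lin S \<phi> E (\<lambda>p. f p + g p), tens_lin S \<psi> E (\<lambda>p. f p + g p)) \<in> N"
        unfolding L\<phi>(2)[OF E(1,2)] L\<psi>(2)[OF E(1,2)] fz gz by (rule Nadd[OF D(4) D'(4)])
    qed
  next
    case (neg f)
    obtain D where D: "finite D" "D \<subseteq> ?U" "\<And>p. p \<notin> D \<Longrightarrow> f p = 0" "(tens_lin S \<phi> D f, tens_lin S \<psi> D f) \<in> N"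
      using neg.IH by (rule tens_goodE) blast
    show ?case
    proof (rule tens_goodI[OF D(1,2)])
      show "(tens_lin S \<phi> D (\<lambda>p. - f p), tens_lin S \<psi> D (\<lambda>p. - f p)) \<in> N"
        unfolding L\<phi>(4)[OF D(1,2)] L\<psi>(4)[OF D(1,2)] by (rule Nneg[OF D(4)])
    qed (use D(3) in auto)
  next
    case (lin1 x y s)
    define D where "D = {(x \<oplus> y, s), (x, s), (y, s)}"
    have D: "finite D" "D \<subseteq> ?U" "(x \<oplus> y, s) \<in> D" "(x, s) \<in> D" "(y, s) \<in> D"
      unfolding D_def using lin1 I by auto
    show ?case
    proof (rule tens_goodI[OF D(1,2)])
      show "(tens_lin S \<phi> D (\<lambda>p. indic (x \<oplus> y, s) p - indic (x, s) p - indic (y, s) p),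
          tens_lin S \<psi> D (\<lambda>p. indic (x \<oplus> y, s) p - indic (x, s) p - indic (y, s) p)) \<in> N"
        unfolding L\<phi>(3)[OF D(1,2)] L\<psi>(3)[OF D(1,2)] L\<phi>(5)[OF D(1,2,3)] L\<phi>(5)[OF D(1,2,4)] L\<phi>(5)[OF D(1,2,5)]
           L\<psi>(5)[OF D(1,2,3)] L\<psi>(5)[OF D(1,2,4)] L\<psi>(5)[OF D(1,2,5)]
        by (rule assms(10)[OF lin1])
    qed (auto simp: D_def indic_def)
  next
    case (lin2 x s t)
    define D where "D = {(x, s \<oplus> t), (x, s), (x, t)}"
    have D: "finite D" "D \<subseteq> ?U" "(x, s \<oplus> t) \<in> D" "(x, s) \<in> D" "(x, t) \<in> D"
      unfolding D_def using lin2 by auto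
    show ?case
    proof (rule tens_goodI[OF D(1,2)])
      show "(tens_lin S \<phi> D (\<lambda>p. indic (x, s \<oplus> t) p - indic (x, s) p - indic (x, t) p),
          tens_lin S \<psi> D (\<lambda>p. indic (x, s \<oplus> t) p - indic (x, s) p - indic (x, t) p)) \<in> N"
        unfolding L\<phi>(3)[OF D(1,2)] L\<psi>(3)[OF D(1,2)] L\<phi>(5)[OF D(1,2,3)] L\<phi>(5)[OF D(1,2,4)] L\<phi>(5)[OF D(1,2,5)]
           L\<psi>(5)[OF D(1,2,3)] L\<psi>(5)[OF D(1,2,4)] L\<psi>(5)[OF D(1,2,5)]
        by (rule assms(11)[OF lin2])
    qed (auto simp: D_def indic_def)
  next
    case (bal r x s)
    define D where "D = {(r \<otimes> x, s), (x, r \<otimes> s)}"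
    have D: "finite D" "D \<subseteq> ?U" "(r \<otimes> x, s) \<in> D" "(x, r \<otimes> s) \<in> D"
      unfolding D_def using bal I RS by auto
    show ?case
    proof (rule tens_goodI[OF D(1,2)])
      show "(tens_lin S \<phi> D (\<lambda>p. indic (r \<otimes> x, s) p - indic (x, r \<otimes> s) p),
          tens_lin S \<psi> D (\<lambda>p. indic (r \<otimes> x, s) p - indic (x, r \<otimes> s) p)) \<in> N"
        unfolding L\<phi>(3)[OF D(1,2)] L\<psi>(3)[OF D(1,2)] L\<phi>(5)[OF D(1,2,3)] L\<phi>(5)[OF D(1,2,4)]
           L\<psi>(5)[OF D(1,2,3)] L\<psi>(5)[OF D(1,2,4)]
        by (rule assms(12)[OF bal])
    qed (auto simp: D_def indic_def)
  }
qed

text \<open>The pairs \<open>(\<Sum> b\<^sub>k y\<^sub>k, \<Sum> d\<^sub>k y\<^sub>k)\<close> with \<open>b\<^sub>k, d\<^sub>k\<close> in \<open>R\<close> and \<open>a\<^sub>1 b\<^sub>k + a\<^sub>2 d\<^sub>k = 0\<close>; by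
  flatness, every relation \<open>a\<^sub>1 s\<^sub>1 + a\<^sub>2 s\<^sub>2 = 0\<close> over \<open>S\<close> arises from such a pair.\<close>
inductive_set syz_span :: "'a ring \<Rightarrow> 'a set \<Rightarrow> 'a \<Rightarrow> 'a \<Rightarrow> ('a \<times> 'a) set"
  for S :: "'a ring" and R :: "'a set" and a1 :: 'a and a2 :: 'a where
  zero: "(\<zero>\<^bsub>S\<^esub>, \<zero>\<^bsub>S\<^esub>) \<in> syz_span S R a1 a2"
| step: "(x, y) \<in> syz_span S R a1 a2 \<Longrightarrow> b \<in> R \<Longrightarrow> d \<in> R \<Longrightarrow> a1 \<otimes>\<^bsub>S\<^esub> b \<oplus>\<^bsub>S\<^esub> a2 \<otimes>\<^bsub>S\<^esub> d = \<zero>\<^bsub>S\<^esub> \<Longrightarrow>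
    s \<in> carrier S \<Longrightarrow> (x \<oplus>\<^bsub>S\<^esub> b \<otimes>\<^bsub>S\<^esub> s, y \<oplus>\<^bsub>S\<^esub> d \<otimes>\<^bsub>S\<^esub> s) \<in> syz_span S R a1 a2"

lemma syz_span_facts:
  fixes S (structure)
  assumes "cring S" "subring R S" "a1 \<in> R" "a2 \<in> R"
  shows "(x, y) \<in> syz_span S R a1 a2 \<Longrightarrow> x \<in> carrier S \<and> y \<in> carrier S"
    "(x, y) \<in> syz_span S R a1 a2 \<Longrightarrow> (x', y') \<in> syz_span S R a1 a2 \<Longrightarrow> (x \<oplus> x', y \<oplus> y') \<in> syz_span S R a1 a2"
    "(x, y) \<in> syz_span S R a1 a2 \<Longrightarrow> (\<ominus> x, \<ominus> y) \<in> syz_span S R a1 a2"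
    "b \<in> R \<Longrightarrow> d \<in> R \<Longrightarrow> a1 \<otimes> b \<oplus> a2 \<otimes> d = \<zero> \<Longrightarrow> s \<in> carrier S \<Longrightarrow> (b \<otimes> s, d \<otimes> s) \<in> syz_span S R a1 a2"
proof -
  interpret cring S by fact
  have RC: "r \<in> R \<Longrightarrow> r \<in> carrier S" for r using subringE(1)[OF assms(2)] by auto
  show c: "x \<in> carrier S \<and> y \<in> carrier S" if "(x, y) \<in> syz_span S R a1 a2" for x y
    using that by (induction x y rule: syz_span.induct) (auto simp: RC)
  show "(x \<oplus> x', y \<oplus> y') \<in> syz_span S R a1 a2" if "(x, y) \<in> syz_span S R a1 a2" "(x', y') \<in> syz_span S R a1 a2"
    using that(2)
  proof (induction x' y' rule: syz_span.induct)
    case zero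
    then show ?case using that(1) c[OF that(1)] by simp
  next
    case (step u v b d s)
    have "(x \<oplus> u \<oplus> b \<otimes> s, y \<oplus> v \<oplus> d \<otimes> s) \<in> syz_span S R a1 a2" using step.IH step.hyps(2-) by (rule syz_span.step)
    then show ?case using c[OF that(1)] c[OF step.hyps(1)] step.hyps RC by (simp add: a_assoc)
  qed
  show "(\<ominus> x, \<ominus> y) \<in> syz_span S R a1 a2" if "(x, y) \<in> syz_span S R a1 a2"
    using that
  proof (induction x y rule: syz_span.induct)
    case zero
    then show ?case using syz_span.zero by simp
  next
    case (step u v b d s)
    have "(\<ominus> u \<oplus> b \<otimes> \<ominus> s, \<ominus> v \<oplus> d \<otimes> \<ominus> s) \<in> syz_span S R a1 a2"
      using step.IH step.hyps(2-4) a_inv_closed[OF step.hyps(5)] by (rule syz_span.step)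
    then show ?case using c[OF step.hyps(1)] step.hyps RC by (simp add: r_minus minus_add)
  qed
  show "(b \<otimes> s, d \<otimes> s) \<in> syz_span S R a1 a2"
    if "b \<in> R" "d \<in> R" "a1 \<otimes> b \<oplus> a2 \<otimes> d = \<zero>" "s \<in> carrier S"
    using syz_span.step[OF syz_span.zero that] that RC by simp
qed

text \<open>The equational criterion for flatness, for a relation with two terms. Let
  \<open>I\<close> be generated by \<open>a1\<close> and \<open>a2\<close>. The relation makes the
  formal sum of the pairs \<open>(a1, s1)\<close> and \<open>(a2, s2)\<close> zero in the tensor
  product of \<open>R\<close> with \<open>S\<close>, hence by flatness in that of \<open>I\<close>
  with \<open>S\<close>; a map from there to pairs modulo \<open>syz_span\<close> takes this sum to
  the class of \<open>(s1, s2)\<close>.\<close>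

lemma flat_syzygy:
  fixes S (structure)
  assumes "cring S" and R: "subring R S" and fl: "flat_ext S R" and a: "a1 \<in> R" "a2 \<in> R"
    and s: "s1 \<in> carrier S" "s2 \<in> carrier S" and rel: "a1 \<otimes> s1 \<oplus> a2 \<otimes> s2 = \<zero>"
  shows "(s1, s2) \<in> syz_span S R a1 a2"
proof -
  interpret cring S by fact
  interpret R: cring "S\<lparr>carrier := R\<rparr>" by (rule subring_cring[OF R])
  note sR = subringE[OF R]
  note sy = syz_span_facts[OF assms(1) R a]
  let ?N = "syz_span S R a1 a2"
  have RC: "r \<in> R \<Longrightarrow> r \<in> carrier S" for r using sR(1) by auto
  have ac: "a1 \<in> carrier S" "a2 \<in> carrier S" using a RC by auto
  have Rm: "x \<ominus> y \<in> R" if "x \<in> R" "y \<in> R" for x y unfolding minus_eq using that sR by simp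
  define I where "I = {a1 \<otimes> u \<oplus> a2 \<otimes> v | u v. u \<in> R \<and> v \<in> R}"
  have Iadd: "x \<oplus> y \<in> I" if "x \<in> I" "y \<in> I" for x y
  proof -
    obtain u v u' v' where h: "x = a1 \<otimes> u \<oplus> a2 \<otimes> v" "y = a1 \<otimes> u' \<oplus> a2 \<otimes> v'" "u \<in> R" "v \<in> R" "u' \<in> R" "v' \<in> R"
      using \<open>x \<in> I\<close> \<open>y \<in> I\<close> unfolding I_def by blast
    have cc: "u \<in> carrier S" "v \<in> carrier S" "u' \<in> carrier S" "v' \<in> carrier S" using h RC by auto
    have "x \<oplus> y = a1 \<otimes> (u \<oplus> u') \<oplus> a2 \<otimes> (v \<oplus> v')" unfolding h(1,2) using cc ac by algebra
    moreover have "u \<oplus> u' \<in> R" "v \<oplus> v' \<in> R" using h sR(7) by auto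
    ultimately show ?thesis unfolding I_def by blast
  qed
  have Imul: "r \<otimes> x \<in> I" if "r \<in> R" "x \<in> I" for r x
  proof -
    obtain u v where h: "x = a1 \<otimes> u \<oplus> a2 \<otimes> v" "u \<in> R" "v \<in> R" using \<open>x \<in> I\<close> unfolding I_def by blast
    have cc: "u \<in> carrier S" "v \<in> carrier S" "r \<in> carrier S" using h RC that by auto
    have "r \<otimes> x = a1 \<otimes> (r \<otimes> u) \<oplus> a2 \<otimes> (r \<otimes> v)" unfolding h(1) using cc ac by algebra
    moreover have "r \<otimes> u \<in> R" "r \<otimes> v \<in> R" using h sR(6) that by auto
    ultimately show ?thesis unfolding I_def by blast
  qed
  have IR: "I \<subseteq> R"
  proof
    fix x assume "x \<in> I"
    then obtain u v where h: "x = a1 \<otimes> u \<oplus> a2 \<otimes> v" "u \<in> R" "v \<in> R" unfolding I_def by blast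
    then show "x \<in> R" using sR(7)[OF sR(6)[OF a(1)] sR(6)[OF a(2)]] by simp
  qed
  have "\<zero> \<in> I" unfolding I_def using sR(2) ac by (auto intro!: exI[of _ \<zero>])
  then have II: "ideal I (S\<lparr>carrier := R\<rparr>)" using IR Iadd Imul by (intro R.cring_idealI) auto
  have aI: "a1 \<in> I" "a2 \<in> I"
  proof -
    have "a1 = a1 \<otimes> \<one> \<oplus> a2 \<otimes> \<zero>" "a2 = a1 \<otimes> \<zero> \<oplus> a2 \<otimes> \<one>" using ac by auto
    then show "a1 \<in> I" "a2 \<in> I" unfolding I_def using sR(2,3) by blast+
  qed
  \<comment> \<open>Coefficients of the elements of \<open>I\<close> are chosen arbitrarily, with no
    linearity. Their failure to be linear is itself a syzygy of \<open>a1\<close> and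
    \<open>a2\<close>, so \<open>(\<phi>, \<psi>)\<close> is balanced modulo
    \<open>syz_span\<close>.\<close>
  have "\<forall>x\<in>I. \<exists>w. fst w \<in> R \<and> snd w \<in> R \<and> x = a1 \<otimes> fst w \<oplus> a2 \<otimes> snd w"
    unfolding I_def by auto
  from bchoice[OF this] obtain w where w: "\<forall>x\<in>I. fst (w x) \<in> R \<and> snd (w x) \<in> R \<and> x = a1 \<otimes> fst (w x) \<oplus> a2 \<otimes> snd (w x)" ..
  define u where "u x = fst (w x)" for x
  define v where "v x = snd (w x)" for x
  have uv: "u x \<in> R \<and> v x \<in> R \<and> x = a1 \<otimes> u x \<oplus> a2 \<otimes> v x" if "x \<in> I" for x
    using w that unfolding u_def v_def by blast
  have uR: "u x \<in> R" "v x \<in> R" "u x \<in> carrier S" "v x \<in> carrier S" "x = a1 \<otimes> u x \<oplus> a2 \<otimes> v x" "x \<in> carrier S" if "x \<in> I" for x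
    using uv[OF that] RC that IR by blast+
  define \<phi> where "\<phi> p = u (fst p) \<otimes> snd p" for p
  define \<psi> where "\<psi> p = v (fst p) \<otimes> snd p" for p
  have good: "tens_good S \<phi> \<psi> (I \<times> carrier S) ?N f" if "f \<in> tens_rel S R I" for f
  proof (rule tens_rel_good[OF assms(1) Iadd Imul sR(1) _ _ syz_span.zero sy(2,3) _ _ _ that])
    show "\<phi> p \<in> carrier S" if "p \<in> I \<times> carrier S" for p unfolding \<phi>_def using that uR by auto
    show "\<psi> p \<in> carrier S" if "p \<in> I \<times> carrier S" for p unfolding \<psi>_def using that uR by auto
  next
    fix x y s assume xy: "x \<in> I" "y \<in> I" and s: "s \<in> carrier S"
    note ux = uR[OF xy(1)] and uy = uR[OF xy(2)] and uxy = uR[OF Iadd[OF xy]]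
    let ?b = "u (x \<oplus> y) \<ominus> u x \<ominus> u y" and ?d = "v (x \<oplus> y) \<ominus> v x \<ominus> v y"
    have "a1 \<otimes> ?b \<oplus> a2 \<otimes> ?d = (a1 \<otimes> u (x \<oplus> y) \<oplus> a2 \<otimes> v (x \<oplus> y)) \<ominus> (a1 \<otimes> u x \<oplus> a2 \<otimes> v x) \<ominus> (a1 \<otimes> u y \<oplus> a2 \<otimes> v y)"
      using ac ux(3,4) uy(3,4) uxy(3,4) by algebra
    also have "\<dots> = (x \<oplus> y) \<ominus> x \<ominus> y" using ux(5) uy(5) uxy(5) by simp
    also have "\<dots> = \<zero>" using ux(6) uy(6) by algebra
    finally have "(?b \<otimes> s, ?d \<otimes> s) \<in> ?N" using sy(4)[of ?b ?d s] s Rm ux(1,2) uy(1,2) uxy(1,2) by simp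
    moreover have "?b \<otimes> s = \<phi> (x \<oplus> y, s) \<ominus> \<phi> (x, s) \<ominus> \<phi> (y, s)"
      unfolding \<phi>_def fst_conv snd_conv using s ux(3,4) uy(3,4) uxy(3,4) by algebra
    moreover have "?d \<otimes> s = \<psi> (x \<oplus> y, s) \<ominus> \<psi> (x, s) \<ominus> \<psi> (y, s)"
      unfolding \<psi>_def fst_conv snd_conv using s ux(3,4) uy(3,4) uxy(3,4) by algebra
    ultimately show "(\<phi> (x \<oplus> y, s) \<ominus> \<phi> (x, s) \<ominus> \<phi> (y, s), \<psi> (x \<oplus> y, s) \<ominus> \<psi> (x, s) \<ominus> \<psi> (y, s)) \<in> ?N" by simp
  next
    fix x s t assume x: "x \<in> I" and st: "s \<in> carrier S" "t \<in> carrier S"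
    note ux = uR[OF x]
    have "\<phi> (x, s \<oplus> t) \<ominus> \<phi> (x, s) \<ominus> \<phi> (x, t) = \<zero>" unfolding \<phi>_def fst_conv snd_conv using ux(3) st by algebra
    moreover have "\<psi> (x, s \<oplus> t) \<ominus> \<psi> (x, s) \<ominus> \<psi> (x, t) = \<zero>" unfolding \<psi>_def fst_conv snd_conv using ux(4) st by algebra
    ultimately show "(\<phi> (x, s \<oplus> t) \<ominus> \<phi> (x, s) \<ominus> \<phi> (x, t), \<psi> (x, s \<oplus> t) \<ominus> \<psi> (x, s) \<ominus> \<psi> (x, t)) \<in> ?N"
      using syz_span.zero by simp
  next
    fix r x s assume r: "r \<in> R" and x: "x \<in> I" and s: "s \<in> carrier S"
    note ux = uR[OF x] and urx = uR[OF Imul[OF r x]] and rc = RC[OF r]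
    let ?b = "u (r \<otimes> x) \<ominus> r \<otimes> u x" and ?d = "v (r \<otimes> x) \<ominus> r \<otimes> v x"
    have "a1 \<otimes> ?b \<oplus> a2 \<otimes> ?d = (a1 \<otimes> u (r \<otimes> x) \<oplus> a2 \<otimes> v (r \<otimes> x)) \<ominus> r \<otimes> (a1 \<otimes> u x \<oplus> a2 \<otimes> v x)"
      using ac ux(3,4) urx(3,4) rc by algebra
    also have "\<dots> = r \<otimes> x \<ominus> r \<otimes> x" using ux(5) urx(5) by simp
    also have "\<dots> = \<zero>" using ux(6) rc by algebra
    finally have "(?b \<otimes> s, ?d \<otimes> s) \<in> ?N" using sy(4)[of ?b ?d s] s Rm ux(1,2) urx(1,2) sR(6) r by simp
    moreover have "?b \<otimes> s = \<phi> (r \<otimes> x, s) \<ominus> \<phi> (x, r \<otimes> s)"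
      unfolding \<phi>_def fst_conv snd_conv using s ux(3,4) urx(3,4) rc by algebra
    moreover have "?d \<otimes> s = \<psi> (r \<otimes> x, s) \<ominus> \<psi> (x, r \<otimes> s)"
      unfolding \<psi>_def fst_conv snd_conv using s ux(3,4) urx(3,4) rc by algebra
    ultimately show "(\<phi> (r \<otimes> x, s) \<ominus> \<phi> (x, r \<otimes> s), \<psi> (r \<otimes> x, s) \<ominus> \<psi> (x, r \<otimes> s)) \<in> ?N" by simp
  qed
  define f where "f p = indic (a1, s1) p + indic (a2, s2) p" for p
  have sup: "{p. f p \<noteq> 0} \<subseteq> {(a1, s1), (a2, s2)}" unfolding f_def indic_def by auto
  \<comment> \<open>Over \<open>R\<close> both pairs can be moved to first entry
    \<open>\<one>\<close>, where the second entries add up to zero; that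
    \<open>(\<one>, \<zero>)\<close> is itself a relation comes from biadditivity at
    \<open>\<zero> \<oplus> \<zero>\<close>.\<close>
  have fR: "f \<in> tens_rel S R R"
  proof -
    let ?T = "tens_rel S R R"
    have m: "(\<lambda>p. g p - h p) \<in> ?T" if "g \<in> ?T" "h \<in> ?T" for g h
      using tens_rel.add[OF that(1) tens_rel.neg[OF that(2)]] by simp
    have b1: "(\<lambda>p. indic (a1, s1) p - indic (\<one>, a1 \<otimes> s1) p) \<in> ?T"
      using tens_rel.bal[OF a(1) sR(3) s(1)] ac by simp
    have b2: "(\<lambda>p. indic (a2, s2) p - indic (\<one>, a2 \<otimes> s2) p) \<in> ?T"
      using tens_rel.bal[OF a(2) sR(3) s(2)] ac by simp
    have l: "(\<lambda>p. indic (\<one>, \<zero>) p - indic (\<one>, a1 \<otimes> s1) p - indic (\<one>, a2 \<otimes> s2) p) \<in> ?T"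
      using tens_rel.lin2[of \<one> R "a1 \<otimes> s1" S "a2 \<otimes> s2"] rel ac s sR(3) by simp
    have "(\<lambda>p. indic (\<one>, \<zero>) p - indic (\<one>, \<zero>) p - indic (\<one>, \<zero>) p) \<in> ?T"
      using tens_rel.lin2[of \<one> R \<zero> S \<zero>] sR(3) by simp
    from tens_rel.neg[OF this] have z: "indic (\<one>, \<zero>) \<in> ?T" by simp
    from tens_rel.add[OF m[OF tens_rel.add[OF b1 b2] l] z] show ?thesis unfolding f_def by (simp add: algebra_simps)
  qed
  have "f \<in> tens_rel S R I"
    using fl II fR sup aI s finite_subset[OF sup] unfolding flat_ext_def by blast
  from good[OF this] obtain D where D: "finite D" "D \<subseteq> I \<times> carrier S" "\<And>p. p \<notin> D \<Longrightarrow> f p = 0"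
    "(tens_lin S \<phi> D f, tens_lin S \<psi> D f) \<in> ?N" by (rule tens_goodE) blast
  define E where "E = D \<union> {(a1, s1), (a2, s2)}"
  have E: "finite E" "E \<subseteq> I \<times> carrier S" "D \<subseteq> E" "(a1, s1) \<in> E" "(a2, s2) \<in> E" unfolding E_def using D aI s by auto
  have \<phi>E: "\<phi> p \<in> carrier S" "\<psi> p \<in> carrier S" if "p \<in> E" for p unfolding \<phi>_def \<psi>_def using that E(2) uR by auto
  have PE: "\<phi> \<in> E \<rightarrow> carrier S" "\<psi> \<in> E \<rightarrow> carrier S" using \<phi>E by auto
  note L\<phi> = tens_lin_facts[OF assms(1) PE(1) E(1) subset_refl]
    and L\<psi> = tens_lin_facts[OF assms(1) PE(2) E(1) subset_refl]
  have e1: "tens_lin S \<phi> D f = \<phi> (a1, s1) \<oplus> \<phi> (a2, s2)"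
    using L\<phi>(6)[OF E(3), of f, OF D(3)] L\<phi>(2)[of "indic (a1, s1)" "indic (a2, s2)"] L\<phi>(5)[OF E(4)] L\<phi>(5)[OF E(5)] unfolding f_def by simp
  have e2: "tens_lin S \<psi> D f = \<psi> (a1, s1) \<oplus> \<psi> (a2, s2)"
    using L\<psi>(6)[OF E(3), of f, OF D(3)] L\<psi>(2)[of "indic (a1, s1)" "indic (a2, s2)"] L\<psi>(5)[OF E(4)] L\<psi>(5)[OF E(5)] unfolding f_def by simp
  note u1 = uR[OF aI(1)] and u2 = uR[OF aI(2)]
  have n1: "(u a1 \<otimes> s1 \<oplus> u a2 \<otimes> s2, v a1 \<otimes> s1 \<oplus> v a2 \<otimes> s2) \<in> ?N"
    using D(4) unfolding e1 e2 \<phi>_def \<psi>_def by simp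
  \<comment> \<open>The chosen coefficients of \<open>a1\<close> need not be
    \<open>(\<one>, \<zero>)\<close>, nor those of \<open>a2\<close> be
    \<open>(\<zero>, \<one>)\<close>; the differences are again syzygies, and correcting by them
    yields \<open>(s1, s2)\<close>.\<close>
  have oc: "\<one> \<in> carrier S" "\<zero> \<in> carrier S" by auto
  have "a1 \<otimes> (\<one> \<ominus> u a1) \<oplus> a2 \<otimes> (\<zero> \<ominus> v a1) = a1 \<ominus> (a1 \<otimes> u a1 \<oplus> a2 \<otimes> v a1)" using ac u1(3,4) oc by algebra
  also have "\<dots> = a1 \<ominus> a1" using u1(5) by simp
  finally have n2: "((\<one> \<ominus> u a1) \<otimes> s1, (\<zero> \<ominus> v a1) \<otimes> s1) \<in> ?N"
    using sy(4)[of "\<one> \<ominus> u a1" "\<zero> \<ominus> v a1" s1] s Rm u1(1,2) sR(2,3) ac by (simp add: minus_eq r_neg)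
  have "a1 \<otimes> (\<zero> \<ominus> u a2) \<oplus> a2 \<otimes> (\<one> \<ominus> v a2) = a2 \<ominus> (a1 \<otimes> u a2 \<oplus> a2 \<otimes> v a2)" using ac u2(3,4) oc by algebra
  also have "\<dots> = a2 \<ominus> a2" using u2(5) by simp
  finally have n3: "((\<zero> \<ominus> u a2) \<otimes> s2, (\<one> \<ominus> v a2) \<otimes> s2) \<in> ?N"
    using sy(4)[of "\<zero> \<ominus> u a2" "\<one> \<ominus> v a2" s2] s Rm u2(1,2) sR(2,3) ac by (simp add: minus_eq r_neg)
  from sy(2)[OF sy(2)[OF n1 n2] n3]
  have "((u a1 \<otimes> s1 \<oplus> u a2 \<otimes> s2) \<oplus> (\<one> \<ominus> u a1) \<otimes> s1 \<oplus> (\<zero> \<ominus> u a2) \<otimes> s2,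
     (v a1 \<otimes> s1 \<oplus> v a2 \<otimes> s2) \<oplus> (\<zero> \<ominus> v a1) \<otimes> s1 \<oplus> (\<one> \<ominus> v a2) \<otimes> s2) \<in> ?N" .
  moreover have "(u a1 \<otimes> s1 \<oplus> u a2 \<otimes> s2) \<oplus> (\<one> \<ominus> u a1) \<otimes> s1 \<oplus> (\<zero> \<ominus> u a2) \<otimes> s2 = s1"
    using u1(3,4) u2(3,4) s oc by algebra
  moreover have "(v a1 \<otimes> s1 \<oplus> v a2 \<otimes> s2) \<oplus> (\<zero> \<ominus> v a1) \<otimes> s1 \<oplus> (\<one> \<ominus> v a2) \<otimes> s2 = s2"
    using u1(3,4) u2(3,4) s oc by algebra
  ultimately show ?thesis by simp
qed

text \<open>For \<open>s\<close> in \<open>Q1\<close> but not in \<open>Q2\<close>, the relation \<open>c s - r 1 = 0\<close> with \<open>r = c s\<close> in \<open>R\<close> comes from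
  syzygies whose determinants annihilate \<open>c\<close>; if all of them were in \<open>Q1\<close>, then \<open>s\<close> and \<open>1\<close> would be
  proportional modulo \<open>Q1 \<inter> Q2\<close>.\<close>
lemma conductor_locally_zero_of_not_subset:
  fixes S (structure)
  assumes "cring S" and R: "subring R S" and fl: "flat_ext S R"
    and Q1: "primeideal Q1 S" and Q2: "primeideal Q2 S" and ne: "\<not> Q1 \<subseteq> Q2" and eq: "Q1 \<inter> R = Q2 \<inter> R"
    and c: "c \<in> conductor S R"
  shows "\<exists>u\<in>R. u \<notin> Q1 \<and> u \<otimes> c = \<zero>"
proof (rule ccontr)
  assume "\<not> ?thesis"
  then have nz: "u \<in> Q1" if "u \<in> R" "u \<otimes> c = \<zero>" for u using that by auto
  interpret cring S by fact
  note sR = subringE[OF R]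
  have RC: "r \<in> R \<Longrightarrow> r \<in> carrier S" for r using sR(1) by auto
  have Rm: "x \<ominus> y \<in> R" if "x \<in> R" "y \<in> R" for x y unfolding minus_eq using that sR by simp
  note q1 = ideal_facts[OF primeideal.axioms(1)[OF Q1]] and q2 = ideal_facts[OF primeideal.axioms(1)[OF Q2]]
  obtain s where s: "s \<in> Q1" "s \<notin> Q2" using ne by auto
  have sc: "s \<in> carrier S" using s q1 by auto
  have cR: "c \<in> R" and "c \<otimes> s \<in> R" using c sc unfolding conductor_def by auto
  define r where "r = c \<otimes> s"
  have rR: "r \<in> R" and rc: "r \<in> carrier S" and cc: "c \<in> carrier S" using \<open>c \<otimes> s \<in> R\<close> cR RC unfolding r_def by auto
  let ?N = "syz_span S R c (\<ominus> r)"
  have mr: "\<ominus> r \<in> R" using rR sR by simp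
  have "c \<otimes> s \<oplus> \<ominus> r \<otimes> \<one> = \<zero>" using rc unfolding r_def[symmetric] by (simp add: r_neg)
  then have mem: "(s, \<one>) \<in> ?N" using flat_syzygy[OF assms(1) R fl cR mr sc one_closed] by simp
  have sy: "c \<otimes> b = r \<otimes> d" if h: "b \<in> R" "d \<in> R" "c \<otimes> b \<oplus> \<ominus> r \<otimes> d = \<zero>" for b d
  proof -
    have bd: "b \<in> carrier S" "d \<in> carrier S" using h RC by auto
    have "c \<otimes> b = (c \<otimes> b \<oplus> \<ominus> r \<otimes> d) \<oplus> r \<otimes> d" using bd rc cc by algebra
    then show ?thesis using h bd rc by simp
  qed
  have det: "b \<otimes> d' \<ominus> b' \<otimes> d \<in> Q1 \<inter> R"
    if h: "b \<in> R" "d \<in> R" "c \<otimes> b \<oplus> \<ominus> r \<otimes> d = \<zero>" "b' \<in> R" "d' \<in> R" "c \<otimes> b' \<oplus> \<ominus> r \<otimes> d' = \<zero>" for b d b' d'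
  proof -
    have bd: "b \<in> carrier S" "d \<in> carrier S" "b' \<in> carrier S" "d' \<in> carrier S" using h RC by auto
    have "(b \<otimes> d' \<ominus> b' \<otimes> d) \<otimes> c = (c \<otimes> b) \<otimes> d' \<ominus> (c \<otimes> b') \<otimes> d" using bd cc by algebra
    also have "\<dots> = (r \<otimes> d) \<otimes> d' \<ominus> (r \<otimes> d') \<otimes> d" using sy[OF h(1-3)] sy[OF h(4-6)] by simp
    also have "\<dots> = \<zero>" using bd rc by algebra
    finally have "(b \<otimes> d' \<ominus> b' \<otimes> d) \<otimes> c = \<zero>" .
    moreover have "b \<otimes> d' \<ominus> b' \<otimes> d \<in> R" using h Rm sR(6) by simp
    ultimately show ?thesis using nz by auto
  qed
  \<comment> \<open>If all second coefficients were in \<open>Q1\<close>, the span would put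
    \<open>\<one>\<close>, the second entry of \<open>(s, \<one>)\<close>, into
    \<open>Q1\<close>.\<close>
  have "\<exists>b d. b \<in> R \<and> d \<in> R \<and> c \<otimes> b \<oplus> \<ominus> r \<otimes> d = \<zero> \<and> d \<notin> Q1"
  proof (rule ccontr)
    assume "\<not> ?thesis"
    then have all: "d \<in> Q1" if "b \<in> R" "d \<in> R" "c \<otimes> b \<oplus> \<ominus> r \<otimes> d = \<zero>" for b d using that by blast
    have "y \<in> Q1" if "(x, y) \<in> ?N" for x y
      using that
    proof (induction x y rule: syz_span.induct)
      case (step x y b d s)
      show ?case using q1(3)[OF step.IH q1(5)[OF step.hyps(5) all[OF step.hyps(2-4)]]] .
    qed (rule q1(2))
    from this[OF mem] show False
      using ideal.one_imp_carrier[OF primeideal.axioms(1)[OF Q1]] primeideal.I_notcarr[OF Q1] by simp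
  qed
  then obtain b0 d0 where b0: "b0 \<in> R" "d0 \<in> R" "c \<otimes> b0 \<oplus> \<ominus> r \<otimes> d0 = \<zero>" "d0 \<notin> Q1" by auto
  have bc: "b0 \<in> carrier S" "d0 \<in> carrier S" using b0 RC by auto
  have inQ: "d0 \<otimes> x \<ominus> b0 \<otimes> y \<in> Q1 \<inter> Q2" if "(x, y) \<in> ?N" for x y
    using that
  proof (induction x y rule: syz_span.induct)
    case zero
    then show ?case using bc q1(2) q2(2) by (simp add: minus_eq)
  next
    case (step x y b d s)
    have xy: "x \<in> carrier S" "y \<in> carrier S" using syz_span_facts(1)[OF assms(1) R cR mr step.hyps(1)] by auto
    have bd: "b \<in> carrier S" "d \<in> carrier S" using step.hyps RC by auto
    have m: "b \<otimes> d0 \<ominus> b0 \<otimes> d \<in> Q1 \<inter> R" using det[OF step.hyps(2-4) b0(1-3)] .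
    then have m2: "b \<otimes> d0 \<ominus> b0 \<otimes> d \<in> Q2" using eq by auto
    have "d0 \<otimes> (x \<oplus> b \<otimes> s) \<ominus> b0 \<otimes> (y \<oplus> d \<otimes> s) = (d0 \<otimes> x \<ominus> b0 \<otimes> y) \<oplus> (b \<otimes> d0 \<ominus> b0 \<otimes> d) \<otimes> s"
      using xy bd bc step.hyps(5) by algebra
    then show ?case using step.IH m m2 q1(3,5) q2(3,5) step.hyps(5) by simp
  qed
  \<comment> \<open>Here \<open>s \<in> Q1\<close> gives \<open>b0 \<in> Q1 \<inter> R\<close>,
    hence \<open>b0 \<in> Q2\<close>; then \<open>d0 s \<in> Q2\<close> although neither factor lies
    in \<open>Q2\<close>.\<close>
  have 1: "d0 \<otimes> s \<ominus> b0 \<in> Q1 \<inter> Q2" using inQ[OF mem] bc by simp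
  have "d0 \<otimes> s \<ominus> (d0 \<otimes> s \<ominus> b0) \<in> Q1" using 1 q1(4,7) s bc by simp
  moreover have "d0 \<otimes> s \<ominus> (d0 \<otimes> s \<ominus> b0) = b0" using bc sc by algebra
  ultimately have "b0 \<in> Q2" using eq b0 by auto
  then have "(d0 \<otimes> s \<ominus> b0) \<oplus> b0 \<in> Q2" using 1 q2(3) by simp
  moreover have "(d0 \<otimes> s \<ominus> b0) \<oplus> b0 = d0 \<otimes> s" using bc sc by algebra
  ultimately have "d0 \<in> Q2 \<or> s \<in> Q2" using primeideal.I_prime[OF Q2 bc(2) sc] by simp
  then show False using s b0 eq by auto
qed

lemma conductor_locally_zero:
  fixes S (structure)
  assumes "cring S" and R: "subring R S" and fl: "flat_ext S R"
    and Q1: "primeideal Q1 S" and Q2: "primeideal Q2 S" and ne: "Q1 \<noteq> Q2" and eq: "Q1 \<inter> R = Q2 \<inter> R"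
    and c: "c \<in> conductor S R"
  shows "\<exists>u\<in>R. u \<notin> Q1 \<and> u \<otimes> c = \<zero>"
proof (cases "Q1 \<subseteq> Q2")
  case False
  then show ?thesis using conductor_locally_zero_of_not_subset[OF assms(1) R fl Q1 Q2 _ eq c] by simp
next
  case True
  then have "\<not> Q2 \<subseteq> Q1" using ne by auto
  then obtain u where "u \<in> R" "u \<notin> Q2" "u \<otimes> c = \<zero>"
    using conductor_locally_zero_of_not_subset[OF assms(1) R fl Q2 Q1 _ eq[symmetric] c] by auto
  then show ?thesis using eq by blast
qed

text \<open>The product \<open>a f\<close> vanishes only modulo the conductor, so a factor
  \<open>u\<close> outside \<open>Q1\<close> is used to make it zero in \<open>S\<close>. Flatness
  then writes \<open>f\<close> as a combination of elements \<open>b\<close> of \<open>R\<close>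
  with \<open>u a b = 0\<close>; since \<open>f \<notin> Q1\<close>, one of them is outside
  \<open>Q1\<close>, and \<open>v = u b\<close>.\<close>

lemma flat_torsion:
  fixes S (structure)
  assumes "cring S" and R: "subring R S" and fl: "flat_ext S R"
    and Q1: "primeideal Q1 S" and Q2: "primeideal Q2 S" and ne: "Q1 \<noteq> Q2" and eq: "Q1 \<inter> R = Q2 \<inter> R"
    and a: "a \<in> R" and f: "f \<in> carrier S" "f \<notin> Q1" and af: "a \<otimes> f \<in> conductor S R"
  shows "\<exists>v\<in>R. v \<notin> Q1 \<and> v \<otimes> a = \<zero>"
proof -
  interpret cring S by fact
  note sR = subringE[OF R]
  have RC: "r \<in> R \<Longrightarrow> r \<in> carrier S" for r using sR(1) by auto
  note q1 = ideal_facts[OF primeideal.axioms(1)[OF Q1]]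
  obtain u where u: "u \<in> R" "u \<notin> Q1" "u \<otimes> (a \<otimes> f) = \<zero>"
    using conductor_locally_zero[OF assms(1) R fl Q1 Q2 ne eq af] by auto
  have cc: "u \<in> carrier S" "a \<in> carrier S" using u a RC by auto
  have uaR: "u \<otimes> a \<in> R" using u a sR by simp
  \<comment> \<open>A relation with one term is treated as one with two terms, the second
    coefficient and the second element being zero.\<close>
  have "(u \<otimes> a) \<otimes> f \<oplus> \<zero> \<otimes> \<zero> = \<zero>" using u cc f by (simp add: m_assoc)
  then have mem: "(f, \<zero>) \<in> syz_span S R (u \<otimes> a) \<zero>"
    using flat_syzygy[OF assms(1) R fl uaR sR(2) f(1) zero_closed] by simp
  have "\<exists>b\<in>R. b \<notin> Q1 \<and> u \<otimes> a \<otimes> b = \<zero>"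
  proof (rule ccontr)
    assume "\<not> ?thesis"
    then have all: "b \<in> Q1" if "b \<in> R" "u \<otimes> a \<otimes> b = \<zero>" for b using that by auto
    have "x \<in> Q1" if "(x, y) \<in> syz_span S R (u \<otimes> a) \<zero>" for x y
      using that
    proof (induction x y rule: syz_span.induct)
      case (step x y b d s)
      have "u \<otimes> a \<otimes> b = \<zero>" using step.hyps(4) cc RC[OF step.hyps(2)] RC[OF step.hyps(3)] by simp
      then show ?case using q1(3)[OF step.IH q1(5)[OF step.hyps(5) all[OF step.hyps(2)]]] by simp
    qed (rule q1(2))
    then show False using mem f by auto
  qed
  then obtain b where b: "b \<in> R" "b \<notin> Q1" "u \<otimes> a \<otimes> b = \<zero>" by auto
  have "(u \<otimes> b) \<otimes> a = \<zero>" using b cc RC[OF b(1)] by (simp add: m_ac)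
  moreover have "u \<otimes> b \<notin> Q1" using primeideal.I_prime[OF Q1 cc(1) RC[OF b(1)]] u b by auto
  ultimately show ?thesis using sR(6)[OF u(1) b(1)] by blast
qed


section \<open>Reduction modulo the conductor\<close>

locale etale_gilmer =
  fixes S :: "'a ring" (structure) and R :: "'a set"
  assumes crS: "cring S" and R: "subring R S" and et: "etale S R" and inf: "infra_integral S R"
    and gil: "gilmer_ext S R"
begin

sublocale cring S by (rule crS)

definition C where "C = conductor S R"
definition \<pi> where "\<pi> s = C +> s"
definition B where "B = S Quot C"
definition A where "A = \<pi> ` R"

lemma RC[simp]: "r \<in> R \<Longrightarrow> r \<in> carrier S" using subringE(1)[OF R] by auto

lemma R_closed[simp]:
  "\<zero> \<in> R" "\<one> \<in> R" "a \<in> R \<Longrightarrow> \<ominus> a \<in> R" "a \<in> R \<Longrightarrow> b \<in> R \<Longrightarrow> a \<otimes> b \<in> R"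
  "a \<in> R \<Longrightarrow> b \<in> R \<Longrightarrow> a \<oplus> b \<in> R" "a \<in> R \<Longrightarrow> b \<in> R \<Longrightarrow> a \<ominus> b \<in> R"
  using subringE[OF R] by (auto simp: minus_eq)

lemma crR: "cring (S\<lparr>carrier := R\<rparr>)" by (rule subring_cring[OF R])

lemma C_R: "c \<in> C \<Longrightarrow> c \<in> R" unfolding C_def conductor_def by auto

lemma C_mult: "c \<in> C \<Longrightarrow> s \<in> carrier S \<Longrightarrow> s \<otimes> c \<in> C"
proof -
  assume c: "c \<in> C" and s: "s \<in> carrier S"
  have cR: "c \<in> carrier S" using C_R[OF c] by simp
  have "s \<otimes> c \<in> R" using c s m_comm[OF s cR] unfolding C_def conductor_def by auto
  moreover have "s \<otimes> c \<otimes> t \<in> R" if t: "t \<in> carrier S" for t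
  proof -
    have "c \<otimes> (s \<otimes> t) \<in> R" using c s t unfolding C_def conductor_def by auto
    moreover have "c \<otimes> (s \<otimes> t) = s \<otimes> c \<otimes> t" using s t cR by (simp add: m_ac)
    ultimately show ?thesis by simp
  qed
  ultimately show "s \<otimes> c \<in> C" unfolding C_def conductor_def by auto
qed

lemma C_add: "c \<in> C \<Longrightarrow> d \<in> C \<Longrightarrow> c \<oplus> d \<in> C"
  unfolding C_def conductor_def by (auto simp: l_distr)

lemma C_zero: "\<zero> \<in> C" unfolding C_def conductor_def by auto

lemma C_ideal: "ideal C S"
  using C_R C_mult C_add C_zero by (intro cring_idealI) auto

sublocale Cid: ideal C S by (rule C_ideal)

lemma crB: "cring B" unfolding B_def by (rule Cid.quotient_is_cring[OF crS])

sublocale B: cring B by (rule crB)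

lemma pi_hom: "\<pi> \<in> ring_hom S B" unfolding \<pi>_def[abs_def] B_def by (rule Cid.rcos_ring_hom)

sublocale pi: ring_hom_cring S B \<pi>
  by (rule ring_hom_cring.intro) (auto simp: ring_hom_cring_axioms_def crS crB pi_hom)

lemma B_carrier: "carrier B = \<pi> ` carrier S"
  unfolding B_def FactRing_def \<pi>_def A_RCOSETS_def RCOSETS_def a_r_coset_def by auto

lemma pi_eq: "a \<in> carrier S \<Longrightarrow> b \<in> carrier S \<Longrightarrow> \<pi> a = \<pi> b \<longleftrightarrow> a \<ominus> b \<in> C"
  unfolding \<pi>_def using quotient_eq_iff_same_a_r_cos[OF C_ideal] by auto

lemma pi_zero_iff: "a \<in> carrier S \<Longrightarrow> \<pi> a = \<zero>\<^bsub>B\<^esub> \<longleftrightarrow> a \<in> C"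
  using pi_eq[of a \<zero>] by (simp add: minus_eq)

lemma pi_minus: "a \<in> carrier S \<Longrightarrow> b \<in> carrier S \<Longrightarrow> \<pi> (a \<ominus> b) = \<pi> a \<ominus>\<^bsub>B\<^esub> \<pi> b"
  by (simp add: minus_eq B.minus_eq)

lemma pi_pow: "a \<in> carrier S \<Longrightarrow> \<pi> (a [^] (n::nat)) = \<pi> a [^]\<^bsub>B\<^esub> n"
  by (induction n) auto

lemma A_subring: "subring A B"
  unfolding A_def
  by (rule ring_hom_ring.img_is_subring[OF ring_hom_ringI2[OF ring_axioms B.ring_axioms pi_hom] R])

lemma AB: "a \<in> A \<Longrightarrow> a \<in> carrier B" unfolding A_def by auto

lemma pi_A: "s \<in> carrier S \<Longrightarrow> \<pi> s \<in> A \<longleftrightarrow> s \<in> R"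
proof
  assume s: "s \<in> carrier S" and "\<pi> s \<in> A"
  then obtain r where r: "r \<in> R" "\<pi> s = \<pi> r" unfolding A_def by auto
  then have "s \<ominus> r \<in> R" using pi_eq[of s r] s C_R by auto
  then have "(s \<ominus> r) \<oplus> r \<in> R" using r by simp
  moreover have "(s \<ominus> r) \<oplus> r = s" using s RC[OF r(1)] by algebra
  ultimately show "s \<in> R" by simp
qed (auto simp: A_def)

text \<open>An equality of records: cosets, their sums and their products refer to the operations of
  \<open>S\<close> but not to its carrier, so the nucleus is literally \<open>B\<close> with carrier
  \<open>A\<close>.\<close>

lemma sub_quot: "B\<lparr>carrier := A\<rparr> = S\<lparr>carrier := R\<rparr> Quot C"
proof -
  have 1: "a_r_coset (S\<lparr>carrier := R\<rparr>) = a_r_coset S" unfolding a_r_coset_def r_coset_def[abs_def] by simp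
  have 2: "set_add (S\<lparr>carrier := R\<rparr>) = set_add S" unfolding set_add_def set_mult_def[abs_def] by simp
  have 3: "rcoset_mult (S\<lparr>carrier := R\<rparr>) C = rcoset_mult S C" unfolding rcoset_mult_def[abs_def] 1 by simp
  have 4: "A_RCOSETS (S\<lparr>carrier := R\<rparr>) C = A"
    unfolding A_RCOSETS_def RCOSETS_def A_def \<pi>_def a_r_coset_def r_coset_def by auto
  show ?thesis unfolding B_def FactRing_def 1 2 3 4 by simp
qed

lemma art_A: "artinian (B\<lparr>carrier := A\<rparr>)" using gil unfolding sub_quot gilmer_ext_def C_def .

lemma vimage_subring:
  assumes T: "subring T B" shows "subring {s \<in> carrier S. \<pi> s \<in> T} S"
  using subringE[OF T] by (intro subringI) auto

lemma image_subring:
  assumes T: "subring T S" shows "subring (\<pi> ` T) B"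
  by (rule ring_hom_ring.img_is_subring[OF ring_hom_ringI2[OF ring_axioms B.ring_axioms pi_hom] T])

lemma vimage_image:
  assumes "C \<subseteq> T" "T \<subseteq> carrier S" "\<And>x y. x \<in> T \<Longrightarrow> y \<in> T \<Longrightarrow> x \<oplus> y \<in> T"
  shows "{s \<in> carrier S. \<pi> s \<in> \<pi> ` T} = T"
proof (intro equalityI subsetI)
  fix s assume "s \<in> {s \<in> carrier S. \<pi> s \<in> \<pi> ` T}"
  then obtain t where s: "s \<in> carrier S" and t: "t \<in> T" "\<pi> s = \<pi> t" by auto
  have tc: "t \<in> carrier S" using t assms by auto
  have "s \<ominus> t \<in> C" using pi_eq[OF s tc] t by simp
  then have "(s \<ominus> t) \<oplus> t \<in> T" using t assms by auto
  moreover have "(s \<ominus> t) \<oplus> t = s" using s tc by algebra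
  ultimately show "s \<in> T" by simp
qed (use assms in auto)

lemma image_vimage: "T \<subseteq> carrier B \<Longrightarrow> \<pi> ` {s \<in> carrier S. \<pi> s \<in> T} = T"
  using B_carrier by auto

lemma FIP_iff: "FIP S R \<longleftrightarrow> FIP B A"
proof -
  have "bij_betw ((`) \<pi>) {T. subring T S \<and> R \<subseteq> T} {T. subring T B \<and> A \<subseteq> T}"
  proof (rule bij_betw_byWitness[where f' = "\<lambda>T. {s \<in> carrier S. \<pi> s \<in> T}"])
    show "\<forall>T\<in>{T. subring T S \<and> R \<subseteq> T}. {s \<in> carrier S. \<pi> s \<in> \<pi> ` T} = T"
    proof
      fix T assume "T \<in> {T. subring T S \<and> R \<subseteq> T}"
      then have T: "subring T S" "R \<subseteq> T" by auto
      then have "C \<subseteq> T" using C_R by blast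
      then show "{s \<in> carrier S. \<pi> s \<in> \<pi> ` T} = T"
        by (rule vimage_image[OF _ subringE(1,7)[OF T(1)]])
    qed
    show "\<forall>T\<in>{T. subring T B \<and> A \<subseteq> T}. \<pi> ` {s \<in> carrier S. \<pi> s \<in> T} = T"
      using image_vimage subringE(1) by blast
    show "(`) \<pi> ` {T. subring T S \<and> R \<subseteq> T} \<subseteq> {T. subring T B \<and> A \<subseteq> T}"
      using image_subring unfolding A_def by auto
    show "(\<lambda>T. {s \<in> carrier S. \<pi> s \<in> T}) ` {T. subring T B \<and> A \<subseteq> T} \<subseteq> {T. subring T S \<and> R \<subseteq> T}"
      using vimage_subring unfolding A_def by auto
  qed
  then show ?thesis unfolding FIP_def by (rule bij_betw_finite)
qed

lemma vimage_ideal: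
  assumes W: "ideal W B" shows "ideal {s \<in> carrier S. \<pi> s \<in> W} S"
  using B.ideal_facts[OF W] by (intro cring_idealI) auto

lemma vimage_prime:
  assumes P: "primeideal P B" shows "primeideal {s \<in> carrier S. \<pi> s \<in> P} S"
proof (rule primeidealI[OF vimage_ideal[OF primeideal.axioms(1)[OF P]] crS])
  have "\<pi> \<one> \<notin> P"
    using ideal.one_imp_carrier[OF primeideal.axioms(1)[OF P]] primeideal.I_notcarr[OF P] by auto
  then show "carrier S \<noteq> {s \<in> carrier S. \<pi> s \<in> P}" using one_closed by blast
  fix a b assume "a \<in> carrier S" "b \<in> carrier S" "a \<otimes> b \<in> {s \<in> carrier S. \<pi> s \<in> P}"
  then show "a \<in> {s \<in> carrier S. \<pi> s \<in> P} \<or> b \<in> {s \<in> carrier S. \<pi> s \<in> P}"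
    using primeideal.I_prime[OF P, of "\<pi> a" "\<pi> b"] by auto
qed

lemma image_prime:
  assumes Q: "primeideal Q S" and CQ: "C \<subseteq> Q" shows "primeideal (\<pi> ` Q) B"
proof -
  note q = ideal_facts[OF primeideal.axioms(1)[OF Q]]
  have v: "{s \<in> carrier S. \<pi> s \<in> \<pi> ` Q} = Q" by (rule vimage_image[OF CQ q(1) q(3)])
  have inQ: "s \<in> Q" if "s \<in> carrier S" "\<pi> s \<in> \<pi> ` Q" for s using v that by auto
  have id: "ideal (\<pi> ` Q) B"
  proof (rule B.cring_idealI)
    show "\<pi> ` Q \<subseteq> carrier B" using q(1) by auto
    show "\<zero>\<^bsub>B\<^esub> \<in> \<pi> ` Q" using q(2) pi.hom_zero by (metis image_eqI)
    fix x assume "x \<in> \<pi> ` Q"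
    then obtain s where s: "x = \<pi> s" "s \<in> Q" by auto
    have sc: "s \<in> carrier S" using s q(1) by auto
    show "a \<otimes>\<^bsub>B\<^esub> x \<in> \<pi> ` Q" if a: "a \<in> carrier B" for a
    proof -
      obtain t where t: "a = \<pi> t" "t \<in> carrier S" using a B_carrier by auto
      have "a \<otimes>\<^bsub>B\<^esub> x = \<pi> (t \<otimes> s)" using s t sc by simp
      then show ?thesis using q(4)[OF t(2) s(2)] by auto
    qed
    fix y assume "y \<in> \<pi> ` Q"
    then obtain t where t: "y = \<pi> t" "t \<in> Q" by auto
    have "x \<oplus>\<^bsub>B\<^esub> y = \<pi> (s \<oplus> t)" using s t sc q(1) by auto
    then show "x \<oplus>\<^bsub>B\<^esub> y \<in> \<pi> ` Q" using q(3)[OF s(2) t(2)] by auto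
  qed
  show ?thesis
  proof (rule primeidealI[OF id crB])
    have "\<one> \<notin> Q" using ideal.one_imp_carrier[OF primeideal.axioms(1)[OF Q]] primeideal.I_notcarr[OF Q] by auto
    then have "\<pi> \<one> \<notin> \<pi> ` Q" using inQ[of \<one>] by auto
    then show "carrier B \<noteq> \<pi> ` Q" using pi.hom_closed[OF one_closed] by auto
    fix a b assume ab: "a \<in> carrier B" "b \<in> carrier B" "a \<otimes>\<^bsub>B\<^esub> b \<in> \<pi> ` Q"
    obtain s t where st: "a = \<pi> s" "s \<in> carrier S" "b = \<pi> t" "t \<in> carrier S" using ab B_carrier by auto
    then have "s \<otimes> t \<in> Q" using ab inQ[of "s \<otimes> t"] by simp
    then show "a \<in> \<pi> ` Q \<or> b \<in> \<pi> ` Q" using primeideal.I_prime[OF Q st(2,4)] st by auto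
  qed
qed

lemma prime_restrict:
  assumes P: "primeideal P B" shows "primeideal (P \<inter> A) (B\<lparr>carrier := A\<rparr>)"
proof -
  interpret A: cring "B\<lparr>carrier := A\<rparr>" by (rule B.subring_cring[OF A_subring])
  note sA = subringE[OF A_subring]
  note p = B.ideal_facts[OF primeideal.axioms(1)[OF P]]
  have "ideal (P \<inter> A) (B\<lparr>carrier := A\<rparr>)"
    using p sA AB by (intro A.cring_idealI) auto
  then show ?thesis
  proof (rule primeidealI)
    show "cring (B\<lparr>carrier := A\<rparr>)" by (rule A.is_cring)
    have "\<one>\<^bsub>B\<^esub> \<notin> P" using ideal.one_imp_carrier[OF primeideal.axioms(1)[OF P]] primeideal.I_notcarr[OF P] by auto
    then show "carrier (B\<lparr>carrier := A\<rparr>) \<noteq> P \<inter> A" using sA(3) by auto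
    fix a b assume "a \<in> carrier (B\<lparr>carrier := A\<rparr>)" "b \<in> carrier (B\<lparr>carrier := A\<rparr>)" "a \<otimes>\<^bsub>B\<lparr>carrier := A\<rparr>\<^esub> b \<in> P \<inter> A"
    then show "a \<in> P \<inter> A \<or> b \<in> P \<inter> A" using primeideal.I_prime[OF P, of a b] AB by auto
  qed
qed

text \<open>The residue condition only gives fractions: \<open>b s - a\<close> in the prime with
  \<open>b\<close> outside it. Over the Artinian ring \<open>A\<close> the element
  \<open>\<pi> b\<close> has an inverse \<open>\<pi> c\<close> modulo the prime, so
  \<open>r = c a\<close> is a representative in \<open>R\<close> itself.\<close>

lemma residual:
  assumes P: "primeideal P B" and s: "s \<in> carrier S"
  shows "\<exists>r\<in>R. \<pi> (s \<ominus> r) \<in> P"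
proof -
  interpret A: cring "B\<lparr>carrier := A\<rparr>" by (rule B.subring_cring[OF A_subring])
  note sA = subringE[OF A_subring] and p = B.ideal_facts[OF primeideal.axioms(1)[OF P]]
  obtain E where E: "orth_decomp (B\<lparr>carrier := A\<rparr>) E \<one>\<^bsub>B\<^esub>"
    using A.orth_decomp_exists[OF art_A, of "\<one>\<^bsub>B\<^esub>"] sA(1,3) by auto
  obtain e where e: "e \<in> E" "P \<inter> A = idem_rad (B\<lparr>carrier := A\<rparr>) e"
    using A.prime_eq_idem_rad[OF art_A _ prime_restrict[OF P], of E] E by auto
  note pe = orth_decompD(2)[OF E e(1)]
  note e' = prim_idemD(1-3)[OF pe, simplified]
  let ?Q = "{s \<in> carrier S. \<pi> s \<in> P}"
  have "residually_iso S R ?Q" using inf vimage_prime[OF P] unfolding infra_integral_def by auto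
  then obtain a b where ab: "a \<in> R" "b \<in> R" "b \<notin> ?Q" "b \<otimes> s \<ominus> a \<in> ?Q"
    using s unfolding residually_iso_def by blast
  have bA: "\<pi> b \<in> A" using ab unfolding A_def by auto
  have "\<pi> b \<notin> idem_rad (B\<lparr>carrier := A\<rparr>) e" using ab e(2) by auto
  then obtain y where y: "y \<in> A" "\<pi> b \<otimes>\<^bsub>B\<^esub> y \<otimes>\<^bsub>B\<^esub> e = e"
    using A.idem_rad_iff[OF art_A pe, of "\<pi> b"] bA by auto
  obtain c where c: "c \<in> R" "y = \<pi> c" using y unfolding A_def by auto
  have cc: "\<pi> b \<in> carrier B" "y \<in> carrier B" "e \<in> carrier B" "\<one>\<^bsub>B\<^esub> \<in> carrier B" using bA y e' AB by auto
  have "(\<pi> b \<otimes>\<^bsub>B\<^esub> y \<ominus>\<^bsub>B\<^esub> \<one>\<^bsub>B\<^esub>) \<otimes>\<^bsub>B\<^esub> e = \<pi> b \<otimes>\<^bsub>B\<^esub> y \<otimes>\<^bsub>B\<^esub> e \<ominus>\<^bsub>B\<^esub> e"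
    using cc by algebra
  also have "\<dots> = \<zero>\<^bsub>B\<^esub>" unfolding y(2) using cc by (simp add: B.minus_eq B.r_neg)
  finally have z: "(\<pi> b \<otimes>\<^bsub>B\<^esub> y \<ominus>\<^bsub>B\<^esub> \<one>\<^bsub>B\<^esub>) \<otimes>\<^bsub>B\<^esub> e = \<zero>\<^bsub>B\<^esub>" .
  have w: "\<pi> b \<otimes>\<^bsub>B\<^esub> y \<ominus>\<^bsub>B\<^esub> \<one>\<^bsub>B\<^esub> = \<pi> (b \<otimes> c \<ominus> \<one>)" unfolding c(2) using ab c by (simp add: pi_minus)
  have bcA: "\<pi> (b \<otimes> c \<ominus> \<one>) \<in> A" unfolding A_def by (rule imageI) (use ab c in simp)
  have "\<pi> (b \<otimes> c \<ominus> \<one>) [^]\<^bsub>B\<lparr>carrier := A\<rparr>\<^esub> (1::nat) \<otimes>\<^bsub>B\<^esub> e = \<zero>\<^bsub>B\<^esub>"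
    using z unfolding w using AB[OF bcA] by simp
  then have "\<pi> (b \<otimes> c \<ominus> \<one>) \<in> idem_rad (B\<lparr>carrier := A\<rparr>) e"
    unfolding idem_rad_def using bcA by (intro CollectI conjI exI[of _ "1::nat"]) simp_all
  then have m: "\<pi> (b \<otimes> c \<ominus> \<one>) \<in> P" using e(2) by blast
  have bc: "b \<in> carrier S" "c \<in> carrier S" "a \<in> carrier S" using ab c by auto
  have "\<pi> c \<otimes>\<^bsub>B\<^esub> \<pi> (b \<otimes> s \<ominus> a) \<ominus>\<^bsub>B\<^esub> \<pi> s \<otimes>\<^bsub>B\<^esub> \<pi> (b \<otimes> c \<ominus> \<one>) \<in> P"
    using p(4,7) m ab(4) bc s by auto
  moreover have "\<pi> c \<otimes>\<^bsub>B\<^esub> \<pi> (b \<otimes> s \<ominus> a) \<ominus>\<^bsub>B\<^esub> \<pi> s \<otimes>\<^bsub>B\<^esub> \<pi> (b \<otimes> c \<ominus> \<one>) = \<pi> (c \<otimes> (b \<otimes> s \<ominus> a) \<ominus> s \<otimes> (b \<otimes> c \<ominus> \<one>))"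
    using bc s by (simp add: pi_minus)
  moreover have "c \<otimes> (b \<otimes> s \<ominus> a) \<ominus> s \<otimes> (b \<otimes> c \<ominus> \<one>) = s \<ominus> c \<otimes> a"
    using bc s by algebra
  ultimately have "\<pi> (s \<ominus> c \<otimes> a) \<in> P" by simp
  then show ?thesis using ab c by (intro bexI[of _ "c \<otimes> a"]) auto
qed

lemma power_span_sum:
  assumes "s \<in> carrier S" "\<And>i. i < n \<Longrightarrow> c i \<in> R"
  shows "(\<Oplus>i\<in>{..<n}. c i \<otimes> s [^] (i::nat)) \<in> power_span S R s n"
  using assms(2)
proof (induction n)
  case 0
  show ?case by simp
next
  case (Suc n)
  have cc: "c i \<in> carrier S" if "i < Suc n" for i using Suc.prems[OF that] by simp
  have "(\<Oplus>i\<in>insert n {..<n}. c i \<otimes> s [^] i) = c n \<otimes> s [^] n \<oplus> (\<Oplus>i\<in>{..<n}. c i \<otimes> s [^] i)"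
    using cc assms(1) by (intro finsum_insert) auto
  also have "\<dots> = (\<Oplus>i\<in>{..<n}. c i \<otimes> s [^] i) \<oplus> c n \<otimes> s [^] n"
    using cc assms(1) by (intro a_comm finsum_closed) auto
  finally show ?case unfolding lessThan_Suc using power_spanI[OF Suc.IH, of "c n"] Suc.prems by simp
qed

lemma power_span_pi:
  assumes s: "s \<in> carrier S"
  shows "x \<in> power_span S R s n \<Longrightarrow> \<pi> x \<in> power_span B A (\<pi> s) n"
proof (induction n arbitrary: x)
  case (Suc n)
  then obtain v t where vt: "x = v \<oplus> t \<otimes> s [^] n" "v \<in> power_span S R s n" "t \<in> R" by auto
  have vc: "v \<in> carrier S" using vt(2) submodD(1)[OF power_span_submod[OF R R subset_refl s, of n]] by auto
  have "\<pi> x = \<pi> v \<oplus>\<^bsub>B\<^esub> \<pi> t \<otimes>\<^bsub>B\<^esub> \<pi> s [^]\<^bsub>B\<^esub> n" unfolding vt(1) using vc vt(3) s by (simp add: pi_pow)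
  moreover have "\<pi> t \<in> A" using vt(3) unfolding A_def by auto
  ultimately show ?case using power_spanI[OF Suc.IH[OF vt(2)]] by metis
qed simp

lemma integral_B:
  assumes b: "b \<in> carrier B"
  shows "\<exists>n. b [^]\<^bsub>B\<^esub> (n::nat) \<in> power_span B A b n"
proof -
  obtain s where s: "s \<in> carrier S" "b = \<pi> s" using b B_carrier by auto
  obtain n c where c: "\<And>i. i < n \<Longrightarrow> c i \<in> R" "s [^] (n::nat) \<oplus> (\<Oplus>i\<in>{..<n}. c i \<otimes> s [^] i) = \<zero>"
    using inf s(1) unfolding infra_integral_def integral_ext_def by blast
  let ?x = "\<Oplus>i\<in>{..<n}. c i \<otimes> s [^] i"
  have x: "?x \<in> power_span S R s n" using power_span_sum[OF s(1) c(1)] .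
  note sm = power_span_submod[OF R R subset_refl s(1), of n]
  have xc: "?x \<in> carrier S" using x submodD(1)[OF sm] by auto
  have "\<zero> \<ominus> ?x \<in> power_span S R s n" using submod_minus[OF R sm submodD(2)[OF sm] x] .
  moreover have "s [^] n = \<zero> \<ominus> ?x" using c(2) xc s(1) by (metis minus_equality add.inv_closed minus_eq l_zero nat_pow_closed)
  ultimately have "s [^] n \<in> power_span S R s n" by simp
  from power_span_pi[OF s(1) this] show ?thesis unfolding s(2) using s(1) by (auto simp: pi_pow)
qed

text \<open>Shows that adjoining finitely many integral elements reaches all of \<open>B\<close>: a
  subring containing \<open>A\<close> and the images of the generators contains the image of every
  polynomial value.\<close>

lemma generated:
  "\<exists>ss. set ss \<subseteq> carrier B \<and> (\<forall>T. subring T B \<longrightarrow> A \<subseteq> T \<longrightarrow> set ss \<subseteq> T \<longrightarrow> T = carrier B)"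
proof -
  obtain n s where s: "\<And>i. i < (n::nat) \<Longrightarrow> s i \<in> carrier S"
    and gen: "\<And>x. x \<in> carrier S \<Longrightarrow> \<exists>p\<in>mpolys S R n. mp_eval S n s p = x"
    using et unfolding etale_def unramified_def finite_type_def by blast
  let ?ss = "map (\<lambda>i. \<pi> (s i)) [0..<n]"
  have "T = carrier B" if T: "subring T B" "A \<subseteq> T" "set ?ss \<subseteq> T" for T
  proof
    show "T \<subseteq> carrier B" using subringE(1)[OF T(1)] .
    define U where "U = {s \<in> carrier S. \<pi> s \<in> T}"
    have U: "subring U S" unfolding U_def by (rule vimage_subring[OF T(1)])
    note sU = subringE[OF U]
    have RU: "R \<subseteq> U" unfolding U_def using T(2) unfolding A_def by auto
    have sU': "s i \<in> U" if "i < n" for i unfolding U_def using s[OF that] T(3) that by auto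
    have pw: "x [^] (k::nat) \<in> U" if "x \<in> U" for x k using that sU by (induction k) auto
    have pr: "(\<Otimes>i\<in>{..<k}. s i [^] (m i :: nat)) \<in> U" if "k \<le> n" for k m
      using that
    proof (induction k)
      case 0
      show ?case using sU(3) by simp
    next
      case (Suc k)
      have "(\<Otimes>i\<in>insert k {..<k}. s i [^] m i) = s k [^] m k \<otimes> (\<Otimes>i\<in>{..<k}. s i [^] m i)"
        using s Suc.prems by (intro finprod_insert) auto
      then show ?case unfolding lessThan_Suc using Suc pw[OF sU'] sU(6) by simp
    qed
    have "x \<in> U" if x: "x \<in> carrier S" for x
    proof -
      obtain p where p: "p \<in> mpolys S R n" "mp_eval S n s p = x" using gen[OF x] by auto
      have "mp_eval S n s p \<in> U" unfolding mp_eval_def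
      proof (rule finsum_closed_set)
        show "finite {m. p m \<noteq> \<zero>}" using p unfolding mpolys_def by auto
        show "p m \<otimes> (\<Otimes>i\<in>{..<n}. s i [^] m i) \<in> U" for m
          using sU(6) pr[of n m] p(1) RU unfolding mpolys_def by auto
      qed (use sU in auto)
      then show ?thesis using p by simp
    qed
    then show "carrier B \<subseteq> T" unfolding U_def B_carrier by auto
  qed
  moreover have "set ?ss \<subseteq> carrier B" using s by auto
  ultimately show ?thesis by blast
qed

lemma dcc_B: "dcc B A (carrier B)"
proof -
  obtain ss where ss: "set ss \<subseteq> carrier B" "\<And>T. subring T B \<Longrightarrow> A \<subseteq> T \<Longrightarrow> set ss \<subseteq> T \<Longrightarrow> T = carrier B"
    using generated by blast
  obtain T where "subring T B" "A \<subseteq> T" "set ss \<subseteq> T" "dcc B A T"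
    using B.integral_list_dcc[OF A_subring B.artinian_dcc[OF A_subring art_A] integral_B ss(1)] by blast
  then show ?thesis using ss(2) by metis
qed

text \<open>The assumptions are carried from \<open>S\<close> to \<open>B\<close> through inverse
  images of ideals and primes. A zero product in \<open>B\<close> lifts only to an element of the
  conductor, which is the reason for the form of \<open>flat_torsion\<close>.\<close>

lemma art_ext_exists: "\<exists>E F. art_ext B A E F"
proof -
  interpret A: cring "B\<lparr>carrier := A\<rparr>" by (rule B.subring_cring[OF A_subring])
  obtain E where E: "orth_decomp (B\<lparr>carrier := A\<rparr>) E \<one>\<^bsub>B\<^esub>"
    using A.orth_decomp_exists[OF art_A, of "\<one>\<^bsub>B\<^esub>"] subringE(1,3)[OF A_subring] by auto
  have "artinian (B\<lparr>carrier := carrier B\<rparr>)"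
    using B.dcc_artinian[OF dcc_B B.carrier_is_subring] AB by blast
  then obtain F where F: "orth_decomp B F \<one>\<^bsub>B\<^esub>"
    using B.orth_decomp_exists[of "\<one>\<^bsub>B\<^esub>"] by auto
  have "art_ext B A E F"
  proof (intro art_ext.intro art_ext_axioms.intro)
    show "cring B" by (rule crB)
    show "subring A B" by (rule A_subring)
    show "dcc B A (carrier B)" by (rule dcc_B)
    show "\<exists>a\<in>A. s \<ominus>\<^bsub>B\<^esub> a \<in> Q" if Q: "primeideal Q B" and s: "s \<in> carrier B" for Q s
    proof -
      obtain t where t: "t \<in> carrier S" "s = \<pi> t" using s B_carrier by auto
      obtain r where r: "r \<in> R" "\<pi> (t \<ominus> r) \<in> Q" using residual[OF Q t(1)] by auto
      then have "s \<ominus>\<^bsub>B\<^esub> \<pi> r \<in> Q" unfolding t(2) using t(1) by (simp add: pi_minus)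
      then show ?thesis using r unfolding A_def by blast
    qed
    show "Q \<subseteq> W" if Q: "primeideal Q B" and W: "ideal W B" "Q \<inter> A \<subseteq> W"
      and QQ: "\<And>x y. x \<in> Q \<Longrightarrow> y \<in> Q \<Longrightarrow> x \<otimes>\<^bsub>B\<^esub> y \<in> W" for Q W
    proof -
      have "{s \<in> carrier S. \<pi> s \<in> Q} \<subseteq> {s \<in> carrier S. \<pi> s \<in> W}"
      proof (rule unramified_prime[OF crS R _ vimage_prime[OF Q] _ vimage_ideal[OF W(1)]])
        show "kaehler_zero S R" using et unfolding etale_def unramified_def by auto
        show "\<exists>r\<in>R. s \<ominus> r \<in> {s \<in> carrier S. \<pi> s \<in> Q}" if "s \<in> carrier S" for s
          using residual[OF Q that] that by auto
        show "{s \<in> carrier S. \<pi> s \<in> Q} \<inter> R \<subseteq> {s \<in> carrier S. \<pi> s \<in> W}" using W(2) unfolding A_def by auto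
        show "x \<otimes> y \<in> {s \<in> carrier S. \<pi> s \<in> W}"
          if "x \<in> {s \<in> carrier S. \<pi> s \<in> Q}" "y \<in> {s \<in> carrier S. \<pi> s \<in> Q}" for x y
          using that QQ by auto
      qed
      then have "\<pi> ` {s \<in> carrier S. \<pi> s \<in> Q} \<subseteq> \<pi> ` {s \<in> carrier S. \<pi> s \<in> W}" by blast
      then show ?thesis
        using image_vimage B.ideal_facts(1)[OF primeideal.axioms(1)[OF Q]] B.ideal_facts(1)[OF W(1)] by simp
    qed
    show "\<exists>v\<in>A. v \<notin> Q \<and> v \<otimes>\<^bsub>B\<^esub> a = \<zero>\<^bsub>B\<^esub>"
      if Q: "primeideal Q B" "primeideal Q' B" "Q \<noteq> Q'" "Q \<inter> A = Q' \<inter> A"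
        and a: "a \<in> A" and f: "f \<in> carrier B" "f \<notin> Q" "a \<otimes>\<^bsub>B\<^esub> f = \<zero>\<^bsub>B\<^esub>" for Q Q' a f
    proof -
      let ?v = "\<lambda>Q. {s \<in> carrier S. \<pi> s \<in> Q}"
      obtain r t where r: "r \<in> R" "a = \<pi> r" and t: "t \<in> carrier S" "f = \<pi> t" using a f B_carrier unfolding A_def by auto
      have ne: "?v Q \<noteq> ?v Q'"
        using Q(3) image_vimage B.ideal_facts(1)[OF primeideal.axioms(1)[OF Q(1)]] B.ideal_facts(1)[OF primeideal.axioms(1)[OF Q(2)]] by metis
      have eq: "?v Q \<inter> R = ?v Q' \<inter> R" using Q(4) unfolding A_def by blast
      have "\<pi> (r \<otimes> t) = \<zero>\<^bsub>B\<^esub>" using f(3) r t by simp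
      then have "r \<otimes> t \<in> conductor S R" using pi_zero_iff[of "r \<otimes> t"] r t unfolding C_def by simp
      moreover have "flat_ext S R" using et unfolding etale_def by simp
      ultimately obtain v where v: "v \<in> R" "v \<notin> ?v Q" "v \<otimes> r = \<zero>"
        using flat_torsion[OF crS R _ vimage_prime[OF Q(1)] vimage_prime[OF Q(2)] ne eq r(1) t(1)] f(2) t by auto
      have "\<pi> v \<otimes>\<^bsub>B\<^esub> a = \<pi> (v \<otimes> r)" using v(1) r by simp
      also have "\<dots> = \<zero>\<^bsub>B\<^esub>" unfolding v(3) by simp
      finally show ?thesis using v unfolding A_def by auto
    qed
    show "a = \<zero>\<^bsub>B\<^esub>" if a: "a \<in> A" "\<And>b. b \<in> carrier B \<Longrightarrow> a \<otimes>\<^bsub>B\<^esub> b \<in> A" for a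
    proof -
      obtain r where r: "r \<in> R" "a = \<pi> r" using a unfolding A_def by auto
      have "r \<otimes> s \<in> R" if s: "s \<in> carrier S" for s
      proof -
        have "\<pi> (r \<otimes> s) \<in> A" using a(2)[of "\<pi> s"] r s by simp
        then show ?thesis using pi_A[of "r \<otimes> s"] r s by simp
      qed
      then have "r \<in> C" unfolding C_def conductor_def using r by auto
      then show ?thesis using pi_zero_iff[of r] r by simp
    qed
    show "orth_decomp (B\<lparr>carrier := A\<rparr>) E \<one>\<^bsub>B\<^esub>" by (rule E)
    show "orth_decomp B F \<one>\<^bsub>B\<^esub>" by (rule F)
  qed
  then show ?thesis by blast
qed

end


section \<open>The localization at a supporting prime\<close>

text \<open>\<open>L\<close> is not assumed to be a ring. It is an image of the ring
  \<open>D\<close> under a map respecting the operations, so its ring axioms are inherited and need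
  not be checked on classes of fractions; with \<open>M\<close> mapping to nonunits and its
  complement to units, \<open>L\<close> is local.\<close>

locale local_image = D: cring D for D (structure) +
  fixes L :: "('c, 'd) ring_scheme" and \<theta> :: "'a \<Rightarrow> 'c" and M :: "'a set"
  assumes surj: "carrier L = \<theta> ` carrier D"
    and mult: "\<And>a b. a \<in> carrier D \<Longrightarrow> b \<in> carrier D \<Longrightarrow> \<theta> (a \<otimes> b) = \<theta> a \<otimes>\<^bsub>L\<^esub> \<theta> b"
    and add: "\<And>a b. a \<in> carrier D \<Longrightarrow> b \<in> carrier D \<Longrightarrow> \<theta> (a \<oplus> b) = \<theta> a \<oplus>\<^bsub>L\<^esub> \<theta> b"
    and one: "\<theta> \<one> = \<one>\<^bsub>L\<^esub>" and zero: "\<theta> \<zero> = \<zero>\<^bsub>L\<^esub>"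
    and M: "ideal M D"
    and unit: "\<And>a. a \<in> carrier D \<Longrightarrow> a \<notin> M \<Longrightarrow> \<exists>b\<in>carrier D. \<theta> (a \<otimes> b) = \<one>\<^bsub>L\<^esub>"
    and nonunit: "\<And>a b. a \<in> M \<Longrightarrow> b \<in> carrier D \<Longrightarrow> \<theta> (a \<otimes> b) \<noteq> \<one>\<^bsub>L\<^esub>"
begin

lemma theta_closed[simp]: "a \<in> carrier D \<Longrightarrow> \<theta> a \<in> carrier L" using surj by auto

lemma thetaE: assumes "x \<in> carrier L" obtains a where "a \<in> carrier D" "x = \<theta> a" using assms surj by auto

lemma L_cring: "cring L"
proof (rule cringI)
  show "abelian_group L"
  proof (rule abelian_groupI)
    show "x \<oplus>\<^bsub>L\<^esub> y \<in> carrier L" if "x \<in> carrier L" "y \<in> carrier L" for x y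
      using that by (elim thetaE) (simp add: add[symmetric])
    show "\<zero>\<^bsub>L\<^esub> \<in> carrier L" unfolding zero[symmetric] by simp
    show "x \<oplus>\<^bsub>L\<^esub> y \<oplus>\<^bsub>L\<^esub> z = x \<oplus>\<^bsub>L\<^esub> (y \<oplus>\<^bsub>L\<^esub> z)" if "x \<in> carrier L" "y \<in> carrier L" "z \<in> carrier L" for x y z
      using that by (elim thetaE) (simp add: add[symmetric] D.a_assoc)
    show "x \<oplus>\<^bsub>L\<^esub> y = y \<oplus>\<^bsub>L\<^esub> x" if "x \<in> carrier L" "y \<in> carrier L" for x y
      using that by (elim thetaE) (simp add: add[symmetric] D.a_comm)
    show "\<zero>\<^bsub>L\<^esub> \<oplus>\<^bsub>L\<^esub> x = x" if "x \<in> carrier L" for x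
      using that by (elim thetaE) (simp add: add[symmetric] zero[symmetric])
    show "\<exists>y\<in>carrier L. y \<oplus>\<^bsub>L\<^esub> x = \<zero>\<^bsub>L\<^esub>" if "x \<in> carrier L" for x
    proof -
      obtain a where a: "a \<in> carrier D" "x = \<theta> a" using \<open>x \<in> carrier L\<close> by (rule thetaE)
      then have "\<theta> (\<ominus> a) \<oplus>\<^bsub>L\<^esub> x = \<zero>\<^bsub>L\<^esub>" by (simp add: add[symmetric] zero[symmetric] D.l_neg)
      then show ?thesis using a by (intro bexI[of _ "\<theta> (\<ominus> a)"]) auto
    qed
  qed
  show "comm_monoid L"
  proof (rule comm_monoidI)
    show "x \<otimes>\<^bsub>L\<^esub> y \<in> carrier L" if "x \<in> carrier L" "y \<in> carrier L" for x y
      using that by (elim thetaE) (simp add: mult[symmetric])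
    show "\<one>\<^bsub>L\<^esub> \<in> carrier L" unfolding one[symmetric] by simp
    show "x \<otimes>\<^bsub>L\<^esub> y \<otimes>\<^bsub>L\<^esub> z = x \<otimes>\<^bsub>L\<^esub> (y \<otimes>\<^bsub>L\<^esub> z)" if "x \<in> carrier L" "y \<in> carrier L" "z \<in> carrier L" for x y z
      using that by (elim thetaE) (simp add: mult[symmetric] D.m_assoc)
    show "x \<otimes>\<^bsub>L\<^esub> y = y \<otimes>\<^bsub>L\<^esub> x" if "x \<in> carrier L" "y \<in> carrier L" for x y
      using that by (elim thetaE) (simp add: mult[symmetric] D.m_comm)
    show "\<one>\<^bsub>L\<^esub> \<otimes>\<^bsub>L\<^esub> x = x" if "x \<in> carrier L" for x
      using that by (elim thetaE) (simp add: mult[symmetric] one[symmetric])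
  qed
  show "(x \<oplus>\<^bsub>L\<^esub> y) \<otimes>\<^bsub>L\<^esub> z = x \<otimes>\<^bsub>L\<^esub> z \<oplus>\<^bsub>L\<^esub> y \<otimes>\<^bsub>L\<^esub> z" if "x \<in> carrier L" "y \<in> carrier L" "z \<in> carrier L" for x y z
    using that by (elim thetaE) (simp add: mult[symmetric] add[symmetric] D.l_distr)
qed

sublocale L: cring L by (rule L_cring)

lemmas m = D.ideal_facts[OF M]

lemma M_nonunit: "a \<in> M \<Longrightarrow> \<theta> a \<notin> Units L"
proof
  assume a: "a \<in> M" and u: "\<theta> a \<in> Units L"
  have ac: "a \<in> carrier D" using a m(1) by auto
  obtain y where y: "y \<in> carrier L" "\<theta> a \<otimes>\<^bsub>L\<^esub> y = \<one>\<^bsub>L\<^esub>" using u L.Units_r_inv_ex by auto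
  obtain b where b: "b \<in> carrier D" "y = \<theta> b" using y(1) by (rule thetaE)
  then show False using y nonunit[OF a b(1)] mult[OF ac b(1)] by simp
qed

lemma unit_theta: "a \<in> carrier D \<Longrightarrow> a \<notin> M \<Longrightarrow> \<theta> a \<in> Units L"
proof -
  assume a: "a \<in> carrier D" "a \<notin> M"
  obtain b where b: "b \<in> carrier D" "\<theta> (a \<otimes> b) = \<one>\<^bsub>L\<^esub>" using unit[OF a] by auto
  then have "\<theta> a \<otimes>\<^bsub>L\<^esub> \<theta> b = \<one>\<^bsub>L\<^esub>" "\<theta> b \<otimes>\<^bsub>L\<^esub> \<theta> a = \<one>\<^bsub>L\<^esub>"
    using mult[OF a(1) b(1)] L.m_comm[of "\<theta> a" "\<theta> b"] a(1) by auto
  then show ?thesis using a(1) b(1) unfolding Units_def by auto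
qed

lemma field_L:
  assumes "\<And>a. a \<in> M \<Longrightarrow> \<theta> a = \<zero>\<^bsub>L\<^esub>" shows "field L"
proof (rule L.cring_fieldI, intro equalityI subsetI)
  fix x assume x: "x \<in> Units L"
  moreover have "\<zero>\<^bsub>L\<^esub> \<notin> Units L" using M_nonunit[OF m(2)] zero by simp
  ultimately show "x \<in> carrier L - {\<zero>\<^bsub>L\<^esub>}" by auto
next
  fix x assume x: "x \<in> carrier L - {\<zero>\<^bsub>L\<^esub>}"
  then obtain a where a: "a \<in> carrier D" "x = \<theta> a" by (auto elim: thetaE)
  then show "x \<in> Units L" using unit_theta[OF a(1)] assms x by auto
qed

lemma N_ideal: "ideal (\<theta> ` M) L"
proof (rule L.cring_idealI)
  show "\<theta> ` M \<subseteq> carrier L" using m(1) by auto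
  show "\<zero>\<^bsub>L\<^esub> \<in> \<theta> ` M" using m(2) zero by force
  fix x assume "x \<in> \<theta> ` M"
  then obtain a where a: "a \<in> M" "x = \<theta> a" by auto
  have ac: "a \<in> carrier D" using a m(1) by auto
  show "c \<otimes>\<^bsub>L\<^esub> x \<in> \<theta> ` M" if "c \<in> carrier L" for c
  proof -
    obtain b where b: "b \<in> carrier D" "c = \<theta> b" using \<open>c \<in> carrier L\<close> by (rule thetaE)
    then show ?thesis using a m(4)[OF b(1) a(1)] mult[OF b(1) ac] by force
  qed
  fix y assume "y \<in> \<theta> ` M"
  then obtain b where b: "b \<in> M" "y = \<theta> b" by auto
  have bc: "b \<in> carrier D" using b m(1) by auto
  show "x \<oplus>\<^bsub>L\<^esub> y \<in> \<theta> ` M" using a b m(3)[OF a(1) b(1)] add[OF ac bc] by force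
qed

lemma unit_in_ideal: "ideal I L \<Longrightarrow> x \<in> I \<Longrightarrow> x \<in> Units L \<Longrightarrow> I = carrier L"
  using L.ideal_facts(1,5)[of I] ideal.one_imp_carrier[of I L] L.Units_r_inv_ex[of x] by metis

lemma N_maximal: "maximalideal I L \<longleftrightarrow> I = \<theta> ` M"
proof
  have oneN: "\<one>\<^bsub>L\<^esub> \<notin> \<theta> ` M" using M_nonunit L.Units_one_closed by (metis imageE)
  assume "maximalideal I L"
  then interpret I: maximalideal I L .
  have "I \<subseteq> \<theta> ` M"
  proof
    fix x assume x: "x \<in> I"
    then obtain a where a: "a \<in> carrier D" "x = \<theta> a" using I.a_subset by (auto elim: thetaE)
    then show "x \<in> \<theta> ` M" using unit_in_ideal[OF I.ideal_axioms x] unit_theta[OF a(1)] I.I_notcarr by auto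
  qed
  moreover have "\<theta> ` M \<subseteq> carrier L" using m(1) by auto
  ultimately have "\<theta> ` M = I \<or> \<theta> ` M = carrier L" by (rule I.I_maximal[OF N_ideal])
  then show "I = \<theta> ` M" using oneN by auto
next
  assume I: "I = \<theta> ` M"
  show "maximalideal I L" unfolding I
  proof (rule maximalidealI[OF N_ideal])
    show "carrier L \<noteq> \<theta> ` M" using M_nonunit L.one_closed L.Units_one_closed by (metis imageE)
    fix J assume J: "ideal J L" "\<theta> ` M \<subseteq> J" "J \<subseteq> carrier L"
    show "J = \<theta> ` M \<or> J = carrier L"
    proof (cases "J \<subseteq> \<theta> ` M")
      case False
      then obtain x where x: "x \<in> J" "x \<notin> \<theta> ` M" by auto
      then have "x \<in> carrier L" using J(3) by auto
      then obtain a where a: "a \<in> carrier D" "x = \<theta> a" by (rule thetaE)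
      then show ?thesis using unit_in_ideal[OF J(1) x(1)] unit_theta[OF a(1)] x by auto
    qed (use J in auto)
  qed
qed

lemma SPIR_L:
  assumes x: "x \<in> M" "\<theta> x \<noteq> \<zero>\<^bsub>L\<^esub>" and nil: "\<theta> (x [^] (n::nat)) = \<zero>\<^bsub>L\<^esub>"
    and gen: "\<And>y. y \<in> M \<Longrightarrow> \<exists>z\<in>carrier D. \<theta> y = \<theta> (x \<otimes> z)"
  shows "SPIR L"
proof -
  have xc: "x \<in> carrier D" using x m(1) by auto
  have N: "\<theta> ` M = PIdl\<^bsub>L\<^esub> (\<theta> x)"
  proof (intro equalityI subsetI)
    fix y assume "y \<in> \<theta> ` M"
    then obtain a where a: "a \<in> M" "y = \<theta> a" by auto
    obtain z where z: "z \<in> carrier D" "\<theta> a = \<theta> (x \<otimes> z)" using gen[OF a(1)] by auto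
    have "y = \<theta> z \<otimes>\<^bsub>L\<^esub> \<theta> x" using a z mult[OF z(1) xc] D.m_comm[OF z(1) xc] by simp
    then show "y \<in> PIdl\<^bsub>L\<^esub> (\<theta> x)" using z unfolding cgenideal_def by auto
  next
    fix y assume "y \<in> PIdl\<^bsub>L\<^esub> (\<theta> x)"
    then obtain w where "w \<in> carrier L" "y = w \<otimes>\<^bsub>L\<^esub> \<theta> x" unfolding cgenideal_def by auto
    then show "y \<in> \<theta> ` M" using L.ideal_facts(4)[OF N_ideal] x by auto
  qed
  have pr: "principalideal (\<theta> ` M) L"
    using N_ideal unfolding N using L.cgenideal_eq_genideal[of "\<theta> x"] xc by (intro principalidealI) auto
  have pw: "\<theta> (x [^] k) = \<theta> x [^]\<^bsub>L\<^esub> k" for k :: nat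
    by (induction k) (auto simp: one mult xc)
  \<comment> \<open>One inclusion is enough: the \<open>n\<close>-th power lies in the ideal
    generated by a zero element, and every ideal contains zero.\<close>
  have sub: "ideal_pow L (\<theta> ` M) k \<subseteq> PIdl\<^bsub>L\<^esub> (\<theta> x [^]\<^bsub>L\<^esub> k)" for k
  proof (induction k)
    case 0
    show ?case unfolding cgenideal_def by (auto intro!: exI)
  next
    case (Suc k)
    have c: "\<theta> x [^]\<^bsub>L\<^esub> Suc k \<in> carrier L" "\<theta> x \<in> carrier L" using xc by auto
    note p = L.ideal_facts[OF L.cgenideal_ideal[OF c(1)]]
    show ?case
    proof
      fix y assume "y \<in> ideal_pow L (\<theta> ` M) (Suc k)"
      then have "y \<in> ideal_prod L (\<theta> ` M) (ideal_pow L (\<theta> ` M) k)" by simp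
      then show "y \<in> PIdl\<^bsub>L\<^esub> (\<theta> x [^]\<^bsub>L\<^esub> Suc k)"
      proof (induction y rule: ideal_prod.induct)
        case (prod i j)
        obtain u where u: "u \<in> carrier L" "i = u \<otimes>\<^bsub>L\<^esub> \<theta> x" using prod(1) unfolding N cgenideal_def by auto
        obtain v where v: "v \<in> carrier L" "j = v \<otimes>\<^bsub>L\<^esub> \<theta> x [^]\<^bsub>L\<^esub> k" using prod(2) Suc unfolding cgenideal_def by auto
        have "i \<otimes>\<^bsub>L\<^esub> j = (u \<otimes>\<^bsub>L\<^esub> v) \<otimes>\<^bsub>L\<^esub> \<theta> x [^]\<^bsub>L\<^esub> Suc k" unfolding u(2) v(2) using u(1) v(1) c by (simp add: L.m_ac)
        then show ?case using u(1) v(1) unfolding cgenideal_def by blast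
      next
        case (sum s1 s2)
        then show ?case using p(3) by blast
      qed
    qed
  qed
  have "ideal_pow L (\<theta> ` M) n \<subseteq> {\<zero>\<^bsub>L\<^esub>}" using sub[of n] nil unfolding pw cgenideal_def by auto
  moreover have "\<zero>\<^bsub>L\<^esub> \<in> ideal_pow L (\<theta> ` M) n" using L.ideal_facts(2)[OF L.ideal_pow_ideal[OF N_ideal]] .
  ultimately have "ideal_pow L (\<theta> ` M) n = {\<zero>\<^bsub>L\<^esub>}" by auto
  moreover have "\<not> field L"
  proof
    assume "field L"
    then have "\<theta> x \<in> Units L" using field.field_Units[of L] x xc by auto
    then show False using M_nonunit[OF x(1)] by simp
  qed
  ultimately show ?thesis unfolding SPIR_def N_maximal using L_cring pr by auto
qed

end

section \<open>Primes of the support and the primes of \<open>S\<close> above them\<close>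

context etale_gilmer
begin

text \<open>A \<open>c\<close> in \<open>C\<close> outside \<open>M\<close> would be a denominator
  bringing every \<open>s\<close> into \<open>R\<close>.\<close>

lemma supp_prime:
  assumes "M \<in> supp S R"
  shows "primeideal M (S\<lparr>carrier := R\<rparr>)" "C \<subseteq> M"
proof -
  show "primeideal M (S\<lparr>carrier := R\<rparr>)" using assms unfolding supp_def by auto
  obtain s where s: "s \<in> carrier S" "\<And>t. t \<in> R - M \<Longrightarrow> t \<otimes> s \<notin> R" using assms unfolding supp_def by auto
  show "C \<subseteq> M"
  proof
    fix c assume c: "c \<in> C"
    then have "c \<otimes> s \<in> R" using s unfolding C_def conductor_def by auto
    then show "c \<in> M" using s(2)[of c] C_R[OF c] by auto
  qed
qed

lemma image_prime_R:
  assumes M: "primeideal M (S\<lparr>carrier := R\<rparr>)" "C \<subseteq> M"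
  shows "primeideal (\<pi> ` M) (B\<lparr>carrier := A\<rparr>)" "\<And>r. r \<in> R \<Longrightarrow> \<pi> r \<in> \<pi> ` M \<longleftrightarrow> r \<in> M"
proof -
  interpret A: cring "B\<lparr>carrier := A\<rparr>" by (rule B.subring_cring[OF A_subring])
  interpret R: cring "S\<lparr>carrier := R\<rparr>" by (rule crR)
  note m = R.ideal_facts(1-5)[OF primeideal.axioms(1)[OF M(1)], simplified]
  have MS: "M \<subseteq> carrier S" using m(1) by auto
  show inM: "\<pi> r \<in> \<pi> ` M \<longleftrightarrow> r \<in> M" if "r \<in> R" for r
    using vimage_image[OF M(2) MS m(3)] that by auto
  have "ideal (\<pi> ` M) (B\<lparr>carrier := A\<rparr>)"
  proof (rule A.cring_idealI)
    show "\<pi> ` M \<subseteq> carrier (B\<lparr>carrier := A\<rparr>)" using m(1) unfolding A_def by auto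
    show "\<zero>\<^bsub>B\<lparr>carrier := A\<rparr>\<^esub> \<in> \<pi> ` M" using imageI[OF m(2), of \<pi>] by simp
    fix x assume "x \<in> \<pi> ` M"
    then obtain s where s: "x = \<pi> s" "s \<in> M" by auto
    have sc: "s \<in> R" using s m(1) by auto
    show "a \<otimes>\<^bsub>B\<lparr>carrier := A\<rparr>\<^esub> x \<in> \<pi> ` M" if a: "a \<in> carrier (B\<lparr>carrier := A\<rparr>)" for a
    proof -
      obtain t where t: "a = \<pi> t" "t \<in> R" using a unfolding A_def by auto
      have "a \<otimes>\<^bsub>B\<^esub> x = \<pi> (t \<otimes> s)" using s t sc by simp
      then show ?thesis using m(4)[OF t(2) s(2)] by auto
    qed
    fix y assume "y \<in> \<pi> ` M"
    then obtain t where t: "y = \<pi> t" "t \<in> M" by auto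
    have "x \<oplus>\<^bsub>B\<^esub> y = \<pi> (s \<oplus> t)" using s t sc m(1) by auto
    then show "x \<oplus>\<^bsub>B\<lparr>carrier := A\<rparr>\<^esub> y \<in> \<pi> ` M" using m(3)[OF s(2) t(2)] by auto
  qed
  then show "primeideal (\<pi> ` M) (B\<lparr>carrier := A\<rparr>)"
  proof (rule primeidealI)
    show "cring (B\<lparr>carrier := A\<rparr>)" by (rule A.is_cring)
    have "\<one> \<notin> M"
      using ideal.one_imp_carrier[OF primeideal.axioms(1)[OF M(1)]] primeideal.I_notcarr[OF M(1)] by auto
    then have "\<pi> \<one> \<notin> \<pi> ` M" using inM[OF R_closed(2)] by blast
    moreover have "\<pi> \<one> \<in> carrier (B\<lparr>carrier := A\<rparr>)" unfolding A_def using imageI[OF R_closed(2), of \<pi>] by simp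
    ultimately show "carrier (B\<lparr>carrier := A\<rparr>) \<noteq> \<pi> ` M" by blast
    fix a b assume "a \<in> carrier (B\<lparr>carrier := A\<rparr>)" "b \<in> carrier (B\<lparr>carrier := A\<rparr>)" "a \<otimes>\<^bsub>B\<lparr>carrier := A\<rparr>\<^esub> b \<in> \<pi> ` M"
    then obtain s t where st: "a = \<pi> s" "b = \<pi> t" "s \<in> R" "t \<in> R" "\<pi> s \<otimes>\<^bsub>B\<^esub> \<pi> t \<in> \<pi> ` M" unfolding A_def by auto
    then have "s \<otimes> t \<in> M" using inM[of "s \<otimes> t"] by simp
    then show "a \<in> \<pi> ` M \<or> b \<in> \<pi> ` M" using primeideal.I_prime[OF M(1), of s t] st by auto
  qed
qed

lemma vimage_Int_R:
  assumes "P \<inter> A = \<pi> ` M" "\<And>r. r \<in> R \<Longrightarrow> \<pi> r \<in> \<pi> ` M \<longleftrightarrow> r \<in> M" "M \<subseteq> R"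
  shows "{s \<in> carrier S. \<pi> s \<in> P} \<inter> R = M"
proof (intro equalityI subsetI)
  fix r assume r: "r \<in> {s \<in> carrier S. \<pi> s \<in> P} \<inter> R"
  then have "\<pi> r \<in> P \<inter> A" unfolding A_def by auto
  then show "r \<in> M" using assms r by auto
next
  fix r assume r: "r \<in> M"
  then have "\<pi> r \<in> P" using assms(1) by auto
  then show "r \<in> {s \<in> carrier S. \<pi> s \<in> P} \<inter> R" using r assms(3) by auto
qed

lemma primes_over_bij:
  assumes M: "primeideal M (S\<lparr>carrier := R\<rparr>)" "C \<subseteq> M"
  shows "card {Q. primeideal Q S \<and> Q \<inter> R = M} = card {P. primeideal P B \<and> P \<inter> A = \<pi> ` M}"
proof (rule bij_betw_same_card)
  interpret R: cring "S\<lparr>carrier := R\<rparr>" by (rule crR)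
  have MR: "M \<subseteq> R" using R.ideal_facts(1)[OF primeideal.axioms(1)[OF M(1)]] by simp
  note inM = image_prime_R(2)[OF M]
  show "bij_betw ((`) \<pi>) {Q. primeideal Q S \<and> Q \<inter> R = M} {P. primeideal P B \<and> P \<inter> A = \<pi> ` M}"
  proof (rule bij_betw_byWitness[where f' = "\<lambda>P. {s \<in> carrier S. \<pi> s \<in> P}"])
    have v: "{s \<in> carrier S. \<pi> s \<in> \<pi> ` Q} = Q" if Q: "primeideal Q S" "Q \<inter> R = M" for Q
      using Q M(2) ideal_facts(1,3)[OF primeideal.axioms(1)[OF Q(1)]] by (intro vimage_image) auto
    then show "\<forall>Q\<in>{Q. primeideal Q S \<and> Q \<inter> R = M}. {s \<in> carrier S. \<pi> s \<in> \<pi> ` Q} = Q" by auto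
    show "\<forall>P\<in>{P. primeideal P B \<and> P \<inter> A = \<pi> ` M}. \<pi> ` {s \<in> carrier S. \<pi> s \<in> P} = P"
      using image_vimage B.ideal_facts(1)[OF primeideal.axioms(1)] by auto
    show "(`) \<pi> ` {Q. primeideal Q S \<and> Q \<inter> R = M} \<subseteq> {P. primeideal P B \<and> P \<inter> A = \<pi> ` M}"
    proof clarify
      fix Q assume Q: "primeideal Q S" "M = Q \<inter> R"
      have "\<pi> ` Q \<inter> A = \<pi> ` (Q \<inter> R)"
      proof (intro equalityI subsetI)
        fix x assume x: "x \<in> \<pi> ` Q \<inter> A"
        then obtain r where r: "r \<in> R" "x = \<pi> r" unfolding A_def by auto
        then have "r \<in> Q" using v[OF Q(1)] Q(2) x by auto
        then show "x \<in> \<pi> ` (Q \<inter> R)" using r by auto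
      qed (auto simp: A_def)
      then show "primeideal (\<pi> ` Q) B \<and> \<pi> ` Q \<inter> A = \<pi> ` (Q \<inter> R)"
        using image_prime[OF Q(1)] Q(2) M(2) by auto
    qed
    show "(\<lambda>P. {s \<in> carrier S. \<pi> s \<in> P}) ` {P. primeideal P B \<and> P \<inter> A = \<pi> ` M} \<subseteq> {Q. primeideal Q S \<and> Q \<inter> R = M}"
      using vimage_prime vimage_Int_R[OF _ inM MR] by auto
  qed
qed

end

section \<open>Identification of the localization with \<open>Ae\<close>\<close>

locale etale_prime = etale_gilmer + X: art_ext B A E F for E F +
  fixes M e
  assumes M: "primeideal M (S\<lparr>carrier := R\<rparr>)" "C \<subseteq> M" and e: "e \<in> E" and Me: "\<pi> ` M = X.M e"
begin

definition U where "U = R - M"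
text \<open>The fraction \<open>r/1\<close>. The lemmas below show that \<open>\<theta>\<close> is
  onto and has the same fibres as \<open>r \<mapsto> e \<pi> r\<close>, which identifies
  \<open>R_M\<close> with \<open>Ae\<close>.\<close>

definition \<theta> where "\<theta> r = loc_rel S R U `` {(r, \<one>)}"

lemma M_R: "M \<subseteq> R" using cring.ideal_facts(1)[OF crR primeideal.axioms(1)[OF M(1)]] by simp

lemmas inM = image_prime_R(2)[OF M]

lemma U_R[simp]: "u \<in> U \<Longrightarrow> u \<in> R" "u \<in> U \<Longrightarrow> u \<in> carrier S" unfolding U_def by auto

lemma U_mult[simp]: "u \<in> U \<Longrightarrow> v \<in> U \<Longrightarrow> u \<otimes> v \<in> U"
  unfolding U_def using primeideal.I_prime[OF M(1), of u v] by auto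

lemma U_one[simp]: "\<one> \<in> U"
  unfolding U_def using ideal.one_imp_carrier[OF primeideal.axioms(1)[OF M(1)]] primeideal.I_notcarr[OF M(1)] by auto

lemma two_primes:
  obtains Q1 Q2 where "primeideal Q1 S" "primeideal Q2 S" "Q1 \<noteq> Q2" "Q1 \<inter> R = M" "Q2 \<inter> R = M"
proof -
  obtain f g where fg: "f \<in> X.Fe e" "g \<in> X.Fe e" "f \<noteq> g" using X.Fe_two[OF e] by auto
  let ?v = "\<lambda>P. {s \<in> carrier S. \<pi> s \<in> P}"
  have pr: "primeideal (X.Q f) B" "primeideal (X.Q g) B" using X.Q_prime X.Fe_F(1) fg by auto
  have ne: "X.Q f \<noteq> X.Q g" using X.Q_inj X.Fe_F(1) fg by auto
  have "?v (X.Q f) \<noteq> ?v (X.Q g)"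
  proof
    assume eq: "?v (X.Q f) = ?v (X.Q g)"
    show False using ne image_vimage[OF B.ideal_facts(1)[OF primeideal.axioms(1)[OF pr(1)]]]
        image_vimage[OF B.ideal_facts(1)[OF primeideal.axioms(1)[OF pr(2)]]] unfolding eq by simp
  qed
  moreover have "?v (X.Q f) \<inter> R = M"
    by (rule vimage_Int_R[OF _ inM M_R]) (simp_all add: X.Q_Int_A[OF e fg(1)] Me)
  moreover have "?v (X.Q g) \<inter> R = M"
    by (rule vimage_Int_R[OF _ inM M_R]) (simp_all add: X.Q_Int_A[OF e fg(2)] Me)
  ultimately show ?thesis using that[OF vimage_prime[OF pr(1)] vimage_prime[OF pr(2)]] by simp
qed

lemma C_local: assumes "c \<in> C" shows "\<exists>u\<in>U. u \<otimes> c = \<zero>"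
proof -
  obtain Q1 Q2 where Q: "primeideal Q1 S" "primeideal Q2 S" "Q1 \<noteq> Q2" "Q1 \<inter> R = M" "Q2 \<inter> R = M" by (rule two_primes)
  have "flat_ext S R" using et unfolding etale_def by simp
  then obtain u where "u \<in> R" "u \<notin> Q1" "u \<otimes> c = \<zero>"
    using conductor_locally_zero[OF crS R _ Q(1-3), of c] Q assms unfolding C_def by auto
  then show ?thesis unfolding U_def using Q by auto
qed

text \<open>One of two distinct primes over \<open>M\<close> contains an \<open>s\<close> outside
  the other. If \<open>t s\<close> were in \<open>R\<close> for some \<open>t\<close> outside
  \<open>M\<close>, it would lie in \<open>M\<close>, hence in the other prime, which contains
  neither factor.\<close>

lemma M_supp: "M \<in> supp S R"
proof -
  have key: "M \<in> supp S R" if Q: "primeideal Q1 S" "primeideal Q2 S" "\<not> Q1 \<subseteq> Q2" "Q1 \<inter> R = M" "Q2 \<inter> R = M" for Q1 Q2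
  proof -
    obtain s where s: "s \<in> Q1" "s \<notin> Q2" using Q by auto
    note q1 = ideal_facts[OF primeideal.axioms(1)[OF Q(1)]]
    have sc: "s \<in> carrier S" using s q1(1) by auto
    have "t \<otimes> s \<notin> R" if t: "t \<in> R - M" for t
    proof
      assume ts: "t \<otimes> s \<in> R"
      have "t \<otimes> s \<in> Q1" using q1(4) s t by auto
      then have "t \<otimes> s \<in> Q2" using ts Q by auto
      then show False using primeideal.I_prime[OF Q(2), of t s] s sc t Q by auto
    qed
    then show ?thesis unfolding supp_def using M(1) sc by auto
  qed
  obtain Q1 Q2 where Q: "primeideal Q1 S" "primeideal Q2 S" "Q1 \<noteq> Q2" "Q1 \<inter> R = M" "Q2 \<inter> R = M" by (rule two_primes)
  then show ?thesis using key[of Q1 Q2] key[of Q2 Q1] by blast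
qed

lemma pi_unit:
  assumes "u \<in> U" shows "\<exists>t\<in>R. \<pi> u \<otimes>\<^bsub>B\<^esub> \<pi> t \<otimes>\<^bsub>B\<^esub> e = e"
proof -
  have "\<pi> u \<in> A" "\<pi> u \<notin> X.M e" using assms inM Me unfolding A_def U_def by auto
  then show ?thesis using X.M_unit[OF e, of "\<pi> u"] unfolding A_def by auto
qed

text \<open>An element of \<open>U\<close> is invertible at \<open>e\<close>, which gives one
  direction. Conversely a lift \<open>\<epsilon>\<close> of \<open>e\<close> lies in
  \<open>U\<close> and moves \<open>r\<close> into \<open>C\<close>, and each element of
  \<open>C\<close> is killed by some element of \<open>U\<close>.\<close>

lemma kernel:
  assumes r: "r \<in> R"
  shows "(\<exists>u\<in>U. u \<otimes> r = \<zero>) \<longleftrightarrow> e \<otimes>\<^bsub>B\<^esub> \<pi> r = \<zero>\<^bsub>B\<^esub>"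
proof
  note e' = X.E_idem[OF e]
  assume "\<exists>u\<in>U. u \<otimes> r = \<zero>"
  then obtain u where u: "u \<in> U" "u \<otimes> r = \<zero>" by auto
  obtain t where t: "t \<in> R" "\<pi> u \<otimes>\<^bsub>B\<^esub> \<pi> t \<otimes>\<^bsub>B\<^esub> e = e" using pi_unit[OF u(1)] by auto
  have c: "\<pi> u \<in> carrier B" "\<pi> t \<in> carrier B" "\<pi> r \<in> carrier B" "e \<in> carrier B" using u(1) t(1) r e' by auto
  have "e \<otimes>\<^bsub>B\<^esub> \<pi> r = \<pi> u \<otimes>\<^bsub>B\<^esub> \<pi> t \<otimes>\<^bsub>B\<^esub> e \<otimes>\<^bsub>B\<^esub> \<pi> r" using t(2) by simp
  also have "\<dots> = \<pi> t \<otimes>\<^bsub>B\<^esub> e \<otimes>\<^bsub>B\<^esub> (\<pi> u \<otimes>\<^bsub>B\<^esub> \<pi> r)" using c by (simp add: B.m_ac)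
  also have "\<pi> u \<otimes>\<^bsub>B\<^esub> \<pi> r = \<pi> (u \<otimes> r)" using u(1) r by simp
  finally show "e \<otimes>\<^bsub>B\<^esub> \<pi> r = \<zero>\<^bsub>B\<^esub>" unfolding u(2) using c by simp
next
  note e' = X.E_idem[OF e]
  assume z: "e \<otimes>\<^bsub>B\<^esub> \<pi> r = \<zero>\<^bsub>B\<^esub>"
  obtain \<epsilon> where \<epsilon>: "\<epsilon> \<in> R" "e = \<pi> \<epsilon>" using e'(1) unfolding A_def by auto
  have "e \<notin> X.M e" using X.M_not_unit[OF e, of e "\<one>\<^bsub>B\<^esub>"] e' by auto
  then have \<epsilon>U: "\<epsilon> \<in> U" unfolding U_def using \<epsilon> inM Me by auto
  have "\<pi> (\<epsilon> \<otimes> r) = \<zero>\<^bsub>B\<^esub>" using z \<epsilon> r by simp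
  then have "\<epsilon> \<otimes> r \<in> C" using pi_zero_iff[of "\<epsilon> \<otimes> r"] \<epsilon> r by simp
  then obtain u where u: "u \<in> U" "u \<otimes> (\<epsilon> \<otimes> r) = \<zero>" using C_local by auto
  then have "(u \<otimes> \<epsilon>) \<otimes> r = \<zero>" using \<epsilon>(1) r by (simp add: m_assoc)
  then show "\<exists>u\<in>U. u \<otimes> r = \<zero>" using U_mult[OF u(1) \<epsilon>U] by blast
qed

lemma loc_rel_iff:
  "((a, s), (b, t)) \<in> loc_rel S R U \<longleftrightarrow> a \<in> R \<and> b \<in> R \<and> s \<in> U \<and> t \<in> U \<and> (\<exists>u\<in>U. u \<otimes> (a \<otimes> t \<ominus> b \<otimes> s) = \<zero>)"
  unfolding loc_rel_def by simp

lemma loc_equiv: "equiv (R \<times> U) (loc_rel S R U)"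
proof (rule equivI)
  show "loc_rel S R U \<subseteq> (R \<times> U) \<times> (R \<times> U)" unfolding loc_rel_def by auto
  show "refl_on (R \<times> U) (loc_rel S R U)"
  proof (rule refl_onI)
    fix x assume "x \<in> R \<times> U"
    then obtain a s where x: "x = (a, s)" "a \<in> R" "s \<in> U" by auto
    have "\<one> \<otimes> (a \<otimes> s \<ominus> a \<otimes> s) = \<zero>" using x by (simp add: minus_eq r_neg)
    then show "(x, x) \<in> loc_rel S R U" unfolding x(1) loc_rel_iff using x U_one by blast
  qed
  show "sym (loc_rel S R U)"
  proof (rule symI)
    fix x y assume xy: "(x, y) \<in> loc_rel S R U"
    obtain a s b t where [simp]: "x = (a, s)" "y = (b, t)" by (cases x, cases y) auto
    obtain u where u: "a \<in> R" "b \<in> R" "s \<in> U" "t \<in> U" "u \<in> U" "u \<otimes> (a \<otimes> t \<ominus> b \<otimes> s) = \<zero>"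
      using xy by (auto simp: loc_rel_iff)
    have c: "a \<in> carrier S" "b \<in> carrier S" "s \<in> carrier S" "t \<in> carrier S" "u \<in> carrier S" using u(1-5) by auto
    have "u \<otimes> (b \<otimes> s \<ominus> a \<otimes> t) = \<ominus> (u \<otimes> (a \<otimes> t \<ominus> b \<otimes> s))" using c by algebra
    then have "u \<otimes> (b \<otimes> s \<ominus> a \<otimes> t) = \<zero>" unfolding u(6) by simp
    then show "(y, x) \<in> loc_rel S R U" using u by (auto simp: loc_rel_iff)
  qed
  show "trans (loc_rel S R U)"
  proof (rule transI)
    fix x y z assume xy: "(x, y) \<in> loc_rel S R U" and yz: "(y, z) \<in> loc_rel S R U"
    obtain a s b t c w where [simp]: "x = (a, s)" "y = (b, t)" "z = (c, w)" by (cases x, cases y, cases z) auto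
    obtain u where u: "a \<in> R" "b \<in> R" "s \<in> U" "t \<in> U" "u \<in> U" "u \<otimes> (a \<otimes> t \<ominus> b \<otimes> s) = \<zero>"
      using xy by (auto simp: loc_rel_iff)
    obtain v where v: "c \<in> R" "w \<in> U" "v \<in> U" "v \<otimes> (b \<otimes> w \<ominus> c \<otimes> t) = \<zero>"
      using yz by (auto simp: loc_rel_iff)
    have cc: "a \<in> carrier S" "b \<in> carrier S" "s \<in> carrier S" "t \<in> carrier S" "u \<in> carrier S"
      "c \<in> carrier S" "w \<in> carrier S" "v \<in> carrier S" using u(1-5) v(1-3) by auto
    have "(u \<otimes> v \<otimes> t) \<otimes> (a \<otimes> w \<ominus> c \<otimes> s) = v \<otimes> w \<otimes> (u \<otimes> (a \<otimes> t \<ominus> b \<otimes> s)) \<oplus> u \<otimes> s \<otimes> (v \<otimes> (b \<otimes> w \<ominus> c \<otimes> t))"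
      using cc by algebra
    then have "(u \<otimes> v \<otimes> t) \<otimes> (a \<otimes> w \<ominus> c \<otimes> s) = \<zero>" unfolding u(6) v(4) using cc by simp
    moreover have "u \<otimes> v \<otimes> t \<in> U" using u v by simp
    ultimately show "(x, z) \<in> loc_rel S R U" using u v by (auto simp: loc_rel_iff)
  qed
qed

lemma theta_mem: "(a, s) \<in> \<theta> r \<longleftrightarrow> r \<in> R \<and> a \<in> R \<and> s \<in> U \<and> (\<exists>u\<in>U. u \<otimes> (r \<otimes> s \<ominus> a) = \<zero>)"
proof -
  have "(a, s) \<in> \<theta> r \<longleftrightarrow> r \<in> R \<and> a \<in> R \<and> s \<in> U \<and> (\<exists>u\<in>U. u \<otimes> (r \<otimes> s \<ominus> a \<otimes> \<one>) = \<zero>)"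
    unfolding \<theta>_def by (auto simp: loc_rel_iff)
  then show ?thesis by (cases "a \<in> R") auto
qed

lemma theta_eq:
  assumes "a \<in> R" "b \<in> R"
  shows "\<theta> a = \<theta> b \<longleftrightarrow> e \<otimes>\<^bsub>B\<^esub> \<pi> a = e \<otimes>\<^bsub>B\<^esub> \<pi> b"
proof -
  note e' = X.E_idem[OF e]
  have c: "\<pi> a \<in> carrier B" "\<pi> b \<in> carrier B" "e \<in> carrier B" using assms e' by auto
  have "\<theta> a = \<theta> b \<longleftrightarrow> ((a, \<one>), (b, \<one>)) \<in> loc_rel S R U"
    unfolding \<theta>_def using eq_equiv_class_iff[OF loc_equiv, of "(a, \<one>)" "(b, \<one>)"] assms by auto
  also have "\<dots> \<longleftrightarrow> (\<exists>u\<in>U. u \<otimes> (a \<ominus> b) = \<zero>)" using assms by (auto simp: loc_rel_iff)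
  also have "\<dots> \<longleftrightarrow> e \<otimes>\<^bsub>B\<^esub> \<pi> (a \<ominus> b) = \<zero>\<^bsub>B\<^esub>" using kernel[of "a \<ominus> b"] assms by simp
  also have "e \<otimes>\<^bsub>B\<^esub> \<pi> (a \<ominus> b) = e \<otimes>\<^bsub>B\<^esub> \<pi> a \<ominus>\<^bsub>B\<^esub> e \<otimes>\<^bsub>B\<^esub> \<pi> b"
    using assms c by (simp add: pi_minus B.minus_eq B.r_distr B.r_minus)
  also have "\<dots> = \<zero>\<^bsub>B\<^esub> \<longleftrightarrow> e \<otimes>\<^bsub>B\<^esub> \<pi> a = e \<otimes>\<^bsub>B\<^esub> \<pi> b" using c by simp
  finally show ?thesis .
qed

text \<open>The operations of the localization saturate a set of pairs built from all
  representatives. To evaluate them it suffices that this set contains \<open>(r, \<one>)\<close>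
  and stays within its class.\<close>

lemma theta_image_class:
  assumes r: "r \<in> R" and Z: "(r, \<one>) \<in> Z" "Z \<subseteq> \<theta> r"
  shows "loc_rel S R U `` Z = \<theta> r"
proof (intro equalityI subsetI)
  fix w assume "w \<in> loc_rel S R U `` Z"
  then obtain z where z: "z \<in> Z" "(z, w) \<in> loc_rel S R U" by auto
  then have "((r, \<one>), z) \<in> loc_rel S R U" using Z unfolding \<theta>_def by auto
  then have "((r, \<one>), w) \<in> loc_rel S R U" using z loc_equiv unfolding equiv_def by (meson transE)
  then show "w \<in> \<theta> r" unfolding \<theta>_def by auto
qed (use Z in \<open>auto simp: \<theta>_def\<close>)

lemma theta_self: "r \<in> R \<Longrightarrow> (r, \<one>) \<in> \<theta> r"
  unfolding \<theta>_def using equiv_class_self[OF loc_equiv, of "(r, \<one>)"] by simp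

lemma theta_mult:
  assumes "a \<in> R" "b \<in> R" shows "loc_mult S R U (\<theta> a) (\<theta> b) = \<theta> (a \<otimes> b)"
  unfolding loc_mult_def
proof (rule theta_image_class)
  show "a \<otimes> b \<in> R" using assms by simp
  show "(a \<otimes> b, \<one>) \<in> {z. \<exists>a' s b' t. (a', s) \<in> \<theta> a \<and> (b', t) \<in> \<theta> b \<and> z = (a' \<otimes> b', s \<otimes> t)}"
    using theta_self[OF assms(1)] theta_self[OF assms(2)] by force
  show "{z. \<exists>a' s b' t. (a', s) \<in> \<theta> a \<and> (b', t) \<in> \<theta> b \<and> z = (a' \<otimes> b', s \<otimes> t)} \<subseteq> \<theta> (a \<otimes> b)"
  proof clarify
    fix a' s b' t assume h: "(a', s) \<in> \<theta> a" "(b', t) \<in> \<theta> b"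
    obtain u where u: "a' \<in> R" "s \<in> U" "u \<in> U" "u \<otimes> (a \<otimes> s \<ominus> a') = \<zero>" using h(1) unfolding theta_mem by auto
    obtain v where v: "b' \<in> R" "t \<in> U" "v \<in> U" "v \<otimes> (b \<otimes> t \<ominus> b') = \<zero>" using h(2) unfolding theta_mem by auto
    have c: "a \<in> carrier S" "b \<in> carrier S" "a' \<in> carrier S" "b' \<in> carrier S" "s \<in> carrier S" "t \<in> carrier S"
      "u \<in> carrier S" "v \<in> carrier S" using assms u(1-3) v(1-3) by auto
    have "(u \<otimes> v) \<otimes> (a \<otimes> b \<otimes> (s \<otimes> t) \<ominus> a' \<otimes> b') = v \<otimes> b \<otimes> t \<otimes> (u \<otimes> (a \<otimes> s \<ominus> a')) \<oplus> u \<otimes> a' \<otimes> (v \<otimes> (b \<otimes> t \<ominus> b'))"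
      using c by algebra
    then have "(u \<otimes> v) \<otimes> (a \<otimes> b \<otimes> (s \<otimes> t) \<ominus> a' \<otimes> b') = \<zero>" unfolding u(4) v(4) using c by simp
    then show "(a' \<otimes> b', s \<otimes> t) \<in> \<theta> (a \<otimes> b)" unfolding theta_mem using assms u(1-3) v(1-3) U_mult[OF u(3) v(3)] by auto
  qed
qed

lemma theta_add:
  assumes "a \<in> R" "b \<in> R" shows "loc_add S R U (\<theta> a) (\<theta> b) = \<theta> (a \<oplus> b)"
  unfolding loc_add_def
proof (rule theta_image_class)
  show "a \<oplus> b \<in> R" using assms by simp
  show "(a \<oplus> b, \<one>) \<in> {z. \<exists>a' s b' t. (a', s) \<in> \<theta> a \<and> (b', t) \<in> \<theta> b \<and> z = (a' \<otimes> t \<oplus> b' \<otimes> s, s \<otimes> t)}"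
    using theta_self[OF assms(1)] theta_self[OF assms(2)] assms by force
  show "{z. \<exists>a' s b' t. (a', s) \<in> \<theta> a \<and> (b', t) \<in> \<theta> b \<and> z = (a' \<otimes> t \<oplus> b' \<otimes> s, s \<otimes> t)} \<subseteq> \<theta> (a \<oplus> b)"
  proof clarify
    fix a' s b' t assume h: "(a', s) \<in> \<theta> a" "(b', t) \<in> \<theta> b"
    obtain u where u: "a' \<in> R" "s \<in> U" "u \<in> U" "u \<otimes> (a \<otimes> s \<ominus> a') = \<zero>" using h(1) unfolding theta_mem by auto
    obtain v where v: "b' \<in> R" "t \<in> U" "v \<in> U" "v \<otimes> (b \<otimes> t \<ominus> b') = \<zero>" using h(2) unfolding theta_mem by auto
    have c: "a \<in> carrier S" "b \<in> carrier S" "a' \<in> carrier S" "b' \<in> carrier S" "s \<in> carrier S" "t \<in> carrier S"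
      "u \<in> carrier S" "v \<in> carrier S" using assms u(1-3) v(1-3) by auto
    have "(u \<otimes> v) \<otimes> ((a \<oplus> b) \<otimes> (s \<otimes> t) \<ominus> (a' \<otimes> t \<oplus> b' \<otimes> s)) = v \<otimes> t \<otimes> (u \<otimes> (a \<otimes> s \<ominus> a')) \<oplus> u \<otimes> s \<otimes> (v \<otimes> (b \<otimes> t \<ominus> b'))"
      using c by algebra
    then have "(u \<otimes> v) \<otimes> ((a \<oplus> b) \<otimes> (s \<otimes> t) \<ominus> (a' \<otimes> t \<oplus> b' \<otimes> s)) = \<zero>" unfolding u(4) v(4) using c by simp
    then show "(a' \<otimes> t \<oplus> b' \<otimes> s, s \<otimes> t) \<in> \<theta> (a \<oplus> b)" unfolding theta_mem using assms u(1-3) v(1-3) U_mult[OF u(3) v(3)] by auto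
  qed
qed

lemma theta_inverse:
  assumes "s \<in> U" shows "\<exists>t\<in>R. \<theta> (s \<otimes> t) = \<theta> \<one>"
proof -
  note e' = X.E_idem[OF e]
  obtain t where t: "t \<in> R" "\<pi> s \<otimes>\<^bsub>B\<^esub> \<pi> t \<otimes>\<^bsub>B\<^esub> e = e" using pi_unit[OF assms] by auto
  have "e \<otimes>\<^bsub>B\<^esub> \<pi> (s \<otimes> t) = \<pi> s \<otimes>\<^bsub>B\<^esub> \<pi> t \<otimes>\<^bsub>B\<^esub> e" using assms t(1) e'(1) by (simp add: B.m_comm)
  also have "\<dots> = e \<otimes>\<^bsub>B\<^esub> \<pi> \<one>" using t(2) e'(1) by simp
  finally show ?thesis using theta_eq[of "s \<otimes> t" \<one>] assms t(1) by auto
qed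

text \<open>Denominators are already invertible at \<open>e\<close>, so \<open>s t\<close> and
  \<open>\<one>\<close> have the same image for a suitable \<open>t \<in> R\<close>, and the
  fraction \<open>a/s\<close> equals \<open>(a t)/1\<close>.\<close>

lemma loc_carrier: "carrier (loc_at S R M) = \<theta> ` R"
proof (intro equalityI subsetI)
  fix x assume "x \<in> carrier (loc_at S R M)"
  then have "x \<in> (R \<times> U) // loc_rel S R U" unfolding localization_def U_def by simp
  then obtain a s where x: "x = loc_rel S R U `` {(a, s)}" "a \<in> R" "s \<in> U" by (auto elim!: quotientE)
  obtain t where t: "t \<in> R" "\<theta> (s \<otimes> t) = \<theta> \<one>" using theta_inverse[OF x(3)] by auto
  have "(\<one>, \<one>) \<in> \<theta> (s \<otimes> t)" unfolding t(2) using theta_self by simp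
  then obtain u where u: "u \<in> U" "u \<otimes> (s \<otimes> t \<otimes> \<one> \<ominus> \<one>) = \<zero>" unfolding theta_mem by auto
  have c: "a \<in> carrier S" "s \<in> carrier S" "t \<in> carrier S" "u \<in> carrier S" "\<one> \<in> carrier S" using x t u by auto
  have "u \<otimes> (a \<otimes> t \<otimes> s \<ominus> a \<otimes> \<one>) = a \<otimes> (u \<otimes> (s \<otimes> t \<otimes> \<one> \<ominus> \<one>))" using c by algebra
  then have "u \<otimes> (a \<otimes> t \<otimes> s \<ominus> a \<otimes> \<one>) = \<zero>" unfolding u(2) using c by simp
  then have "((a \<otimes> t, \<one>), (a, s)) \<in> loc_rel S R U" unfolding loc_rel_iff using x t u U_one by auto
  then have "x = \<theta> (a \<otimes> t)" unfolding x(1) \<theta>_def using equiv_class_eq[OF loc_equiv] by blast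
  then show "x \<in> \<theta> ` R" using x t by auto
next
  fix x assume "x \<in> \<theta> ` R"
  then obtain r where "x = loc_rel S R U `` {(r, \<one>)}" "r \<in> R" unfolding \<theta>_def by auto
  then show "x \<in> carrier (loc_at S R M)"
    unfolding localization_def U_def[symmetric] by (auto intro!: quotientI)
qed

sublocale loc: local_image "S\<lparr>carrier := R\<rparr>" "loc_at S R M" \<theta> M
proof (intro local_image.intro local_image_axioms.intro)
  show "cring (S\<lparr>carrier := R\<rparr>)" by (rule crR)
  show "carrier (loc_at S R M) = \<theta> ` carrier (S\<lparr>carrier := R\<rparr>)" using loc_carrier by simp
  show "\<theta> (a \<otimes>\<^bsub>S\<lparr>carrier := R\<rparr>\<^esub> b) = \<theta> a \<otimes>\<^bsub>loc_at S R M\<^esub> \<theta> b"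
    if "a \<in> carrier (S\<lparr>carrier := R\<rparr>)" "b \<in> carrier (S\<lparr>carrier := R\<rparr>)" for a b
    using theta_mult[of a b] that unfolding localization_def U_def by simp
  show "\<theta> (a \<oplus>\<^bsub>S\<lparr>carrier := R\<rparr>\<^esub> b) = \<theta> a \<oplus>\<^bsub>loc_at S R M\<^esub> \<theta> b"
    if "a \<in> carrier (S\<lparr>carrier := R\<rparr>)" "b \<in> carrier (S\<lparr>carrier := R\<rparr>)" for a b
    using theta_add[of a b] that unfolding localization_def U_def by simp
  show one: "\<theta> \<one>\<^bsub>S\<lparr>carrier := R\<rparr>\<^esub> = \<one>\<^bsub>loc_at S R M\<^esub>" unfolding localization_def \<theta>_def U_def by simp
  show "\<theta> \<zero>\<^bsub>S\<lparr>carrier := R\<rparr>\<^esub> = \<zero>\<^bsub>loc_at S R M\<^esub>" unfolding localization_def \<theta>_def U_def by simp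
  show "ideal M (S\<lparr>carrier := R\<rparr>)" by (rule primeideal.axioms(1)[OF M(1)])
  show "\<exists>b\<in>carrier (S\<lparr>carrier := R\<rparr>). \<theta> (a \<otimes>\<^bsub>S\<lparr>carrier := R\<rparr>\<^esub> b) = \<one>\<^bsub>loc_at S R M\<^esub>"
    if "a \<in> carrier (S\<lparr>carrier := R\<rparr>)" "a \<notin> M" for a
    using theta_inverse[of a] that one unfolding U_def by auto
  show "\<theta> (a \<otimes>\<^bsub>S\<lparr>carrier := R\<rparr>\<^esub> b) \<noteq> \<one>\<^bsub>loc_at S R M\<^esub>" if ab: "a \<in> M" "b \<in> carrier (S\<lparr>carrier := R\<rparr>)" for a b
  proof
    assume "\<theta> (a \<otimes>\<^bsub>S\<lparr>carrier := R\<rparr>\<^esub> b) = \<one>\<^bsub>loc_at S R M\<^esub>"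
    then have "\<theta> (a \<otimes> b) = \<theta> \<one>" using one by simp
    moreover have abR: "a \<in> R" "b \<in> R" using ab M_R by auto
    ultimately have "e \<otimes>\<^bsub>B\<^esub> \<pi> (a \<otimes> b) = e \<otimes>\<^bsub>B\<^esub> \<pi> \<one>" using theta_eq[of "a \<otimes> b" \<one>] by simp
    then have "\<pi> a \<otimes>\<^bsub>B\<^esub> \<pi> b \<otimes>\<^bsub>B\<^esub> e = e" using abR X.E_idem[OF e] by (simp add: B.m_comm)
    moreover have "\<pi> a \<in> X.M e" "\<pi> b \<in> A" using ab abR Me unfolding A_def by auto
    ultimately show False using X.M_not_unit[OF e] by blast
  qed
qed

lemma finite_loc_iff: "finite (carrier (loc_at S R M)) \<longleftrightarrow> finite ((\<lambda>a. e \<otimes>\<^bsub>B\<^esub> a) ` A)"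
proof -
  have eA: "(\<lambda>a. e \<otimes>\<^bsub>B\<^esub> a) ` A = (\<lambda>r. e \<otimes>\<^bsub>B\<^esub> \<pi> r) ` R" unfolding A_def by auto
  show ?thesis unfolding loc_carrier eA
  proof
    assume "finite (\<theta> ` R)"
    then show "finite ((\<lambda>r. e \<otimes>\<^bsub>B\<^esub> \<pi> r) ` R)" by (rule finite_image_factor) (simp only: theta_eq)
  next
    assume "finite ((\<lambda>r. e \<otimes>\<^bsub>B\<^esub> \<pi> r) ` R)"
    then show "finite (\<theta> ` R)" by (rule finite_image_factor) (simp only: theta_eq)
  qed
qed

lemma card_primes: "card {Q. primeideal Q S \<and> Q \<inter> R = M} = card (X.Fe e)"
  using primes_over_bij[OF M] X.card_primes_over[OF e] unfolding Me by simp

lemma not_field_imp: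
  assumes "\<not> field (loc_at S R M)" shows "\<exists>y\<in>X.M e. e \<otimes>\<^bsub>B\<^esub> y \<noteq> \<zero>\<^bsub>B\<^esub>"
proof (rule ccontr)
  assume h: "\<not> ?thesis"
  have "\<theta> a = \<zero>\<^bsub>loc_at S R M\<^esub>" if a: "a \<in> M" for a
  proof -
    have "\<pi> a \<in> X.M e" using a Me by auto
    then have "e \<otimes>\<^bsub>B\<^esub> \<pi> a = e \<otimes>\<^bsub>B\<^esub> \<pi> \<zero>" using h X.E_idem[OF e] by auto
    then have "\<theta> a = \<theta> \<zero>" using theta_eq[of a \<zero>] a M_R by auto
    then show ?thesis using loc.zero by simp
  qed
  then show False using loc.field_L assms by blast
qed

lemma SPIR_loc:
  assumes x: "x \<in> X.M e" "e \<otimes>\<^bsub>B\<^esub> x \<noteq> \<zero>\<^bsub>B\<^esub>"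
    and gen: "\<And>y. y \<in> X.M e \<Longrightarrow> \<exists>z\<in>A. e \<otimes>\<^bsub>B\<^esub> y = e \<otimes>\<^bsub>B\<^esub> (x \<otimes>\<^bsub>B\<^esub> z)"
  shows "SPIR (loc_at S R M)"
proof -
  note e' = X.E_idem[OF e]
  obtain \<xi> where \<xi>: "\<xi> \<in> M" "x = \<pi> \<xi>" using x Me by blast
  have \<xi>R: "\<xi> \<in> R" using \<xi> M_R by auto
  obtain n :: nat where n: "x [^]\<^bsub>B\<^esub> n \<otimes>\<^bsub>B\<^esub> e = \<zero>\<^bsub>B\<^esub>" using x X.M_iff by blast
  have zR: "\<theta> \<zero> = \<zero>\<^bsub>loc_at S R M\<^esub>" using loc.zero by simp
  have powR: "\<xi> [^] n \<in> R" using \<xi>R by (induction n) auto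
  show ?thesis
  proof (rule loc.SPIR_L[OF \<xi>(1)])
    show "\<theta> \<xi> \<noteq> \<zero>\<^bsub>loc_at S R M\<^esub>" using theta_eq[of \<xi> \<zero>] \<xi> \<xi>R x(2) e' unfolding zR[symmetric] by simp
    have "e \<otimes>\<^bsub>B\<^esub> \<pi> (\<xi> [^] n) = \<zero>\<^bsub>B\<^esub>" using n \<xi> \<xi>R e' by (simp add: pi_pow B.m_comm)
    then have "\<theta> (\<xi> [^] n) = \<theta> \<zero>" using theta_eq[OF powR R_closed(1)] e' by simp
    then show "\<theta> (\<xi> [^]\<^bsub>S\<lparr>carrier := R\<rparr>\<^esub> n) = \<zero>\<^bsub>loc_at S R M\<^esub>"
      unfolding zR[symmetric] nat_pow_consistent[symmetric] .
    fix y assume y: "y \<in> M"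
    have yR: "y \<in> R" using y M_R by auto
    obtain z where z: "z \<in> A" "e \<otimes>\<^bsub>B\<^esub> \<pi> y = e \<otimes>\<^bsub>B\<^esub> (x \<otimes>\<^bsub>B\<^esub> z)" using gen[of "\<pi> y"] y Me by blast
    obtain \<zeta> where \<zeta>: "\<zeta> \<in> R" "z = \<pi> \<zeta>" using z unfolding A_def by auto
    have "\<theta> y = \<theta> (\<xi> \<otimes> \<zeta>)" using theta_eq[of y "\<xi> \<otimes> \<zeta>"] yR \<xi>R \<zeta> \<xi> z(2) by simp
    then show "\<exists>z\<in>carrier (S\<lparr>carrier := R\<rparr>). \<theta> y = \<theta> (\<xi> \<otimes>\<^bsub>S\<lparr>carrier := R\<rparr>\<^esub> z)" using \<zeta> by auto
  qed
qed

end

section \<open>The two implications, by passing between supporting primes and idempotents of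
  \<open>A\<close>\<close>

context etale_gilmer
begin

lemma FIP_characterization:
  "FIP S R \<longleftrightarrow> FMIR (S\<lparr>carrier := R\<rparr> Quot C) \<and>
     (\<forall>M\<in>supp S R. SPIR (loc_at S R M) \<and> infinite (carrier (loc_at S R M)) \<longrightarrow>
        card {Q. primeideal Q S \<and> Q \<inter> R = M} = 2)" (is "_ \<longleftrightarrow> ?F \<and> ?H")
proof -
  obtain E F where "art_ext B A E F" using art_ext_exists by auto
  then interpret X: art_ext B A E F .
  show ?thesis
  proof
    assume "FIP S R"
    then have fip: "FIP B A" using FIP_iff by simp
    have ?F using X.FIP_imp_FMIR[OF fip] unfolding sub_quot .
    moreover have ?H
    proof (intro ballI impI)
      fix M assume Ms: "M \<in> supp S R" and sp: "SPIR (loc_at S R M) \<and> infinite (carrier (loc_at S R M))"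
      note M = supp_prime[OF Ms]
      \<comment> \<open>The image of \<open>M\<close> in the Artinian ring \<open>A\<close> is a
        prime, so it is the radical at one of the idempotents in \<open>E\<close>.\<close>
      obtain e where e: "e \<in> E" "\<pi> ` M = X.M e"
        using cring.prime_eq_idem_rad[OF X.cringA X.artA _ image_prime_R(1)[OF M], of E] X.E by auto
      interpret Y: etale_prime S R E F M e
        by (intro etale_prime.intro etale_prime_axioms.intro etale_gilmer_axioms X.art_ext_axioms M e)
      have "\<not> field (loc_at S R M)" using sp unfolding SPIR_def by auto
      then show "card {Q. primeideal Q S \<and> Q \<inter> R = M} = 2"
        using X.FIP_card_two[OF fip e(1)] Y.not_field_imp Y.finite_loc_iff sp Y.card_primes by simp
    qed
    ultimately show "?F \<and> ?H" by simp
  next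
    assume FH: "?F \<and> ?H"
    then have fm: "FMIR (B\<lparr>carrier := A\<rparr>)" unfolding sub_quot by simp
    have "FIP B A"
    proof (rule X.FIP_if[OF fm])
      fix e x assume e: "e \<in> E" and inf: "infinite ((\<lambda>a. e \<otimes>\<^bsub>B\<^esub> a) ` A)"
        and x: "x \<in> X.M e" "e \<otimes>\<^bsub>B\<^esub> x \<noteq> \<zero>\<^bsub>B\<^esub>"
        and gen: "\<And>y. y \<in> X.M e \<Longrightarrow> \<exists>z\<in>A. e \<otimes>\<^bsub>B\<^esub> y = e \<otimes>\<^bsub>B\<^esub> (x \<otimes>\<^bsub>B\<^esub> z)"
      \<comment> \<open>Every \<open>e \<in> E\<close> arises from a prime of the support: the
        inverse image \<open>M\<close> of the radical at \<open>e\<close> contains \<open>C\<close>,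
        and \<open>M_supp\<close> puts it into \<open>supp S R\<close> because at least two primes
        of \<open>S\<close> lie over it.\<close>
      define M where "M = {r \<in> R. \<pi> r \<in> X.M e}"
      interpret R: cring "S\<lparr>carrier := R\<rparr>" by (rule crR)
      note m = X.M_facts[OF e] and p = X.M_prime[OF e]
      have rA: "r \<in> R \<Longrightarrow> \<pi> r \<in> A" for r unfolding A_def by auto
      have im: "\<pi> ` M = X.M e" using m(1) unfolding M_def A_def by auto
      have CM: "C \<subseteq> M"
      proof
        fix c assume c: "c \<in> C"
        then have "\<pi> c = \<zero>\<^bsub>B\<^esub>" using pi_zero_iff[of c] C_R[OF c] by simp
        then show "c \<in> M" unfolding M_def using C_R[OF c] m(2) by simp
      qed
      have pM: "primeideal M (S\<lparr>carrier := R\<rparr>)"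
      proof (rule primeidealI)
        show "ideal M (S\<lparr>carrier := R\<rparr>)"
          using m rA unfolding M_def by (intro R.cring_idealI) auto
        show "cring (S\<lparr>carrier := R\<rparr>)" by (rule crR)
        have "\<one> \<notin> M" unfolding M_def using m(8) by simp
        then show "carrier (S\<lparr>carrier := R\<rparr>) \<noteq> M" by auto
        fix a b assume "a \<in> carrier (S\<lparr>carrier := R\<rparr>)" "b \<in> carrier (S\<lparr>carrier := R\<rparr>)" "a \<otimes>\<^bsub>S\<lparr>carrier := R\<rparr>\<^esub> b \<in> M"
        then show "a \<in> M \<or> b \<in> M" using primeideal.I_prime[OF p, of "\<pi> a" "\<pi> b"] rA unfolding M_def by auto
      qed
      interpret Y: etale_prime S R E F M e
        by (intro etale_prime.intro etale_prime_axioms.intro etale_gilmer_axioms X.art_ext_axioms pM CM e im)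
      have "SPIR (loc_at S R M)" using Y.SPIR_loc[OF x gen] .
      then have "card {Q. primeideal Q S \<and> Q \<inter> R = M} = 2"
        using FH Y.M_supp Y.finite_loc_iff inf by blast
      then show "card (X.Fe e) = 2" using Y.card_primes by simp
    qed
    then show "FIP S R" using FIP_iff by simp
  qed
qed

end

theorem theorem3p7:
  fixes S :: "'a ring" and R :: "'a set"
  assumes "cring S" and "subring R S"
    and "etale S R" and "infra_integral S R" and "gilmer_ext S R"
  shows "FIP S R \<longleftrightarrow>
           FMIR (subR S R Quot conductor S R) \<and>
           (\<forall>M \<in> supp S R. SPIR (loc_at S R M) \<and> infinite (carrier (loc_at S R M)) \<longrightarrow>
              card {Q. primeideal Q S \<and> Q \<inter> R = M} = 2)"
proof -
  interpret etale_gilmer S R by (rule etale_gilmer.intro[OF assms])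
  show ?thesis using FIP_characterization unfolding C_def .
qed

end
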